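(* Let $n\ge 1$ and let $\mathcal{D}_1,\ldots,\mathcal{D}_n$ be arbitrary continuous probability distributions on $\mathbb{R}$, known to the algorithm. In the secretary problem with distributions $\mathcal{D}_1,\ldots,\mathcal{D}_n$ there is an online algorithm that selects the largest draw with probability at least $\gamma$, where $\gamma$ is the optimal success probability when the distributions are all identical, namely $\gamma=(e^c-c-1)\int_c^\infty \frac{e^{-x}}{x}\,dx+e^{-c}\approx 0.5801$, with $c>0$ the unique solution of $\int_0^c\frac{e^x-1}{x}\,dx=1$.
   Context: The secretary problem with distributions: independent random variables $X_1,\ldots,X_n$ are drawn, $X_i\sim\mathcal{D}_i$. They are then presented to the algorithm one at a time in a uniformly random order, the order being independent of the draws. After observing each value the algorithm must irrevocably decide whether to accept it, and it may accept at most one value. The algorithm knows $\mathcal{D}_1,\ldots,\mathcal{D}_n$ in advance but does not know which distribution produced which presented value. It succeeds if the accepted value equals $\max_{k} X_k$. The success probability is taken over the draws, the random order, and any internal randomness of the algorithm. The constant $\gamma$ is the limit as $n\to\infty$, which is also the infimum over $n$, of the optimal success probability in the case where $X_1,\ldots,X_n$ are i.i.d. from a single known continuous distribution (the Gilbert–Mosteller full-information problem). *)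

theory Defs
  imports "HOL-Probability.Probability" "HOL-Combinatorics.Permutations"
begin

definition continuous_distribution :: "real measure \<Rightarrow> bool" where
  "continuous_distribution M \<longleftrightarrow> real_distribution M \<and> continuous_on UNIV (cdf M)"

text \<open>
  An algorithm carries its own internal randomness: a seed, drawn once from the probability
  space \<open>seed A\<close>, which the algorithm may choose freely. At time \<open>t\<close> (times start at \<open>0\<close>) it
  accepts iff \<open>accept A t \<omega> h\<close>, where \<open>\<omega>\<close> is the seed and \<open>h\<close> is the history of the
  presented values, as a function on \<open>{..t}\<close>. The decision thus depends neither on later values
  nor on the identity of the distributions that produced the observed ones.
\<close>

record algorithm =
  seed :: "(nat \<Rightarrow> real) measure"
  accept :: "nat \<Rightarrow> (nat \<Rightarrow> real) \<Rightarrow> (nat \<Rightarrow> real) \<Rightarrow> bool"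

definition online_algorithm :: "nat \<Rightarrow> algorithm \<Rightarrow> bool" where
  "online_algorithm n A \<longleftrightarrow>
     prob_space (seed A) \<and>
     (\<forall>t<n. (\<lambda>(\<omega>, h). accept A t \<omega> h)
        \<in> measurable (seed A \<Otimes>\<^sub>M (\<Pi>\<^sub>M i\<in>{..t}. borel)) (count_space UNIV))"

text \<open>
  A rule may say ``accept'' at several times; only the first of these is an actual acceptance,
  so at most one value is accepted.
\<close>

definition accepts_at :: "algorithm \<Rightarrow> (nat \<Rightarrow> real) \<Rightarrow> (nat \<Rightarrow> real) \<Rightarrow> nat \<Rightarrow> bool" where
  "accepts_at A \<omega> y t \<longleftrightarrow>
     accept A t \<omega> (restrict y {..t}) \<and> (\<forall>s<t. \<not> accept A s \<omega> (restrict y {..s}))"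

text \<open>
  An outcome \<open>(\<omega>, x, p)\<close> consists of the seed, the draws and the order of presentation, all
  independent: the value presented at time \<open>t\<close> is \<open>x (p t)\<close>.
\<close>

definition outcome_space :: "nat \<Rightarrow> (nat \<Rightarrow> real measure) \<Rightarrow> algorithm
    \<Rightarrow> ((nat \<Rightarrow> real) \<times> (nat \<Rightarrow> real) \<times> (nat \<Rightarrow> nat)) measure" where
  "outcome_space n D A =
     seed A \<Otimes>\<^sub>M ((\<Pi>\<^sub>M i\<in>{..<n}. D i) \<Otimes>\<^sub>M uniform_count_measure {p. p permutes {..<n}})"

definition success_prob :: "nat \<Rightarrow> (nat \<Rightarrow> real measure) \<Rightarrow> algorithm \<Rightarrow> real" where
  "success_prob n D A =
     measure (outcome_space n D A)
       {(\<omega>, x, p) \<in> space (outcome_space n D A).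
          \<exists>t<n. accepts_at A \<omega> (\<lambda>s. x (p s)) t \<and> x (p t) = Max (x ` {..<n})}"

definition optimal_success :: "nat \<Rightarrow> (nat \<Rightarrow> real measure) \<Rightarrow> real" where
  "optimal_success n D = (SUP A \<in> {A. online_algorithm n A}. success_prob n D A)"

text \<open>
  The integrand below has a removable singularity at \<open>0\<close>, where its value in HOL is \<open>0\<close>; this
  does not affect the integral.
\<close>

definition gamma_parameter :: "real \<Rightarrow> bool" where
  "gamma_parameter c \<longleftrightarrow> c > 0 \<and> integral {0..c} (\<lambda>x. (exp x - 1) / x) = 1"

definition gamma_value :: "real \<Rightarrow> real" where
  "gamma_value c = (exp c - c - 1) * integral {c..} (\<lambda>x. exp (- x) / x) + exp (- c)"

end

theory Submission
  imports Defs "HOL-Real_Asymp.Real_Asymp"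
begin

text \<open>
  Upper bound for identical distributions. With \<open>r\<close> values still to come and a current maximum
  that a fresh value exceeds with probability \<open>v\<close>, the success probability of any continuation
  is at most a potential of \<open>r\<close> and \<open>v\<close>. In the Poisson limit the optimal continuation value
  depends on \<open>z = r v\<close> only; it is the explicit function \<open>W\<close>, which increases to \<open>\<gamma>\<close>.
  The discrete dynamic programming step loses \<open>O(1/r\<^sup>2)\<close> against \<open>W\<close>, and the last \<open>r\<^sub>0\<close> values
  contain the maximum with probability about \<open>r\<^sub>0/n\<close>, so the total loss tends to \<open>0\<close>.

  Lower bound for arbitrary distributions. The algorithm draws \<open>n\<close> uniform arrival times and
  presents them in increasing order, so that the values have independent uniform arrival times.
  With \<open>F\<close> the distribution function of the overall maximum, it accepts the first record \<open>x\<close>,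
  arriving at time \<open>t\<close>, with \<open>F x \<ge> b t = exp (- c / (1 - t))\<close>. Suppose the maximum arrives at
  time \<open>t\<close> and exceeds its threshold. It is accepted unless the best earlier value exceeded its
  own threshold; as that value has a uniform arrival time \<open>s < t\<close>, this leads to the average over
  \<open>s\<close> of \<open>(1 - t)\<close> to the number of other values with \<open>F\<close> at least \<open>b s\<close>. Its expectation is
  estimated by \<open>1 - t + t p \<ge> p powr t\<close>, which replaces each distribution by infinitely many
  infinitesimal pieces of it, i.e. by the Poisson limit. The resulting double integral is \<open>\<gamma>\<close>.
\<close>

section \<open>The integrals defining the constant\<close>

text \<open>The constant c and the thresholds come from indifference in the Poisson limit. There the
  number of values with \<open>F\<close> at least u is Poisson with mean - ln u. A value on the
  threshold at time t is thus exceeded by \<open>\<beta> t\<close> values on average, of which (1 -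
  t) * \<open>\<beta> t\<close> = c are still to come. Accepting it wins with probability exp (-c).
  Waiting for the next better value wins iff the first better one is also the largest, so with
  probability exp (-c) times the sum of c^k / (k * k!) over k \<ge> 1. This sum is the integral that
  c makes equal to 1.

  For identical distributions the optimum is at least \<gamma> for every n, so the upper bound has
  to carry an error term. The step errors are summable, but only their tail is small; hence the
  crude treatment of the last r0 values.

  For general distributions the obstacle is that the maximum and the number of large values depend
  on each other. The loss is therefore written as a product over all items, to which independence
  applies. As the lower bound covers identical distributions too, limit and infimum follow
  together.\<close>

definition expq :: "real \<Rightarrow> real" where
  "expq x = (if x = 0 then 1 else (exp x - 1) / x)"

lemma isCont_expq: "isCont expq x"
proof (cases "x = 0")
  case True
  have "((\<lambda>h::real. (exp (0 + h) - exp 0) / h) \<longlongrightarrow> exp 0) (at 0)"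
    using DERIV_exp[of 0] unfolding DERIV_def .
  then have "((\<lambda>h::real. (exp h - 1) / h) \<longlongrightarrow> 1) (at 0)"
    by simp
  then have "(expq \<longlongrightarrow> 1) (at 0)"
    by (rule Lim_transform_eventually) (auto simp: expq_def eventually_at_filter)
  then show ?thesis using True by (simp add: isCont_def expq_def)
next
  case False
  have "isCont (\<lambda>x. (exp x - 1) / x) x"
    using False by (intro continuous_intros) auto
  moreover have "eventually (\<lambda>y. (exp y - 1) / y = expq y) (nhds x)"
    using False by (intro eventually_mono[OF t1_space_nhds[of x 0]]) (auto simp: expq_def)
  ultimately show ?thesis
    by (simp add: isCont_cong)
qed

lemma continuous_on_expq: "continuous_on A expq"
  by (simp add: continuous_at_imp_continuous_on isCont_expq)

lemma expq_ge_1: "0 \<le> x \<Longrightarrow> 1 \<le> expq x"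
  using exp_ge_add_one_self[of x] by (auto simp: expq_def field_simps)

lemma expq_le_exp: "0 \<le> x \<Longrightarrow> expq x \<le> exp x"
proof (cases "x = 0")
  case False
  assume "0 \<le> x"
  have "exp x * (1 - x) \<le> exp x * exp (-x)"
    using exp_ge_add_one_self[of "-x"] by (intro mult_left_mono) auto
  then have "exp x * (1 - x) \<le> 1"
    by (simp add: exp_minus)
  then show ?thesis using False \<open>0 \<le> x\<close> by (auto simp: expq_def field_simps)
qed (auto simp: expq_def)

text \<open>Up to sign and reflection this is the entire exponential integral:
  \<open>expq_int z\<close> = - Ein (-z).\<close>

definition expq_int :: "real \<Rightarrow> real" where
  "expq_int z = integral {0..z} (\<lambda>x. (exp x - 1) / x)"

lemma expq_int_altdef: "expq_int z = integral {0..z} expq"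
  unfolding expq_int_def
  by (rule integral_spike[of "{0}"]) (auto simp: expq_def)

lemma continuous_on_expq_int: "continuous_on {0..} expq_int"
proof -
  have "continuous_on {0..b} expq_int" for b
    unfolding expq_int_altdef
    by (intro indefinite_integral_continuous_1 integrable_continuous_interval continuous_on_expq)
  then have "continuous (at x within {0..}) expq_int" if "x \<ge> 0" for x
  proof -
    have "continuous (at x within {0..x+1}) expq_int"
      using \<open>\<And>b. continuous_on {0..b} expq_int\<close>[of "x+1"] that
      by (simp add: continuous_on_eq_continuous_within)
    moreover have "at x within {0..x+1} = at x within {0..}"
      by (rule at_within_nhd[of _ "{..<x+1}"]) auto
    ultimately show ?thesis by simp
  qed
  then show ?thesis by (simp add: continuous_on_eq_continuous_within)
qed

lemma expq_int_deriv:
  assumes "0 < z" shows "(expq_int has_real_derivative expq z) (at z)"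
proof -
  have "((\<lambda>u. integral {0..u} expq) has_real_derivative expq z) (at z within {0..z+1})"
    by (rule integral_has_real_derivative) (use assms continuous_on_expq in auto)
  moreover have "at z within {0..z+1} = at z"
    using assms by (intro at_within_interior) auto
  ultimately show ?thesis
    unfolding expq_int_altdef[abs_def] by simp
qed

lemma expq_int_0 [simp]: "expq_int 0 = 0"
  by (simp add: expq_int_def)

lemma expq_int_strict_mono:
  assumes "0 \<le> x" "x < y" shows "expq_int x < expq_int y"
proof -
  show ?thesis
  proof (rule DERIV_pos_imp_increasing_open[OF assms(2)])
    show "\<exists>d. (expq_int has_real_derivative d) (at u) \<and> 0 < d" if "x < u" "u < y" for u
      using expq_int_deriv[of u] expq_ge_1[of u] that assms by (intro exI[of _ "expq u"]) auto
    show "continuous_on {x..y} expq_int"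
      by (rule continuous_on_subset[OF continuous_on_expq_int]) (use assms in auto)
  qed
qed

lemma gamma_parameter_iff: "gamma_parameter c \<longleftrightarrow> c > 0 \<and> expq_int c = 1"
  by (simp add: gamma_parameter_def expq_int_def)

lemma gamma_parameter_exists: "\<exists>c. gamma_parameter c"
proof -
  have "1 \<le> expq_int 1"
  proof -
    have "integral {0..1} (\<lambda>x::real. 1::real) \<le> integral {0..1} expq"
      by (intro integral_le integrable_continuous_interval continuous_on_expq continuous_intros)
        (auto intro: expq_ge_1)
    then show ?thesis by (simp add: expq_int_altdef)
  qed
  then obtain c where "0 \<le> c" "expq_int c = 1"
    using IVT'[of expq_int 0 1 1] continuous_on_subset[OF continuous_on_expq_int, of "{0..1}"] by force
  then have "c > 0"
    by (cases "c = 0") auto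
  with \<open>expq_int c = 1\<close> show ?thesis by (auto simp: gamma_parameter_iff)
qed

lemma gamma_parameter_unique:
  assumes "gamma_parameter c" "gamma_parameter c'" shows "c' = c"
  using assms expq_int_strict_mono[of c c'] expq_int_strict_mono[of c' c]
  by (auto simp: gamma_parameter_iff) (metis less_eq_real_def linorder_neqE_linordered_idom less_irrefl)

section \<open>The exponential integral E_1 and its behaviour at 0 and at infinity\<close>

definition exp_int :: "real \<Rightarrow> real" where
  "exp_int x = integral {x..} (\<lambda>u. exp (- u) / u)"

lemma exp_int_integrable:
  fixes x :: real
  assumes "0 < x" shows "(\<lambda>u. exp (- u) / u) integrable_on {x..}"
proof (rule measurable_bounded_by_integrable_imp_integrable)
  show "(\<lambda>u. exp (- u) / u) \<in> borel_measurable (lebesgue_on {x..})"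
    using assms by (intro continuous_imp_measurable_on_sets_lebesgue continuous_intros) auto
  show "(\<lambda>u. exp (- 1 * u) / x) integrable_on {x..}"
    by (intro integrable_on_divide integrable_on_exp_minus_to_infinity) auto
  show "norm (exp (- u) / u) \<le> exp (- 1 * u) / x" if "u \<in> {x..}" for u
    using that assms by (auto simp: field_simps)
qed auto

lemma exp_int_split:
  assumes "0 < a" "a \<le> x"
  shows "exp_int a = integral {a..x} (\<lambda>u. exp (- u) / u) + exp_int x"
proof -
  have "integral ({a..x} \<union> {x..}) (\<lambda>u. exp (- u) / u) =
      integral {a..x} (\<lambda>u. exp (- u) / u) + integral {x..} (\<lambda>u. exp (- u) / u)"
  proof (rule integral_Un)
    show "(\<lambda>u. exp (- u) / u) integrable_on {a..x}"
      using assms by (intro integrable_continuous_interval continuous_intros) auto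
    have "{a..x} \<inter> {x..} = {x}" using assms by auto
    then show "negligible ({a..x} \<inter> {x..})" by simp
  qed (use assms exp_int_integrable[of x] in auto)
  moreover have "{a..x} \<union> {x..} = {a..}" using assms by auto
  ultimately show ?thesis by (simp add: exp_int_def)
qed

lemma exp_int_deriv [derivative_intros]:
  assumes "0 < x" shows "(exp_int has_real_derivative - (exp (- x) / x)) (at x)"
proof -
  let ?a = "x / 2"
  have "((\<lambda>v. integral {?a..v} (\<lambda>u. exp (- u) / u)) has_real_derivative exp (- x) / x)
      (at x within {?a..x+1})"
    by (rule integral_has_real_derivative) (use assms in \<open>auto intro!: continuous_intros\<close>)
  moreover have "at x within {?a..x+1} = at x"
    using assms by (intro at_within_interior) auto
  ultimately have A: "((\<lambda>v. exp_int ?a - integral {?a..v} (\<lambda>u. exp (- u) / u))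
      has_real_derivative - (exp (- x) / x)) (at x)"
    by (auto intro!: derivative_eq_intros)
  have "exp_int ?a - integral {?a..v} (\<lambda>u. exp (- u) / u) = exp_int v" if "v \<in> {?a<..}" for v
    using exp_int_split[of ?a v] that assms by auto
  then show ?thesis
    using assms by (intro has_field_derivative_transform_within_open[OF A, of "{?a<..}"]) auto
qed

lemma exp_int_nonneg: "0 < x \<Longrightarrow> 0 \<le> exp_int x"
  unfolding exp_int_def by (intro integral_nonneg exp_int_integrable) auto

lemma exp_int_le: assumes "0 < x" shows "exp_int x \<le> exp (- x) / x"
proof -
  have "exp_int x \<le> integral {x..} (\<lambda>u. exp (- 1 * u) / x)"
    unfolding exp_int_def
    using assms by (intro integral_le exp_int_integrable integrable_on_divide integrable_on_exp_minus_to_infinity)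
      (auto simp: field_simps)
  also have "\<dots> = exp (- x) / x"
    using integral_unique[OF has_integral_divide[OF has_integral_exp_minus_to_infinity[of 1 x], of x]] by simp
  finally show ?thesis .
qed

text \<open>The derivative of \<open>exp_int u + ln u\<close> is (1 - exp (-u)) / u \<ge> 0. So the
  singularity at 0 is only logarithmic, and a factor x removes it.\<close>

lemma exp_int_le_ln: assumes "0 < x" "x \<le> 1" shows "exp_int x \<le> exp_int 1 - ln x"
proof -
  have "exp_int x + ln x \<le> exp_int 1 + ln 1"
  proof (rule DERIV_nonneg_imp_nondecreasing[OF assms(2)])
    fix u assume "x \<le> u" "u \<le> 1"
    then have "((\<lambda>x. exp_int x + ln x) has_real_derivative - (exp (- u) / u) + 1 / u) (at u)"
      using assms by (auto intro!: derivative_eq_intros)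
    moreover have "0 \<le> - (exp (- u) / u) + 1 / u"
      using \<open>x \<le> u\<close> assms by (auto simp: field_simps)
    ultimately show "\<exists>y. ((\<lambda>x. exp_int x + ln x) has_real_derivative y) (at u) \<and> 0 \<le> y" by blast
  qed
  then show ?thesis by simp
qed

lemma exp_int_tendsto_0: "(exp_int \<longlongrightarrow> 0) at_top"
proof (rule tendsto_sandwich[of "\<lambda>_. 0"])
  show "((\<lambda>x::real. exp (- x) / x) \<longlongrightarrow> 0) at_top" by real_asymp
  show "\<forall>\<^sub>F x in at_top. 0 \<le> exp_int x"
    using eventually_gt_at_top[of 0] by eventually_elim (rule exp_int_nonneg)
  show "\<forall>\<^sub>F x in at_top. exp_int x \<le> exp (- x) / x"
    using eventually_gt_at_top[of 0] by eventually_elim (rule exp_int_le)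
qed auto

lemma exp_int_mult_tendsto_0: "((\<lambda>x. x * exp_int x) \<longlongrightarrow> 0) (at_right 0)"
proof (rule tendsto_sandwich[of "\<lambda>_. 0"])
  show "((\<lambda>x::real. x * (exp_int 1 - ln x)) \<longlongrightarrow> 0) (at_right 0)" by real_asymp
  show "\<forall>\<^sub>F x in at_right 0. 0 \<le> x * exp_int x"
    by (auto simp: eventually_at_right_field intro!: exI[of _ 1] mult_nonneg_nonneg exp_int_nonneg)
  show "\<forall>\<^sub>F x in at_right 0. x * exp_int x \<le> x * (exp_int 1 - ln x)"
    by (auto simp: eventually_at_right_field intro!: exI[of _ 1] exp_int_le_ln)
qed auto

section \<open>The value function of the Poisson limit\<close>

locale gamma_constant =
  fixes c :: real
  assumes gamma_parameter: "gamma_parameter c"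
begin

lemma c_pos: "0 < c" and expq_int_c: "expq_int c = 1"
  using gamma_parameter by (auto simp: gamma_parameter_iff)

text \<open>Above c the optimality equation reduces to V' = - (1 + 1/z) * V, solved by the multiples
  of exp (-z) / z. With the factor \<open>K\<close> the function \<open>V\<close>, and with it
  \<open>H\<close>, is continuous at c; the equation \<open>expq_int c = 1\<close> enters
  there.\<close>

definition K :: real where "K = exp c - c - 1"

lemma K_nonneg: "0 \<le> K"
  using exp_ge_add_one_self[of c] unfolding K_def by linarith

lemma gamma_value_altdef: "gamma_value c = K * exp_int c + exp (- c)"
  by (simp add: gamma_value_def K_def exp_int_def)

text \<open>
  \<open>W\<close> solves \<open>z * W' z = - z * W z + (integral of M over {0..z})\<close> with
  \<open>M z = max (exp (- z)) (W z)\<close>, the optimality equation of the Poisson limit: a record leaving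
  \<open>z\<close> expected better values is the maximum with probability \<open>exp (- z)\<close>, and the next record
  leaves a uniformly distributed fraction of \<open>z\<close>. It is optimal to accept iff \<open>z \<le> c\<close>. \<open>V\<close> is the
  derivative of \<open>W\<close>, and \<open>H\<close> the primitive of \<open>M\<close>.
\<close>

definition W :: "real \<Rightarrow> real" where
  "W z = (if z \<le> c then exp (- z) * expq_int z else exp (- c) + K * (exp_int c - exp_int z))"

definition V :: "real \<Rightarrow> real" where
  "V z = (if z \<le> c then exp (- z) * (expq z - expq_int z) else K * exp (- z) / z)"

definition M :: "real \<Rightarrow> real" where
  "M z = (if z \<le> c then exp (- z) else W z)"

definition H :: "real \<Rightarrow> real" where
  "H z = (if z \<le> c then 1 - exp (- z) else K * exp (- z) + z * W z)"

lemma exp_int_antimono: "0 < x \<Longrightarrow> x \<le> y \<Longrightarrow> exp_int y \<le> exp_int x"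
  using exp_int_split[of x y]
  by (auto intro!: integral_nonneg integrable_continuous_interval continuous_intros)

lemma expq_int_mono: "0 \<le> x \<Longrightarrow> x \<le> y \<Longrightarrow> expq_int x \<le> expq_int y"
  using expq_int_strict_mono[of x y] by (cases "x = y") auto

lemma expq_int_nonneg: "0 \<le> x \<Longrightarrow> 0 \<le> expq_int x"
  using expq_int_mono[of 0 x] by simp

lemma W_deriv:
  assumes "0 < z" "z \<noteq> c" shows "(W has_real_derivative V z) (at z)"
proof (cases "z < c")
  case True
  have "((\<lambda>z. exp (- z) * expq_int z) has_real_derivative V z) (at z)"
    using assms True by (auto simp: V_def algebra_simps intro!: derivative_eq_intros expq_int_deriv)
  then show ?thesis
    by (rule has_field_derivative_transform_within_open[of _ _ _ "{..<c}"]) (use True in \<open>auto simp: W_def\<close>)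
next
  case False
  have "((\<lambda>z. exp (- c) + K * (exp_int c - exp_int z)) has_real_derivative V z) (at z)"
    using assms False by (auto simp: V_def intro!: derivative_eq_intros)
  then show ?thesis
    by (rule has_field_derivative_transform_within_open[of _ _ _ "{c<..}"]) (use False assms in \<open>auto simp: W_def\<close>)
qed

lemma isCont_exp_int: "0 < x \<Longrightarrow> isCont exp_int x"
  using DERIV_isCont exp_int_deriv by blast

lemma continuous_on_exp_int: "A \<subseteq> {0<..} \<Longrightarrow> continuous_on A exp_int"
  by (intro continuous_at_imp_continuous_on) (auto intro: isCont_exp_int)

lemma continuous_on_W: "continuous_on {0..} W"
  unfolding W_def[abs_def]
proof (rule continuous_on_cases_le)
  show "continuous_on {x \<in> {0..}. x \<le> c} (\<lambda>z. exp (- z) * expq_int z)"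
    by (intro continuous_intros continuous_on_subset[OF continuous_on_expq_int]) auto
  show "continuous_on {x \<in> {0..}. c \<le> x} (\<lambda>z. exp (- c) + K * (exp_int c - exp_int z))"
    using c_pos by (intro continuous_intros continuous_on_exp_int) auto
qed (auto simp: expq_int_c)

lemma H_glue: "1 - exp (- c) = K * exp (- c) + c * W c"
  by (simp add: W_def expq_int_c K_def exp_minus field_simps)

lemma continuous_on_H: "continuous_on {0..} H"
  unfolding H_def[abs_def]
proof (rule continuous_on_cases_le)
  show "continuous_on {x \<in> {0..}. c \<le> x} (\<lambda>z. K * exp (- z) + z * W z)"
    by (intro continuous_intros continuous_on_subset[OF continuous_on_W]) auto
qed (auto simp: H_glue intro!: continuous_intros)

text \<open>This is the optimality equation with \<open>H\<close> as the integral of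
  \<open>M\<close>. On either side of c it is an algebraic identity between the explicit
  formulas.\<close>

lemma H_eq: "0 < z \<Longrightarrow> H z = z * (V z + W z)"
  by (auto simp: H_def V_def W_def expq_def exp_minus field_simps)

lemma H_deriv:
  assumes "0 < z" "z \<noteq> c" shows "(H has_real_derivative M z) (at z)"
proof (cases "z < c")
  case True
  have "((\<lambda>z. 1 - exp (- z)) has_real_derivative M z) (at z)"
    using assms True by (auto simp: M_def intro!: derivative_eq_intros)
  then show ?thesis
    by (rule has_field_derivative_transform_within_open[of _ _ _ "{..<c}"]) (use True in \<open>auto simp: H_def\<close>)
next
  case False
  have "((\<lambda>z. K * exp (- z) + z * W z) has_real_derivative M z) (at z)"
    using assms False by (auto simp: M_def V_def intro!: derivative_eq_intros W_deriv)
  then show ?thesis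
    by (rule has_field_derivative_transform_within_open[of _ _ _ "{c<..}"]) (use False assms in \<open>auto simp: H_def\<close>)
qed

lemma V_nonneg: "0 \<le> z \<Longrightarrow> 0 \<le> V z"
  using expq_ge_1[of z] expq_int_mono[of z c] expq_int_c K_nonneg c_pos
  by (auto simp: V_def)

lemma W_nonneg: "0 \<le> z \<Longrightarrow> 0 \<le> W z"
  using expq_int_nonneg[of z] exp_int_antimono[of c z] c_pos K_nonneg
  by (auto simp: W_def intro!: add_nonneg_nonneg)

lemma W_mono: assumes "0 < x" "x \<le> y" shows "W x \<le> W y"
proof -
  have "(V has_integral W y - W x) {x..y}"
  proof (rule fundamental_theorem_of_calculus_interior_strong[of "{c}"])
    show "(W has_vector_derivative V u) (at u)" if "u \<in> {x<..<y} - {c}" for u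
      using W_deriv[of u] that assms by (simp add: has_real_derivative_iff_has_vector_derivative)
    show "continuous_on {x..y} W"
      by (rule continuous_on_subset[OF continuous_on_W]) (use assms in auto)
  qed (use assms in auto)
  then have "0 \<le> W y - W x"
    by (rule has_integral_nonneg) (use V_nonneg assms in auto)
  then show ?thesis by simp
qed

text \<open>\<open>gamma_value c\<close> is the limit of \<open>W\<close> at infinity. The formula
  valid above c gives the bound there, and monotonicity carries it to smaller arguments.\<close>

lemma W_le: assumes "0 \<le> z" shows "W z \<le> gamma_value c"
proof -
  have *: "W z \<le> gamma_value c" if "z > c" for z
    using that K_nonneg exp_int_nonneg[of z] c_pos
    by (auto simp: W_def gamma_value_altdef algebra_simps)
  show ?thesis
  proof (cases "z = 0")
    case True
    then show ?thesis
      using c_pos K_nonneg exp_int_nonneg[of c] by (auto simp: W_def gamma_value_altdef intro!: add_nonneg_nonneg)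
  next
    case False
    have "W z \<le> W (z + c)" using False assms c_pos by (intro W_mono) auto
    also have "\<dots> \<le> gamma_value c" using False assms by (intro *) auto
    finally show ?thesis .
  qed
qed

text \<open>Below c, \<open>expq_int z \<le> expq_int c = 1\<close>; above c, \<open>W\<close> has
  already passed exp (-c). Hence \<open>M\<close> dominates both alternatives, accepting and
  continuing.\<close>

lemma M_ge: assumes "0 \<le> z" shows "exp (- z) \<le> M z" "W z \<le> M z"
proof -
  have "expq_int z \<le> 1" if "z \<le> c"
    using expq_int_mono[of z c] that assms expq_int_c by auto
  moreover have "exp (- z) \<le> W z" if "c < z"
  proof -
    have "exp (- z) \<le> exp (- c)" using that by simp
    also have "\<dots> \<le> W z" using exp_int_antimono[of c z] that c_pos K_nonneg by (auto simp: W_def)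
    finally show ?thesis .
  qed
  ultimately show "exp (- z) \<le> M z" "W z \<le> M z"
    by (auto simp: M_def W_def mult_left_le)
qed

text \<open>The substitution z = q * y passes from the limit variable to the probability y of
  exceeding the next value when q values follow it. \<open>H_eq\<close> then expresses the primitive
  through \<open>V\<close> and \<open>W\<close>.\<close>

lemma M_integral:
  assumes "0 < q" "0 < v"
  shows "((\<lambda>y. M (q * y)) has_integral v * (V (q * v) + W (q * v))) {0..v}"
proof -
  have "((\<lambda>y. M (q * y)) has_integral H (q * v) / q - H (q * 0) / q) {0..v}"
  proof (rule fundamental_theorem_of_calculus_interior_strong[of "{c / q}"])
    show "((\<lambda>y. H (q * y) / q) has_vector_derivative M (q * u)) (at u)" if "u \<in> {0<..<v} - {c / q}" for u
    proof -
      have "(H has_real_derivative M (q * u)) (at (q * u))"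
        using that assms by (intro H_deriv) auto
      then have "((\<lambda>y. H (q * y)) has_real_derivative M (q * u) * q) (at u)"
        by (rule DERIV_chain2) (auto intro!: derivative_eq_intros)
      then have "((\<lambda>y. H (q * y) / q) has_real_derivative M (q * u) * q / q) (at u)"
        by (rule DERIV_cdivide)
      then show ?thesis using assms by (simp add: has_real_derivative_iff_has_vector_derivative)
    qed
    show "continuous_on {0..v} (\<lambda>y. H (q * y) / q)"
      using assms by (intro continuous_intros continuous_on_compose2[OF continuous_on_H]) auto
  qed (use assms in auto)
  moreover have "H (q * v) / q - H (q * 0) / q = v * (V (q * v) + W (q * v))"
    using assms c_pos H_eq[of "q * v"] by (simp add: H_def[of 0])
  ultimately show ?thesis by simp
qed

section \<open>The second-order error of the optimality equation\<close>

definition C :: real where "C = max (2 * c ^ 2) K"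

lemma C_nonneg: "0 \<le> C"
  using K_nonneg by (simp add: C_def le_max_iff_disj)

text \<open>The derivative of \<open>V\<close> is exp (-u) * (expq' u + \<open>expq_int u\<close>) -
  2 * exp (-u) * \<open>expq u\<close>. The first summand is nonnegative, and
  \<open>expq_le_exp\<close> bounds the second by 2.\<close>

lemma V_lower_below:
  assumes "0 < z" "z \<le> x" "x \<le> c"
  shows "V z - 2 * (x - z) \<le> V x"
proof -
  define f where "f = (\<lambda>z. exp (- z) * (expq z - expq_int z) + 2 * z)"
  have "f z \<le> f x"
  proof (rule DERIV_nonneg_imp_nondecreasing[OF assms(2)])
    fix u assume u: "z \<le> u" "u \<le> x"
    have "((\<lambda>u. (exp u - 1) / u) has_real_derivative (exp u * u - (exp u - 1)) / (u * u)) (at u)"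
      using u assms by (auto intro!: derivative_eq_intros)
    then have *: "(expq has_real_derivative (exp u * u - (exp u - 1)) / (u * u)) (at u)"
      by (rule has_field_derivative_transform_within_open[of _ _ _ "{0<..}"]) (use u assms in \<open>auto simp: expq_def\<close>)
    let ?d = "exp (- u) * ((exp u * u - (exp u - 1)) / (u * u) - expq u) +
      - exp (- u) * (expq u - expq_int u) + 2"
    have "(f has_real_derivative ?d) (at u)"
      unfolding f_def using u assms
      by (auto intro!: derivative_eq_intros * expq_int_deriv)
    moreover have "0 \<le> ?d"
    proof -
      have "exp (- u) * expq u \<le> exp (- u) * exp u"
        using u assms by (intro mult_left_mono expq_le_exp) auto
      then have 1: "exp (- u) * expq u \<le> 1" by (simp add: exp_minus)
      have "exp u * (1 - u) \<le> exp u * exp (-u)"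
        using exp_ge_add_one_self[of "-u"] by (intro mult_left_mono) auto
      then have "0 \<le> exp u * u - (exp u - 1)" by (simp add: exp_minus algebra_simps)
      then have 2: "0 \<le> exp (- u) * ((exp u * u - (exp u - 1)) / (u * u))" by auto
      have 3: "0 \<le> exp (- u) * expq_int u" using expq_int_nonneg[of u] u assms by auto
      show ?thesis using 1 2 3 by (simp add: algebra_simps)
    qed
    ultimately show "\<exists>y. (f has_real_derivative y) (at u) \<and> 0 \<le> y" by blast
  qed
  then show ?thesis using assms by (simp add: f_def V_def)
qed

text \<open>For u \<ge> c the derivative is - K * exp (-u) * (u + 1) / u^2, and exp (-u) * (u + 1)
  \<le> 1.\<close>

lemma V_lower_above:
  assumes "c \<le> z" "z \<le> x"
  shows "V z - K * (x - z) / z\<^sup>2 \<le> V x"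
proof -
  have Vc: "V u = K * exp (- u) / u" if "c \<le> u" for u
    using that c_pos by (cases "u = c") (auto simp: V_def K_def expq_def expq_int_c exp_minus field_simps)
  define f where "f = (\<lambda>u. K * exp (- u) / u + K / z\<^sup>2 * u)"
  have "f z \<le> f x"
  proof (rule DERIV_nonneg_imp_nondecreasing[OF assms(2)])
    fix u assume u: "z \<le> u" "u \<le> x"
    have "u > 0" "z > 0" using u assms c_pos by auto
    let ?d = "K * (1 / z\<^sup>2 - exp (- u) * (u + 1) / u\<^sup>2)"
    have "(f has_real_derivative ?d) (at u)"
      unfolding f_def using \<open>u > 0\<close> \<open>z > 0\<close>
      by (auto intro!: derivative_eq_intros simp: field_simps power2_eq_square)
    moreover have "0 \<le> ?d"
    proof -
      have "exp (- u) * (u + 1) \<le> exp (- u) * exp u"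
        using exp_ge_add_one_self[of u] by (intro mult_left_mono) (linarith, simp)
      then have "exp (- u) * (u + 1) \<le> 1" by (simp add: exp_minus)
      then have "exp (- u) * (u + 1) / u\<^sup>2 \<le> 1 / z\<^sup>2"
        using u \<open>u > 0\<close> \<open>z > 0\<close> by (intro frac_le) auto
      then show ?thesis using K_nonneg by auto
    qed
    ultimately show "\<exists>y. (f has_real_derivative y) (at u) \<and> 0 \<le> y" by blast
  qed
  then show ?thesis using assms by (simp add: f_def Vc diff_divide_distrib right_diff_distrib)
qed

text \<open>Both slope bounds are weakened to \<open>- C / z\<^sup>2\<close>, with z the left end:
  below c because z \<le> c and \<open>2 * c ^ 2 \<le> C\<close>, above c because
  \<open>K \<le> C\<close>. An interval that contains c is cut there.\<close>

lemma V_lower: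
  assumes "0 < z" "z \<le> x"
  shows "V z - C * (x - z) / z\<^sup>2 \<le> V x"
proof -
  have below: "V z - C * (x - z) / z\<^sup>2 \<le> V x" if "z \<le> x" "x \<le> c" for x
  proof -
    have "2 * (x - z) \<le> C * (x - z) / z\<^sup>2"
    proof -
      have "2 * z\<^sup>2 \<le> C" 
      proof -
        have "z\<^sup>2 \<le> c\<^sup>2" using assms that by (intro power_mono) auto
        then show ?thesis by (simp add: C_def)
      qed
      then have "2 * z\<^sup>2 * (x - z) \<le> C * (x - z)" using that by (intro mult_right_mono) auto
      then show ?thesis using assms by (simp add: field_simps)
    qed
    then show ?thesis using V_lower_below[of z x] that assms by auto
  qed
  have above: "V u - C * (x - u) / z\<^sup>2 \<le> V x" if "c \<le> u" "z \<le> u" "u \<le> x" for u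
  proof -
    have "K * (x - u) / u\<^sup>2 \<le> C * (x - u) / z\<^sup>2"
      using assms that c_pos C_nonneg by (intro frac_le mult_right_mono power_mono) (auto simp: C_def)
    then show ?thesis using V_lower_above[of u x] that by auto
  qed
  show ?thesis
  proof (cases "x \<le> c")
    case True then show ?thesis using below assms by auto
  next
    case False
    show ?thesis
    proof (cases "c \<le> z")
      case True then show ?thesis using above[of z] assms by auto
    next
      case F: False
      have "C * (c - z) / z\<^sup>2 + C * (x - c) / z\<^sup>2 = C * (x - z) / z\<^sup>2"
        by (simp add: diff_divide_distrib right_diff_distrib)
      then show ?thesis using below[of c] above[of c] F False by auto
    qed
  qed
qed

text \<open>The right-hand side is the value after one more time step; only the second-order term is lost.\<close>

lemma W_step:
  assumes "0 < q" "0 \<le> v"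
  shows "W (q * v) + v * V (q * v) \<le> W (q * v + v) + C / q\<^sup>2"
proof (cases "v = 0")
  case True
  then show ?thesis using C_nonneg by simp
next
  case False
  define z where "z = q * v"
  have z: "0 < z" "0 < v" using assms False by (auto simp: z_def)
  have 1: "(V has_integral W (z + v) - W z) {z..z+v}"
  proof (rule fundamental_theorem_of_calculus_interior_strong[of "{c}"])
    show "(W has_vector_derivative V u) (at u)" if "u \<in> {z<..<z+v} - {c}" for u
      using W_deriv[of u] that z by (simp add: has_real_derivative_iff_has_vector_derivative)
    show "continuous_on {z..z+v} W"
      by (rule continuous_on_subset[OF continuous_on_W]) (use z in auto)
  qed (use z in auto)
  have 2: "((\<lambda>_. V z - C * v / z\<^sup>2) has_integral (V z - C * v / z\<^sup>2) * v) {z..z+v}"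
    using has_integral_const_real[of "V z - C * v / z\<^sup>2" z "z + v"] z by (simp add: mult.commute)
  have "(V z - C * v / z\<^sup>2) * v \<le> W (z + v) - W z"
  proof (rule has_integral_le[OF 2 1])
    fix x assume "x \<in> {z..z+v}"
    then have "V z - C * (x - z) / z\<^sup>2 \<le> V x" "C * (x - z) / z\<^sup>2 \<le> C * v / z\<^sup>2"
      using z C_nonneg by (auto intro!: V_lower divide_right_mono mult_left_mono)
    then show "V z - C * v / z\<^sup>2 \<le> V x" by linarith
  qed
  \<comment> \<open>With z = q * v the loss C * v^2 / z^2 no longer depends on v; the slope bound
    was scaled by \<open>z\<^sup>2\<close> for this purpose.\<close>
  moreover have "C * v / z\<^sup>2 * v = C / q\<^sup>2"
    using False assms by (simp add: z_def field_simps power2_eq_square)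
  ultimately show ?thesis by (simp add: z_def algebra_simps)
qed

end

section \<open>A potential for the finite problem\<close>

text \<open>The expected minimum of \<open>v\<close> and \<open>j\<close> independent uniform variables.\<close>

definition mean_min :: "nat \<Rightarrow> real \<Rightarrow> real" where
  "mean_min j v = (1 - (1 - v) ^ Suc j) / real (Suc j)"

lemma mean_min_0: "mean_min 0 v = v" by (simp add: mean_min_def)

lemma mean_min_nonneg: "0 \<le> v \<Longrightarrow> v \<le> 1 \<Longrightarrow> 0 \<le> mean_min j v"
  by (auto simp: mean_min_def intro!: divide_nonneg_pos power_le_one simp del: power_Suc)

text \<open>Condition on one further uniform variable: with probability 1 - v it exceeds v and
  changes nothing, otherwise its value y replaces v. So \<open>mean_min\<close> is preserved on
  average by a step of the process.\<close>

lemma mean_min_integral: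
  assumes "0 \<le> v"
  shows "(mean_min j has_integral (mean_min (Suc j) v - (1 - v) * mean_min j v)) {0..v}"
proof -
  define G where "G = (\<lambda>y::real. (y + (1 - y) ^ Suc (Suc j) / real (Suc (Suc j))) / real (Suc j))"
  have "(mean_min j has_integral (G v - G 0)) {0..v}"
  proof (rule fundamental_theorem_of_calculus[OF assms])
    fix y assume "y \<in> {0..v}"
    have "((\<lambda>y. 1 - y) has_real_derivative - 1) (at y)"
      by (auto intro!: derivative_eq_intros)
    from DERIV_power[OF this, of "Suc (Suc j)"]
    have "((\<lambda>y. (1 - y) ^ Suc (Suc j)) has_real_derivative
        real (Suc (Suc j)) * - ((1 - y) ^ Suc j)) (at y)"
      by (simp del: power_Suc of_nat_Suc)
    from DERIV_cdivide[OF DERIV_add[OF DERIV_ident DERIV_cdivide[OF this, of "real (Suc (Suc j))"]], of "real (Suc j)"]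
    have "(G has_real_derivative mean_min j y) (at y)"
      unfolding G_def mean_min_def by (simp del: power_Suc of_nat_Suc)
    then show "(G has_vector_derivative mean_min j y) (at y within {0..v})"
      by (simp add: has_real_derivative_iff_has_vector_derivative has_vector_derivative_at_within)
  qed
  moreover have "G v - G 0 = mean_min (Suc j) v - (1 - v) * mean_min j v"
  proof -
    define a where "a = real (Suc j)"
    define p where "p = (1 - v) ^ Suc j"
    have a: "a > 0" "real (Suc (Suc j)) = a + 1" by (auto simp: a_def)
    show ?thesis
      unfolding G_def mean_min_def power_Suc[of _ "Suc j"] a a_def[symmetric] p_def[symmetric]
      using a(1) by (simp add: divide_simps) (simp add: algebra_simps)
  qed
  ultimately show ?thesis by simp
qed

context gamma_constant
begin

text \<open>
  The term with \<open>mean_min\<close> is harmonic for the process and bounds the probability that the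
  maximum is among the last \<open>r0\<close> values; the last term absorbs the errors \<open>C / q\<^sup>2\<close> of \<open>W_step\<close>.
\<close>

definition pot_late :: "nat \<Rightarrow> nat \<Rightarrow> real \<Rightarrow> real" where
  "pot_late r0 r v = W (real r * v) + real r0 * mean_min (r - r0) v + 2 * C * (1 / real r0 - 1 / real r)"

text \<open>With fewer than r0 values to come the bound is the trivial one: success after continuing
  needs a later value above the current maximum.\<close>

definition pot :: "nat \<Rightarrow> nat \<Rightarrow> real \<Rightarrow> real" where
  "pot r0 r v = (if r < r0 then 1 - (1 - v) ^ r else pot_late r0 r v)"

text \<open>The function m lies above both accepting and continuing at a new maximum, which avoids
  integrating a pointwise maximum. Of the summands of the potential, \<open>mean_min\<close> is
  preserved, and \<open>W_step\<close> loses \<open>C / q\<^sup>2\<close>, which the growth of the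
  last summand absorbs.\<close>

lemma pot_late_step:
  assumes "1 \<le> r0" "r0 \<le> q" "0 \<le> v" "v \<le> 1"
  shows "\<exists>m B. (m has_integral B) {0..v} \<and> (\<forall>y\<in>{0..v}. (1 - y) ^ q \<le> m y \<and> pot_late r0 q y \<le> m y) \<and>
    (1 - v) * pot_late r0 q v + B \<le> pot_late r0 (Suc q) v"
proof (cases "v = 0")
  case True
  \<comment> \<open>On the degenerate interval every function has integral 0;
    \<open>M_integral\<close> covers only v > 0.\<close>
  define m where "m = (\<lambda>_::real. max 1 (pot_late r0 q 0))"
  have "2 * C * (1 / real q) \<ge> 2 * C * (1 / real (Suc q))"
    using assms C_nonneg by (intro mult_left_mono) (auto simp: field_simps)
  then have "pot_late r0 q 0 \<le> pot_late r0 (Suc q) 0"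
    by (simp add: pot_late_def mean_min_def right_diff_distrib)
  moreover have "(m has_integral 0) {0..v}" using True by (simp add: m_def has_integral_refl)
  ultimately show ?thesis using True
    by (intro exI[of _ m] exI[of _ 0]) (auto simp: m_def)
next
  case False
  define e where "e = 2 * C * (1 / real r0 - 1 / real q)"
  have q: "0 < real q" "real r0 > 0" using assms by auto
  have e: "0 \<le> e"
    using assms C_nonneg q by (auto simp: e_def intro!: mult_nonneg_nonneg frac_le)
  define m where "m = (\<lambda>y. M (real q * y) + real r0 * mean_min (q - r0) y + e)"
  define B where "B = v * (V (q * v) + W (q * v)) +
     real r0 * (mean_min (Suc (q - r0)) v - (1 - v) * mean_min (q - r0) v) + e * v"
  have "(m has_integral B) {0..v}"
    unfolding m_def B_def
  proof (intro has_integral_add has_integral_mult_right)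
    show "((\<lambda>x. e) has_integral e * v) {0..v}"
      using has_integral_const_real[of e 0 v] assms by (simp add: mult.commute)
  qed (use assms False q in \<open>auto intro!: M_integral mean_min_integral\<close>)
  moreover have "(1 - y) ^ q \<le> m y \<and> pot_late r0 q y \<le> m y" if y: "y \<in> {0..v}" for y
  proof -
    have "(1 - y) ^ q \<le> exp (- y) ^ q"
      using y assms exp_ge_add_one_self[of "-y"] by (intro power_mono) auto
    also have "\<dots> = exp (- (real q * y))"
      by (simp flip: exp_of_nat_mult)
    also have "\<dots> \<le> M (real q * y)"
      using y by (intro M_ge) auto
    finally have "(1 - y) ^ q \<le> M (real q * y)" .
    moreover have "W (real q * y) \<le> M (real q * y)"
      using y by (intro M_ge) auto
    moreover have "0 \<le> real r0 * mean_min (q - r0) y"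
      using y assms by (intro mult_nonneg_nonneg mean_min_nonneg) auto
    ultimately show ?thesis using e by (auto simp: m_def pot_late_def e_def)
  qed
  moreover have "(1 - v) * pot_late r0 q v + B \<le> pot_late r0 (Suc q) v"
  proof -
    have p: "pot_late r0 q v = W (q * v) + real r0 * mean_min (q - r0) v + e"
      by (simp add: pot_late_def e_def)
    have "(1 - v) * pot_late r0 q v + B
      = W (q * v) + v * V (q * v) + real r0 * mean_min (Suc (q - r0)) v + e"
      unfolding p B_def by (simp add: algebra_simps)
    also have "W (q * v) + v * V (q * v) \<le> W (q * v + v) + C / (real q)\<^sup>2"
      using q assms by (intro W_step) auto
    also have "W (q * v + v) = W (real (Suc q) * v)" by (simp add: algebra_simps)
    also have "C / (real q)\<^sup>2 \<le> 2 * C * (1 / real q - 1 / real (Suc q))"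
    proof -
      \<comment> \<open>Here q + 1 \<le> 2 * q is used; it accounts for the factor 2 in the
        telescoping term of \<open>pot_late\<close>.\<close>
      have "1 / (real q)\<^sup>2 \<le> 2 * (1 / real q - 1 / real (Suc q))"
      proof -
        have "1 / (real q)\<^sup>2 = 2 / (2 * (real q)\<^sup>2)" by simp
        also have "\<dots> \<le> 2 / (real q * real (Suc q))"
          using assms q by (intro frac_le) (auto simp: power2_eq_square algebra_simps intro!: add_pos_pos)
        also have "\<dots> = 2 * (1 / real q - 1 / real (Suc q))"
          using assms by (simp add: divide_simps)
        finally show ?thesis .
      qed
      from mult_left_mono[OF this C_nonneg] show ?thesis
        by (simp only: mult.assoc mult.left_commute[of C 2] times_divide_eq_right mult_1_right)
    qed
    finally show ?thesis
      using assms by (simp add: pot_late_def e_def Suc_diff_le algebra_simps)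
  qed
  ultimately show ?thesis by blast
qed

lemma pot_late_nonneg:
  assumes "1 \<le> r0" "r0 \<le> r" "0 \<le> v" "v \<le> 1" shows "0 \<le> pot_late r0 r v"
  unfolding pot_late_def using assms C_nonneg
  by (intro add_nonneg_nonneg mult_nonneg_nonneg W_nonneg mean_min_nonneg) (auto intro!: frac_le)

lemma pot_nonneg:
  assumes "1 \<le> r0" "0 \<le> v" "v \<le> 1" shows "0 \<le> pot r0 r v"
  using assms pot_late_nonneg by (auto simp: pot_def power_le_one)

text \<open>Up to the switch m = 1 suffices, as (1 - v) * (1 - (1 - v)^q) + v = 1 - (1 - v)^(q + 1).
  At the switch q + 1 = r0, where \<open>mean_min 0 v = v\<close>, the term r0 * v dominates this by
  Bernoulli's inequality.\<close>

lemma pot_step: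
  assumes "1 \<le> r0" "0 \<le> v" "v \<le> 1"
  shows "\<exists>m B. (m has_integral B) {0..v} \<and> (\<forall>y\<in>{0..v}. (1 - y) ^ q \<le> m y \<and> pot r0 q y \<le> m y) \<and>
    (1 - v) * pot r0 q v + B \<le> pot r0 (Suc q) v"
proof (cases "r0 \<le> q")
  case True
  then show ?thesis using pot_late_step[OF assms(1) True assms(2,3)] by (auto simp: pot_def)
next
  case False
  have 1: "((\<lambda>_::real. 1::real) has_integral v) {0..v}"
    using has_integral_const_real[of "1::real" 0 v] assms by simp
  have 2: "1 - (1 - v) ^ Suc q \<le> pot r0 (Suc q) v"
  proof (cases "Suc q < r0")
    case T: True then show ?thesis by (simp add: pot_def)
  next
    case F: False
    then have r: "r0 = Suc q" using False by simp
    have "1 + real (Suc q) * - v \<le> (1 + - v) ^ Suc q"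
      using assms by (intro Bernoulli_inequality) auto
    then have "1 - (1 - v) ^ Suc q \<le> real r0 * v" by (simp add: r)
    moreover have "0 \<le> W (real (Suc q) * v)" using assms by (intro W_nonneg) auto
    ultimately show ?thesis by (simp add: pot_def pot_late_def r mean_min_0)
  qed
  show ?thesis
  proof (intro exI[of _ "\<lambda>_. 1"] exI[of _ v] conjI ballI 1)
    show "(1 - y) ^ q \<le> 1" "pot r0 q y \<le> 1" if "y \<in> {0..v}" for y
      using False that assms by (auto simp: pot_def intro!: power_le_one)
    have "(1 - v) * pot r0 q v + v = 1 - (1 - v) ^ Suc q"
      using False by (simp add: pot_def algebra_simps)
    then show "(1 - v) * pot r0 q v + v \<le> pot r0 (Suc q) v" using 2 by simp
  qed
qed

lemma continuous_on_pot: "continuous_on {0..1} (pot r0 r)"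
  unfolding pot_def[abs_def] pot_late_def mean_min_def
  by (cases "r < r0") (auto intro!: continuous_intros continuous_on_compose2[OF continuous_on_W])

text \<open>Here y is the probability that a fresh value exceeds the next one, so it is uniform on
  the unit interval, and y > v means that the current maximum stays.\<close>

lemma pot_step_nn:
  assumes "1 \<le> r0" "0 \<le> v" "v \<le> 1"
  shows "(\<integral>\<^sup>+ y. ennreal (if v < y then pot r0 q v else max ((1 - y) ^ q) (pot r0 q y)) * indicator {0..1} y \<partial>lborel)
    \<le> ennreal (pot r0 (Suc q) v)"
proof -
  obtain m B where m: "(m has_integral B) {0..v}"
    "\<And>y. y \<in> {0..v} \<Longrightarrow> (1 - y) ^ q \<le> m y" "\<And>y. y \<in> {0..v} \<Longrightarrow> pot r0 q y \<le> m y"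
    "(1 - v) * pot r0 q v + B \<le> pot r0 (Suc q) v"
    using pot_step[OF assms] by blast
  have m0: "0 \<le> m y" if "y \<in> {0..v}" for y
    using m(3)[OF that] pot_nonneg[OF assms(1), of y q] that assms by auto
  have p0: "0 \<le> pot r0 q v" using assms pot_nonneg by auto
  have h: "((\<lambda>y. if v < y then pot r0 q v else m y) has_integral ((1 - v) * pot r0 q v + B)) {0..1}"
  proof -
    have "((\<lambda>y. if v < y then pot r0 q v else m y) has_integral B) {0..v}"
      by (rule has_integral_eq[OF _ m(1)]) auto
    moreover have "((\<lambda>y. if v < y then pot r0 q v else m y) has_integral (1 - v) * pot r0 q v) {v..1}"
    proof (rule has_integral_spike[of "{v}"])
      show "((\<lambda>_. pot r0 q v) has_integral (1 - v) * pot r0 q v) {v..1}"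
        using has_integral_const_real[of "pot r0 q v" v 1] assms by simp
    qed auto
    ultimately show ?thesis
      using has_integral_combine[of 0 v 1] assms by (auto simp: add.commute)
  qed
  have "(\<integral>\<^sup>+ y. ennreal (if v < y then pot r0 q v else max ((1 - y) ^ q) (pot r0 q y)) * indicator {0..1} y \<partial>lborel)
    \<le> (\<integral>\<^sup>+ y. ennreal (if v < y then pot r0 q v else m y) * indicator {0..1} y \<partial>lborel)"
    using m(2,3) by (intro nn_integral_mono) (auto intro!: ennreal_leI split: split_indicator)
  also have "\<dots> = ennreal ((1 - v) * pot r0 q v + B)"
    using m0 p0 by (intro nn_integral_has_integral_lebesgue' h) auto
  also have "\<dots> \<le> ennreal (pot r0 (Suc q) v)"
    using m(4) by (rule ennreal_leI)
  finally show ?thesis .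
qed

lemma pot_final:
  assumes "1 \<le> r0" "r0 \<le> n"
  shows "pot r0 n 1 \<le> gamma_value c + real r0 / real (Suc (n - r0)) + 2 * C / real r0"
proof -
  have "W (real n) \<le> gamma_value c" by (intro W_le) auto
  moreover have "0 \<le> 2 * C / real n" using C_nonneg by auto
  ultimately show ?thesis
    using assms by (simp add: pot_def pot_late_def mean_min_def algebra_simps)
qed

end

section \<open>Stopping problems for identical distributions\<close>

text \<open>\<open>F\<close> may be constant on intervals, so z is taken as the least point of the
  closed set where \<open>F\<close> is at least u; the intermediate value theorem then forces
  equality at z.\<close>

lemma continuous_level_point:
  fixes F :: "real \<Rightarrow> real"
  assumes mono: "mono F" and cont: "continuous_on UNIV F"
    and bot: "(F \<longlongrightarrow> 0) at_bot" and top: "(F \<longlongrightarrow> 1) at_top" and u: "0 < u" "u < 1"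
  obtains z where "F z = u" "\<And>x. u \<le> F x \<longleftrightarrow> z \<le> x"
proof -
  define S where "S = {x. u \<le> F x}"
  have "eventually (\<lambda>x. F x < u) at_bot" "eventually (\<lambda>x. u < F x) at_top"
    using order_tendstoD(2)[OF bot u(1)] order_tendstoD(1)[OF top u(2)] by auto
  then obtain a b where a: "F a < u" and b: "u < F b"
    by (metis eventually_at_bot_linorder eventually_at_top_linorder order_refl)
  have "a \<le> x" if "x \<in> S" for x
    using that a monoD[OF mono, of x a] by (force simp: S_def)
  then have bdd: "bdd_below S" by (rule bdd_belowI)
  have cl: "closed S" unfolding S_def by (intro closed_Collect_le continuous_intros cont)
  have ne: "S \<noteq> {}" using less_imp_le[OF b] by (auto simp: S_def)
  define z where "z = Inf S"
  have zS: "z \<in> S" unfolding z_def by (rule closed_contains_Inf[OF ne bdd cl])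
  have iff: "u \<le> F x \<longleftrightarrow> z \<le> x" for x
  proof
    assume "u \<le> F x" then show "z \<le> x" unfolding z_def by (intro cInf_lower bdd) (simp add: S_def)
  next
    assume "z \<le> x" then show "u \<le> F x" using zS monoD[OF mono, of z x] by (simp add: S_def)
  qed
  have "a \<le> z" using zS \<open>\<And>x. x \<in> S \<Longrightarrow> a \<le> x\<close> by auto
  then obtain y where "a \<le> y" "y \<le> z" "F y = u"
    using IVT'[of F a u z] a zS continuous_on_subset[OF cont, of "{a..z}"] by (auto simp: S_def)
  then have "F z = u" using iff[of y] by auto
  with iff show ?thesis using that by blast
qed

lemma continuous_distribution_measure_atLeast:
  assumes "continuous_distribution E" "0 < u" "u < 1"
  shows "measure E {x. u \<le> cdf E x} = 1 - u"
proof -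
  interpret real_distribution E using assms by (simp add: continuous_distribution_def)
  have cont: "continuous_on UNIV (cdf E)" using assms by (simp add: continuous_distribution_def)
  obtain z where z: "cdf E z = u" "\<And>x. u \<le> cdf E x \<longleftrightarrow> z \<le> x"
    using continuous_level_point[OF _ cont cdf_lim_at_bot cdf_lim_at_top_prob assms(2,3)]
      cdf_nondecreasing by (metis monoI)
  have "measure E {z} = 0"
    using cont isCont_cdf[of z] by (simp add: continuous_on_eq_continuous_at)
  moreover have "{x. u \<le> cdf E x} = (space E - {..z}) \<union> {z}" by (auto simp: z)
  moreover have "measure E ((space E - {..z}) \<union> {z}) = measure E (space E - {..z}) + measure E {z}"
    by (rule finite_measure_Union) auto
  moreover have "measure E (space E - {..z}) = 1 - u"
    using prob_compl[of "{..z}"] z by (simp add: cdf_def)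
  ultimately show ?thesis by simp
qed

lemma distr_cdf_uniform:
  assumes "continuous_distribution E"
  shows "distr E borel (\<lambda>x. 1 - cdf E x) = uniform_measure lborel {0..1}"
proof (rule cdf_unique)
  interpret real_distribution E using assms by (simp add: continuous_distribution_def)
  have cont: "continuous_on UNIV (cdf E)" using assms by (simp add: continuous_distribution_def)
  have m [measurable]: "cdf E \<in> borel_measurable borel"
    by (rule borel_measurable_continuous_onI[OF cont])
  show D: "real_distribution (distr E borel (\<lambda>x. 1 - cdf E x))"
    by (intro real_distribution_distr) auto
  show "real_distribution (uniform_measure lborel {0..1})"
    unfolding real_distribution_def real_distribution_axioms_def
    by (auto intro!: prob_space_uniform_measure)
  show "cdf (distr E borel (\<lambda>x. 1 - cdf E x)) = cdf (uniform_measure lborel {0..1})"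
  proof
    fix a
    have U: "cdf (uniform_measure lborel {0..1}) a = (if a < 0 then 0 else min a 1)"
    proof -
      have "{0..1} \<inter> {..a} = (if a < 0 then {} else {0..min a 1})" by auto
      then show ?thesis by (simp add: cdf_def measure_def emeasure_uniform_measure divide_ennreal_def)
    qed
    have L: "cdf (distr E borel (\<lambda>x. 1 - cdf E x)) a = measure E {x. 1 - a \<le> cdf E x}" for a
      unfolding cdf_def[of "distr E borel (\<lambda>x. 1 - cdf E x)"]
      by (subst measure_distr) (auto intro!: arg_cong[where f="measure E"])
    have mid: "measure E {x. 1 - a \<le> cdf E x} = a" if "0 < a" "a < 1" for a
      using continuous_distribution_measure_atLeast[OF assms, of "1 - a"] that by simp
    consider "a < 0" | "a = 0" | "0 < a" "a < 1" | "1 \<le> a" by linarith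
    then show "cdf (distr E borel (\<lambda>x. 1 - cdf E x)) a = cdf (uniform_measure lborel {0..1}) a"
    proof cases
      case 1
      have "cdf E x < 1 - a" for x using 1 cdf_bounded_prob[of x] by linarith
      then have "{x. 1 - a \<le> cdf E x} = {}" by (auto simp: not_le)
      then show ?thesis unfolding U L using 1 by simp
    next
      \<comment> \<open>The level 1 need not be attained by the distribution function, so this case
        is squeezed by the levels 1 - d with small d.\<close>
      case 2
      have "measure E {x. 1 - 0 \<le> cdf E x} \<le> 0"
      proof (rule field_le_epsilon)
        fix e :: real assume "0 < e"
        define d where "d = min e (1/2)"
        have "measure E {x. 1 - 0 \<le> cdf E x} \<le> measure E {x. 1 - d \<le> cdf E x}"
          using \<open>0 < e\<close> by (intro finite_measure_mono) (auto simp: d_def)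
        also have "\<dots> \<le> 0 + e" using \<open>0 < e\<close> by (subst mid) (auto simp: d_def)
        finally show "measure E {x. 1 - 0 \<le> cdf E x} \<le> 0 + e" .
      qed
      then have "measure E {x. 1 - a \<le> cdf E x} = 0" unfolding 2 by (simp add: order_antisym)
      then show ?thesis unfolding U L using 2 by simp
    next
      case 3
      then show ?thesis unfolding U L by (simp add: mid)
    next
      case 4
      have "{x. 1 - a \<le> cdf E x} = space E" using 4 cdf_nonneg by (auto intro: order_trans[of _ 0])
      then show ?thesis unfolding U L using 4 prob_space by simp
    qed
  qed
qed

lemma nn_integral_cdf_uniform:
  assumes "continuous_distribution E" and [measurable]: "f \<in> borel_measurable borel"
  shows "(\<integral>\<^sup>+ x. f (1 - cdf E x) \<partial>E) = (\<integral>\<^sup>+ y. f y * indicator {0..1} y \<partial>lborel)"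
proof -
  interpret real_distribution E using assms by (simp add: continuous_distribution_def)
  have m [measurable]: "cdf E \<in> borel_measurable borel"
    using assms by (auto simp: continuous_distribution_def intro: borel_measurable_continuous_onI)
  have "(\<integral>\<^sup>+ x. f (1 - cdf E x) \<partial>E) = (\<integral>\<^sup>+ y. f y \<partial>distr E borel (\<lambda>x. 1 - cdf E x))"
    by (subst nn_integral_distr) auto
  also have "\<dots> = (\<integral>\<^sup>+ y. f y * indicator {0..1} y \<partial>lborel)"
    unfolding distr_cdf_uniform[OF assms(1)]
    by (subst nn_integral_uniform_measure) (auto simp: divide_ennreal_def)
  finally show ?thesis .
qed

section \<open>Deterministic stopping rules, that is, algorithms with the seed fixed\<close>

definition first_accept :: "(nat \<Rightarrow> (nat \<Rightarrow> real) \<Rightarrow> bool) \<Rightarrow> (nat \<Rightarrow> real) \<Rightarrow> nat \<Rightarrow> bool" where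
  "first_accept a y t \<longleftrightarrow> a t (restrict y {..t}) \<and> (\<forall>s<t. \<not> a s (restrict y {..s}))"

definition accepted_max :: "(nat \<Rightarrow> (nat \<Rightarrow> real) \<Rightarrow> bool) \<Rightarrow> nat \<Rightarrow> (nat \<Rightarrow> real) \<Rightarrow> bool" where
  "accepted_max a k y \<longleftrightarrow> (\<exists>t<k. first_accept a y t \<and> y t = Max (y ` {..<k}))"

lemma first_accept_exists: "(\<exists>t<k. first_accept a y t) \<longleftrightarrow> (\<exists>t<k. a t (restrict y {..t}))"
proof
  assume "\<exists>t<k. a t (restrict y {..t})"
  then obtain t where "t < k" "a t (restrict y {..t})" by blast
  then show "\<exists>t<k. first_accept a y t"
    unfolding first_accept_def
    by (intro exI[of _ "LEAST t. a t (restrict y {..t})"] conjI allI impI)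
      (auto intro: LeastI dest: not_less_Least elim: le_less_trans[OF Least_le])
qed (auto simp: first_accept_def)

lemma first_accept_unique: "first_accept a y t \<Longrightarrow> first_accept a y s \<Longrightarrow> s = t"
  by (metis first_accept_def linorder_neqE_nat)

lemma restrict_upd: "t < k \<Longrightarrow> restrict (y(k := x)) {..t} = restrict y {..t::nat}"
  by (auto simp: fun_eq_iff)

lemma first_accept_upd: "t < k \<Longrightarrow> first_accept a (y(k := x)) t \<longleftrightarrow> first_accept a y t"
  using restrict_upd[of _ k y x] by (auto simp: first_accept_def)

lemma Max_upd:
  fixes y :: "nat \<Rightarrow> real"
  shows "Max ((y(k := x)) ` {..<Suc k}) = (if k = 0 then x else max x (Max (y ` {..<k})))"
proof -
  have "(y(k := x)) ` {..<Suc k} = insert x (y ` {..<k})"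
    by (auto simp: lessThan_Suc)
  then show ?thesis by (auto simp: lessThan_empty_iff)
qed

locale iid_stopping = real_distribution E for E +
  fixes a :: "nat \<Rightarrow> (nat \<Rightarrow> real) \<Rightarrow> bool" and n :: nat
  assumes cont: "continuous_distribution E"
    and a_measurable: "t < n \<Longrightarrow> Measurable.pred (\<Pi>\<^sub>M i\<in>{..t}. borel) (a t)"
begin

lemma product_sigma_finite: "product_sigma_finite (\<lambda>_::nat. E)"
  by unfold_locales

lemma cdf_measurable [measurable]: "cdf E \<in> borel_measurable borel"
  using cont by (auto simp: continuous_distribution_def intro: borel_measurable_continuous_onI)

lemma a_restrict_measurable:
  assumes "t < k" "k \<le> n"
  shows "Measurable.pred (\<Pi>\<^sub>M i\<in>{..<k}. E) (\<lambda>y. a t (restrict y {..t}))"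
proof -
  have "(\<lambda>y. restrict y {..t}) \<in> measurable (\<Pi>\<^sub>M i\<in>{..<k}. E) (\<Pi>\<^sub>M i\<in>{..t}. E)"
    using assms by (intro measurable_restrict_subset) auto
  also have "measurable (\<Pi>\<^sub>M i\<in>{..<k}. E) (\<Pi>\<^sub>M i\<in>{..t}. E) = measurable (\<Pi>\<^sub>M i\<in>{..<k}. E) (\<Pi>\<^sub>M i\<in>{..t}. borel)"
    by (intro measurable_cong_sets sets_PiM_cong refl) simp
  finally have A: "(\<lambda>y. restrict y {..t}) \<in> measurable (\<Pi>\<^sub>M i\<in>{..<k}. E) (\<Pi>\<^sub>M i\<in>{..t}. borel)" .
  have "t < n" using assms by simp
  show ?thesis
    by (rule measurable_compose[OF A a_measurable[OF \<open>t < n\<close>]])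
qed

lemma first_accept_measurable:
  assumes "t < k" "k \<le> n"
  shows "Measurable.pred (\<Pi>\<^sub>M i\<in>{..<k}. E) (\<lambda>y. first_accept a y t)"
proof -
  have [measurable]: "Measurable.pred (\<Pi>\<^sub>M i\<in>{..<k}. E) (\<lambda>y. a s (restrict y {..s}))" if "s \<in> {..t}" for s
    using assms that by (intro a_restrict_measurable) auto
  have "Measurable.pred (\<Pi>\<^sub>M i\<in>{..<k}. E) (\<lambda>y. a t (restrict y {..t}) \<and> (\<forall>s\<in>{..<t}. \<not> a s (restrict y {..s})))"
    by (intro pred_intros_logic pred_intros_finite) auto
  then show ?thesis unfolding first_accept_def by (simp add: Ball_def)
qed

lemma Max_measurable: "0 < (k::nat) \<Longrightarrow> (\<lambda>y. Max (y ` {..<k})) \<in> borel_measurable (\<Pi>\<^sub>M i\<in>{..<k}. E)"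
proof -
  have "(\<lambda>y. Max ((\<lambda>i. y i) ` {..<k})) \<in> borel_measurable (\<Pi>\<^sub>M i\<in>{..<k}. E)"
    by (rule borel_measurable_Max) auto
  then show ?thesis by simp
qed

lemma accepted_max_measurable:
  assumes "k \<le> n"
  shows "Measurable.pred (\<Pi>\<^sub>M i\<in>{..<k}. E) (accepted_max a k)"
proof (cases "k = 0")
  case False
  have 1: "Measurable.pred (\<Pi>\<^sub>M i\<in>{..<k}. E) (\<lambda>y. first_accept a y t)" if "t \<in> {..<k}" for t
    using assms that by (intro first_accept_measurable) auto
  have 2: "(\<lambda>y. Max (y ` {..<k})) \<in> borel_measurable (\<Pi>\<^sub>M i\<in>{..<k}. E)"
    using False by (intro Max_measurable) auto
  have 3: "(\<lambda>y. y t) \<in> borel_measurable (\<Pi>\<^sub>M i\<in>{..<k}. E)" if "t \<in> {..<k}" for t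
    using that measurable_component_singleton[of t "{..<k}" "\<lambda>_. E"] by simp
  have "Measurable.pred (\<Pi>\<^sub>M i\<in>{..<k}. E) (\<lambda>y. \<exists>t\<in>{..<k}. first_accept a y t \<and> y t = Max (y ` {..<k}))"
    using 1 borel_measurable_eq[OF 3 2]
    by (intro pred_intros_logic pred_intros_finite) (auto simp: pred_def)
  moreover have "accepted_max a k = (\<lambda>y. \<exists>t\<in>{..<k}. first_accept a y t \<and> y t = Max (y ` {..<k}))"
    by (auto simp: accepted_max_def fun_eq_iff)
  ultimately show ?thesis by (simp only:)
qed (simp add: accepted_max_def[abs_def])

text \<open>The probability that a fresh value exceeds all k values seen. The value 1 for k = 0
  reflects that the first value is always a record.\<close>

definition excess :: "nat \<Rightarrow> (nat \<Rightarrow> real) \<Rightarrow> real" where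
  "excess k y = (if k = 0 then 1 else 1 - cdf E (Max (y ` {..<k})))"

lemma excess_range: "0 \<le> excess k y" "excess k y \<le> 1"
  using cdf_nonneg cdf_bounded_prob by (auto simp: excess_def)

lemma excess_measurable: "excess k \<in> borel_measurable (\<Pi>\<^sub>M i\<in>{..<k}. E)"
proof (cases "k = 0")
  case False
  have [measurable]: "(\<lambda>y. Max (y ` {..<k})) \<in> borel_measurable (\<Pi>\<^sub>M i\<in>{..<k}. E)"
    using False by (intro Max_measurable) auto
  show ?thesis unfolding excess_def[abs_def] using False by simp
qed (simp add: excess_def[abs_def])

lemma excess_upd:
  "excess (Suc k) (y(k := x)) = (if k = 0 \<or> Max (y ` {..<k}) \<le> x then 1 - cdf E x else excess k y)"
  by (auto simp: excess_def Max_upd max_def simp del: fun_upd_apply)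

end

section \<open>The supermartingale bound obtained from an abstract potential\<close>

locale iid_potential = iid_stopping +
  fixes h :: "nat \<Rightarrow> real \<Rightarrow> real"
  assumes h_cont: "continuous_on {0..1} (h q)"
    and h_step: "0 \<le> v \<Longrightarrow> v \<le> 1 \<Longrightarrow>
      (\<integral>\<^sup>+ y. ennreal (if v < y then h q v else max ((1 - y) ^ q) (h q y)) * indicator {0..1} y \<partial>lborel)
        \<le> ennreal (h (Suc q) v)"
begin

text \<open>The potential is continuous on the unit interval only; composing it with
  \<open>clamp\<close> gives a Borel function on the whole line that agrees with it at all values of
  \<open>excess\<close>.\<close>

definition clamp :: "real \<Rightarrow> real" where "clamp v = max 0 (min 1 v)"

lemma h_clamp_measurable [measurable]: "(\<lambda>v. h q (clamp v)) \<in> borel_measurable borel"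
  unfolding clamp_def
  by (intro borel_measurable_continuous_onI continuous_on_compose2[OF h_cont]) (auto intro!: continuous_intros)

lemma clamp_id: "0 \<le> v \<Longrightarrow> v \<le> 1 \<Longrightarrow> clamp v = v" by (simp add: clamp_def)

text \<open>A supermartingale that ends as the indicator of success.\<close>

definition Z :: "nat \<Rightarrow> (nat \<Rightarrow> real) \<Rightarrow> real" where
  "Z k y = (if \<exists>t<k. first_accept a y t
     then (if accepted_max a k y then (1 - excess k y) ^ (n - k) else 0)
     else h (n - k) (excess k y))"

lemma Z_measurable:
  assumes "k \<le> n" shows "Z k \<in> borel_measurable (\<Pi>\<^sub>M i\<in>{..<k}. E)"
proof -
  have [measurable]: "Measurable.pred (\<Pi>\<^sub>M i\<in>{..<k}. E) (\<lambda>y. first_accept a y t)" if "t \<in> {..<k}" for t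
    using assms that by (intro first_accept_measurable) auto
  have "Measurable.pred (\<Pi>\<^sub>M i\<in>{..<k}. E) (\<lambda>y. \<exists>t\<in>{..<k}. first_accept a y t)"
    by (intro pred_intros_finite) auto
  then have [measurable]: "Measurable.pred (\<Pi>\<^sub>M i\<in>{..<k}. E) (\<lambda>y. \<exists>t<k. first_accept a y t)"
    by (simp add: Bex_def)
  note [measurable] = accepted_max_measurable[OF assms] excess_measurable
  have "Z k = (\<lambda>y. (if \<exists>t<k. first_accept a y t
     then (if accepted_max a k y then (1 - excess k y) ^ (n - k) else 0)
     else h (n - k) (clamp (excess k y))))"
    by (auto simp: Z_def fun_eq_iff clamp_id excess_range)
  also have "\<dots> \<in> borel_measurable (\<Pi>\<^sub>M i\<in>{..<k}. E)"
    by measurable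
  finally show ?thesis .
qed

text \<open>After an acceptance, success survives iff the new value does not exceed the maximum,
  which has probability 1 - v and lowers the exponent by one. Before it, the new value either leaves
  v unchanged or is a record, worth at most the larger of accepting and continuing; this is
  \<open>h_step\<close> after transforming the value to a uniform one.\<close>

lemma Z_step:
  assumes "k < n"
  shows "(\<integral>\<^sup>+ x. ennreal (Z (Suc k) (y(k := x))) \<partial>E) \<le> ennreal (Z k y)"
proof -
  define q where "q = n - Suc k"
  have nk: "n - k = Suc q" using assms by (simp add: q_def)
  define v where "v = excess k y"
  have v: "0 \<le> v" "v \<le> 1" using excess_range by (auto simp: v_def)
  define w where "w x = 1 - cdf E x" for x
  have w: "0 \<le> w x" "w x \<le> 1" for x using cdf_nonneg cdf_bounded_prob by (auto simp: w_def)
  have w_ge: "v \<le> w x" if "k \<noteq> 0" "x \<le> Max (y ` {..<k})" for x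
    using that cdf_nondecreasing by (auto simp: w_def v_def excess_def)
  have w_le: "w x \<le> v" if "k = 0 \<or> Max (y ` {..<k}) \<le> x" for x
    using that cdf_nondecreasing cdf_nonneg by (auto simp: w_def v_def excess_def)
  have ex: "excess (Suc k) (y(k := x)) = (if k = 0 \<or> Max (y ` {..<k}) \<le> x then w x else v)" for x
    by (simp add: excess_upd w_def v_def)
  show ?thesis
  proof (cases "\<exists>t<k. first_accept a y t")
    case True
    then obtain t where t: "t < k" "first_accept a y t" by blast
    then have k: "k \<noteq> 0" by auto
    have t': "first_accept a (y(k := x)) t" for x using t by (simp add: first_accept_upd)
    \<comment> \<open>A tie with the maximum does no harm to the value accepted before, hence the
      non-strict inequality.\<close>
    have am: "accepted_max a (Suc k) (y(k := x)) \<longleftrightarrow> accepted_max a k y \<and> x \<le> Max (y ` {..<k})" for x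
    proof -
      have "y t \<le> Max (y ` {..<k})" using t by (intro Max_ge) auto
      moreover have "accepted_max a (Suc k) (y(k := x)) \<longleftrightarrow> (y(k := x)) t = Max ((y(k := x)) ` {..<Suc k})"
        using t'[of x] t(1) first_accept_unique[OF t'] unfolding accepted_max_def
        by (metis less_Suc_eq)
      moreover have "accepted_max a k y \<longleftrightarrow> y t = Max (y ` {..<k})"
        using t first_accept_unique[OF t(2)] unfolding accepted_max_def by metis
      ultimately show ?thesis unfolding Max_upd using t k by auto
    qed
    have "ennreal (Z (Suc k) (y(k := x))) \<le>
        (if accepted_max a k y then ennreal ((1 - v) ^ q) else 0) * indicator {v..1} (w x)" for x
    proof -
      have "\<exists>t<Suc k. first_accept a (y(k := x)) t" using t' t(1) by (meson less_SucI)
      then have Zs: "Z (Suc k) (y(k := x)) = (if accepted_max a k y \<and> x \<le> Max (y ` {..<k})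
          then (1 - excess (Suc k) (y(k := x))) ^ q else 0)"
        by (simp add: Z_def am q_def)
      show ?thesis
      proof (cases "accepted_max a k y \<and> x \<le> Max (y ` {..<k})")
        case T: True
        have "v \<le> w x" using w_ge k T by auto
        moreover have "excess (Suc k) (y(k := x)) = v"
          unfolding ex using T k by (auto simp: w_def v_def excess_def)
        ultimately show ?thesis unfolding Zs using T w by simp
      qed (simp add: Zs)
    qed
    then have "(\<integral>\<^sup>+ x. ennreal (Z (Suc k) (y(k := x))) \<partial>E) \<le>
        (\<integral>\<^sup>+ x. (if accepted_max a k y then ennreal ((1 - v) ^ q) else 0) * indicator {v..1} (1 - cdf E x) \<partial>E)"
      by (intro nn_integral_mono) (simp add: w_def)
    also have "\<dots> = (\<integral>\<^sup>+ x. ((if accepted_max a k y then ennreal ((1 - v) ^ q) else 0) * indicator {v..1} x) * indicator {0..1} x \<partial>lborel)"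
      by (rule nn_integral_cdf_uniform[OF cont]) auto
    also have "\<dots> = (\<integral>\<^sup>+ x. (if accepted_max a k y then ennreal ((1 - v) ^ q) else 0) * indicator {v..1} x \<partial>lborel)"
      using v by (intro nn_integral_cong) (auto split: split_indicator)
    also have "\<dots> = (if accepted_max a k y then ennreal ((1 - v) ^ q) else 0) * ennreal (1 - v)"
      using v by (simp add: nn_integral_cmult)
    also have "\<dots> = ennreal (Z k y)"
      using True v by (auto simp: Z_def nk v_def[symmetric] ennreal_mult'[symmetric] mult.commute)
    finally show ?thesis .
  next
    case False
    then have not_acc: "\<not> (\<exists>t<k. a t (restrict y {..t}))" by (simp add: first_accept_exists)
    define \<Phi> where "\<Phi> y = (if v < y then h q v else max ((1 - y) ^ q) (h q (clamp y)))" for y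
    have [measurable]: "\<Phi> \<in> borel_measurable borel" unfolding \<Phi>_def[abs_def] by measurable
    have "ennreal (Z (Suc k) (y(k := x))) \<le> ennreal (\<Phi> (w x))" for x
    proof (cases "\<exists>t<Suc k. first_accept a (y(k := x)) t")
      case T: True
      then obtain t where t: "t < Suc k" "first_accept a (y(k := x)) t" by blast
      then have tk: "t = k" using False first_accept_upd[of t k a y x] by (metis less_antisym)
      have "accepted_max a (Suc k) (y(k := x)) \<longleftrightarrow> (y(k := x)) k = Max ((y(k := x)) ` {..<Suc k})"
        using t tk first_accept_unique[OF t(2)] unfolding accepted_max_def by blast
      then have am: "accepted_max a (Suc k) (y(k := x)) \<longleftrightarrow> (k = 0 \<or> Max (y ` {..<k}) \<le> x)"
        unfolding Max_upd by auto
      show ?thesis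
      proof (cases "k = 0 \<or> Max (y ` {..<k}) \<le> x")
        case T2: True
        have "Z (Suc k) (y(k := x)) = (1 - w x) ^ q"
          using T T2 am ex by (simp add: Z_def q_def)
        then show ?thesis using w_le[OF T2] by (auto simp: \<Phi>_def intro!: ennreal_leI)
      next
        case F2: False
        then have "Z (Suc k) (y(k := x)) = 0" using T am by (simp add: Z_def)
        then show ?thesis by simp
      qed
    next
      case F: False
      then have Zs: "Z (Suc k) (y(k := x)) = h q (excess (Suc k) (y(k := x)))"
        unfolding Z_def q_def by (rule if_not_P)
      show ?thesis
      proof (cases "k = 0 \<or> Max (y ` {..<k}) \<le> x")
        case True
        then show ?thesis unfolding Zs using w_le[OF True] w[of x]
          by (auto simp: \<Phi>_def ex clamp_id intro!: ennreal_leI)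
      next
        case F2: False
        then have "v \<le> w x" by (intro w_ge) auto
        then show ?thesis unfolding Zs using F2 w[of x]
          \<comment> \<open>A smaller x may have the same distribution function value as the
            maximum. Then v = w x, and \<Phi> takes its second branch, which still dominates the
            potential at v.\<close>
          by (cases "v = w x") (auto simp: \<Phi>_def ex clamp_id intro!: ennreal_leI)
      qed
    qed
    then have "(\<integral>\<^sup>+ x. ennreal (Z (Suc k) (y(k := x))) \<partial>E) \<le> (\<integral>\<^sup>+ x. ennreal (\<Phi> (1 - cdf E x)) \<partial>E)"
      by (intro nn_integral_mono) (simp add: w_def)
    also have "\<dots> = (\<integral>\<^sup>+ x. ennreal (\<Phi> x) * indicator {0..1} x \<partial>lborel)"
      by (rule nn_integral_cdf_uniform[OF cont]) auto
    also have "\<dots> = (\<integral>\<^sup>+ y. ennreal (if v < y then h q v else max ((1 - y) ^ q) (h q y)) * indicator {0..1} y \<partial>lborel)"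
      by (intro nn_integral_cong) (auto simp: \<Phi>_def clamp_id split: split_indicator)
    also have "\<dots> \<le> ennreal (h (Suc q) v)" by (rule h_step[OF v])
    also have "\<dots> = ennreal (Z k y)"
      unfolding Z_def if_not_P[OF False] nk v_def ..
    finally show ?thesis .
  qed
qed

lemma nn_integral_Z: "k \<le> n \<Longrightarrow> (\<integral>\<^sup>+ y. ennreal (Z k y) \<partial>(\<Pi>\<^sub>M i\<in>{..<k}. E)) \<le> ennreal (h n 1)"
proof (induction k)
  case 0
  interpret product_sigma_finite "\<lambda>_::nat. E" by (rule product_sigma_finite)
  show ?case by (simp add: lessThan_0 PiM_empty nn_integral_count_space_finite Z_def excess_def)
next
  case (Suc k)
  interpret product_sigma_finite "\<lambda>_::nat. E" by (rule product_sigma_finite)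
  have Zm: "(\<lambda>y. ennreal (Z (Suc k) y)) \<in> borel_measurable (\<Pi>\<^sub>M i\<in>insert k {..<k}. E)"
    using Z_measurable[of "Suc k"] Suc.prems by (simp add: lessThan_Suc)
  have "(\<integral>\<^sup>+ y. ennreal (Z (Suc k) y) \<partial>(\<Pi>\<^sub>M i\<in>{..<Suc k}. E)) =
      (\<integral>\<^sup>+ y. \<integral>\<^sup>+ x. ennreal (Z (Suc k) (y(k := x))) \<partial>E \<partial>(\<Pi>\<^sub>M i\<in>{..<k}. E))"
    unfolding lessThan_Suc by (rule product_nn_integral_insert[OF _ _ Zm]) auto
  also have "\<dots> \<le> (\<integral>\<^sup>+ y. ennreal (Z k y) \<partial>(\<Pi>\<^sub>M i\<in>{..<k}. E))"
    using Suc.prems by (intro nn_integral_mono Z_step) auto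
  finally show ?case using Suc by simp
qed

lemma accepted_max_bound:
  "emeasure (\<Pi>\<^sub>M i\<in>{..<n}. E) {y \<in> space (\<Pi>\<^sub>M i\<in>{..<n}. E). accepted_max a n y} \<le> ennreal (h n 1)"
proof -
  note [measurable] = accepted_max_measurable[OF order_refl]
  have "emeasure (\<Pi>\<^sub>M i\<in>{..<n}. E) {y \<in> space (\<Pi>\<^sub>M i\<in>{..<n}. E). accepted_max a n y} =
    (\<integral>\<^sup>+ y. indicator {y \<in> space (\<Pi>\<^sub>M i\<in>{..<n}. E). accepted_max a n y} y \<partial>(\<Pi>\<^sub>M i\<in>{..<n}. E))"
    by (subst nn_integral_indicator) auto
  \<comment> \<open>At time n the exponent n - k is 0, so \<open>Z\<close> equals 1 on
    success.\<close>
  also have "\<dots> \<le> (\<integral>\<^sup>+ y. ennreal (Z n y) \<partial>(\<Pi>\<^sub>M i\<in>{..<n}. E))"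
    by (intro nn_integral_mono) (auto simp: Z_def accepted_max_def split: split_indicator)
  also have "\<dots> \<le> ennreal (h n 1)" by (rule nn_integral_Z) simp
  finally show ?thesis .
qed

end

section \<open>The upper bound for identical distributions\<close>

lemma online_algorithm_section:
  assumes "online_algorithm n A" "\<omega> \<in> space (seed A)" "t < n"
  shows "Measurable.pred (\<Pi>\<^sub>M i\<in>{..t}. borel) (accept A t \<omega>)"
proof -
  have "(\<lambda>(\<omega>, h). accept A t \<omega> h) \<in> measurable (seed A \<Otimes>\<^sub>M (\<Pi>\<^sub>M i\<in>{..t}. borel)) (count_space UNIV)"
    using assms by (simp add: online_algorithm_def)
  from measurable_Pair2[OF this assms(2)] show ?thesis by simp
qed

text \<open>By Fubini the seed and the order may be fixed. A fixed order only permutes the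
  coordinates, which preserves a product of equal distributions; a deterministic stopping rule on
  independent values remains.\<close>

lemma success_prob_iid_le:
  assumes E: "continuous_distribution E" and A: "online_algorithm n A" and "0 \<le> B"
    and B: "\<And>\<omega>. \<omega> \<in> space (seed A) \<Longrightarrow>
      emeasure (\<Pi>\<^sub>M i\<in>{..<n}. E) {y \<in> space (\<Pi>\<^sub>M i\<in>{..<n}. E). accepted_max (\<lambda>t. accept A t \<omega>) n y} \<le> ennreal B"
  shows "success_prob n (\<lambda>_. E) A \<le> B"
proof -
  let ?X = "\<Pi>\<^sub>M i\<in>{..<n}. E"
  let ?P = "uniform_count_measure {p. p permutes {..<n}}"
  let ?O = "outcome_space n (\<lambda>_. E) A"
  let ?S = "{(\<omega>, x, p) \<in> space ?O. \<exists>t<n. accepts_at A \<omega> (\<lambda>s. x (p s)) t \<and> x (p t) = Max (x ` {..<n})}"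
  interpret E: real_distribution E using E by (simp add: continuous_distribution_def)
  interpret seed: prob_space "seed A" using A by (simp add: online_algorithm_def)
  have fin: "finite {p. p permutes {..<n}}" by (rule finite_permutations) simp
  interpret P: prob_space ?P
    by (rule prob_space_uniform_count_measure[OF fin]) (use permutes_id in blast)
  interpret X: prob_space ?X by (intro prob_space_PiM E.prob_space_axioms)
  interpret XP: pair_prob_space ?X ?P ..

  have O: "?O = seed A \<Otimes>\<^sub>M (?X \<Otimes>\<^sub>M ?P)" by (simp add: outcome_space_def)
  show ?thesis
  proof (cases "?S \<in> sets ?O")
    \<comment> \<open>\<open>measure\<close> assigns 0 to a set that is not measurable.\<close>
    case False
    then show ?thesis using \<open>0 \<le> B\<close> by (simp add: success_prob_def measure_notin_sets)
  next
    case True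
    then have S: "?S \<in> sets (seed A \<Otimes>\<^sub>M (?X \<Otimes>\<^sub>M ?P))" by (simp only: O)
    have *: "emeasure ?X ((\<lambda>x. (x, p)) -` (Pair \<omega> -` ?S)) \<le> ennreal B"
      if \<omega>: "\<omega> \<in> space (seed A)" and p: "p permutes {..<n}" for \<omega> p
    proof -
      let ?G = "{y \<in> space ?X. accepted_max (\<lambda>t. accept A t \<omega>) n y}"
      interpret iid_stopping E "\<lambda>t. accept A t \<omega>" n
        by unfold_locales (use E online_algorithm_section[OF A \<omega>] in auto)
      have G: "?G \<in> sets ?X"
        using accepted_max_measurable[OF order_refl] by (simp add: pred_def)
      let ?r = "\<lambda>x. \<lambda>i\<in>{..<n}. x (p i) :: real"
      have pin: "p \<in> {..<n} \<rightarrow> {..<n}" using permutes_in_image[OF p] by auto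
      have D: "distr ?X ?X ?r = ?X"
        using distr_PiM_reindex[of "{..<n}" "\<lambda>_. E" p "{..<n}"] E.prob_space_axioms permutes_inj_on[OF p] pin by simp
      have rm: "?r \<in> measurable ?X ?X"
        by (intro measurable_restrict measurable_component_singleton) (use pin in auto)
      have "(\<lambda>x. (x, p)) -` (Pair \<omega> -` ?S) = ?r -` ?G \<inter> space ?X"
      proof -
        have "(\<exists>t<n. accepts_at A \<omega> (\<lambda>s. x (p s)) t \<and> x (p t) = Max (x ` {..<n})) \<longleftrightarrow>
            accepted_max (\<lambda>t. accept A t \<omega>) n (?r x)" for x
        proof -
          have "restrict (\<lambda>s. x (p s)) {..t} = restrict (?r x) {..t}" if "t < n" for t
            using that by (auto simp: fun_eq_iff restrict_def)
          then have 1: "accepts_at A \<omega> (\<lambda>s. x (p s)) t \<longleftrightarrow> first_accept (\<lambda>t. accept A t \<omega>) (?r x) t" if "t < n" for t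
            using that by (auto simp: accepts_at_def first_accept_def)
          have "?r x ` {..<n} = x ` (p ` {..<n})" by auto
          also have "p ` {..<n} = {..<n}" by (rule permutes_image[OF p])
          finally have 2: "?r x ` {..<n} = x ` {..<n}" .
          show ?thesis unfolding accepted_max_def 2 using 1 by auto
        qed
        moreover have "?r x \<in> space ?X" if "x \<in> space ?X" for x
          using measurable_space[OF rm that] .
        ultimately show ?thesis
          using \<omega> p by (auto simp: O space_pair_measure space_uniform_count_measure)
      qed
      then have "emeasure ?X ((\<lambda>x. (x, p)) -` (Pair \<omega> -` ?S)) = emeasure (distr ?X ?X ?r) ?G"
        by (simp add: emeasure_distr[OF rm G])
      then show ?thesis using B[OF \<omega>] by (simp add: D)
    qed
    have "emeasure ?O ?S = (\<integral>\<^sup>+ \<omega>. emeasure (?X \<Otimes>\<^sub>M ?P) (Pair \<omega> -` ?S) \<partial>seed A)"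
      unfolding O
      by (rule sigma_finite_measure.emeasure_pair_measure_alt[OF prob_space_imp_sigma_finite[OF XP.P.prob_space_axioms] S[unfolded O]])
    also have "\<dots> \<le> (\<integral>\<^sup>+ \<omega>. ennreal B \<partial>seed A)"
    proof (rule nn_integral_mono)
      fix \<omega> assume \<omega>: "\<omega> \<in> space (seed A)"
      have "emeasure (?X \<Otimes>\<^sub>M ?P) (Pair \<omega> -` ?S) = (\<integral>\<^sup>+ p. emeasure ?X ((\<lambda>x. (x, p)) -` (Pair \<omega> -` ?S)) \<partial>?P)"
        by (rule XP.emeasure_pair_measure_alt2[OF sets_Pair1[OF S]])
      also have "\<dots> \<le> (\<integral>\<^sup>+ p. ennreal B \<partial>?P)"
        by (intro nn_integral_mono *[OF \<omega>]) (simp add: space_uniform_count_measure)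
      also have "\<dots> = ennreal B" by (simp add: P.emeasure_space_1)
      finally show "emeasure (?X \<Otimes>\<^sub>M ?P) (Pair \<omega> -` ?S) \<le> ennreal B" .
    qed
    also have "\<dots> = ennreal B" by (simp add: seed.emeasure_space_1)
    finally show ?thesis
      using \<open>0 \<le> B\<close> by (simp add: success_prob_def measure_def enn2real_leI)
  qed
qed

context gamma_constant
begin

lemma success_prob_iid_le_pot:
  assumes E: "continuous_distribution E" and A: "online_algorithm n A" and "1 \<le> r0"
  shows "success_prob n (\<lambda>_. E) A \<le> pot r0 n 1"
proof (rule success_prob_iid_le[OF E A])
  show "0 \<le> pot r0 n 1" using assms by (intro pot_nonneg) auto
  fix \<omega> assume \<omega>: "\<omega> \<in> space (seed A)"
  interpret E: real_distribution E using E by (simp add: continuous_distribution_def)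
  interpret iid_potential E "\<lambda>t. accept A t \<omega>" n "pot r0"
    by unfold_locales
      (use E online_algorithm_section[OF A \<omega>] continuous_on_pot pot_step_nn[OF \<open>1 \<le> r0\<close>] in auto)
  show "emeasure (\<Pi>\<^sub>M i\<in>{..<n}. E) {y \<in> space (\<Pi>\<^sub>M i\<in>{..<n}. E). accepted_max (\<lambda>t. accept A t \<omega>) n y}
    \<le> ennreal (pot r0 n 1)"
    by (rule accepted_max_bound)
qed

text \<open>The errors are made small one after the other: r0 is chosen to control 2 * C / r0, and
  then n so large that r0 values are a negligible fraction.\<close>

lemma eventually_success_prob_iid_le:
  assumes E: "continuous_distribution E" and "0 < e"
  shows "\<forall>\<^sub>F n in sequentially. \<forall>A. online_algorithm n A \<longrightarrow> success_prob n (\<lambda>_. E) A \<le> gamma_value c + e"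
proof -
  obtain r :: nat where r: "4 * C / e < real r" using reals_Archimedean2 by blast
  define r0 where "r0 = Suc r"
  have r0: "1 \<le> r0" "2 * C / real r0 \<le> e / 2"
    using r \<open>0 < e\<close> by (auto simp: r0_def field_simps)
  have "(\<lambda>n. real r0 / real (Suc n)) \<longlonglongrightarrow> 0" by real_asymp
  then have "\<forall>\<^sub>F n in sequentially. real r0 / real (Suc n) < e / 2"
    using \<open>0 < e\<close> by (intro order_tendstoD(2)[where y=0]) auto
  then obtain N where N: "\<And>n. n \<ge> N \<Longrightarrow> real r0 / real (Suc n) < e / 2"
    by (auto simp: eventually_sequentially)
  show ?thesis
    unfolding eventually_sequentially
  proof (intro exI[of _ "N + r0"] allI impI)
    fix n A assume n: "N + r0 \<le> n" and A: "online_algorithm n A"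
    have "success_prob n (\<lambda>_. E) A \<le> pot r0 n 1"
      by (rule success_prob_iid_le_pot[OF E A r0(1)])
    also have "\<dots> \<le> gamma_value c + real r0 / real (Suc (n - r0)) + 2 * C / real r0"
      using n r0 by (intro pot_final) auto
    also have "\<dots> \<le> gamma_value c + e"
    proof -
      have "N \<le> n - r0" using n by simp
      from N[OF this] r0(2) show ?thesis by linarith
    qed
    finally show "success_prob n (\<lambda>_. E) A \<le> gamma_value c + e" .
  qed
qed

end

section \<open>The success probability as an iterated integral\<close>

context gamma_constant
begin

definition \<beta> :: "real \<Rightarrow> real" where "\<beta> s = c / (1 - s)"

lemma \<beta>_pos: "s < 1 \<Longrightarrow> 0 < \<beta> s" using c_pos by (simp add: \<beta>_def)

lemma \<beta>_measurable [measurable]: "\<beta> \<in> borel_measurable borel"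
  unfolding \<beta>_def[abs_def] by measurable

lemma \<beta>_deriv: "s < 1 \<Longrightarrow> (\<beta> has_real_derivative \<beta> s / (1 - s)) (at s)"
  unfolding \<beta>_def[abs_def] by (auto intro!: derivative_eq_intros simp: field_simps)

definition Q :: "real \<Rightarrow> real" where "Q s = exp_int (s * \<beta> s) - exp_int (\<beta> s)"

text \<open>This is where the equation for c enters. The substitution x = (1 - t) *
  \<open>\<beta> s\<close> turns the integral into exp (- \<open>\<beta> s\<close>) *
  \<open>expq_int\<close> ((1 - s) * \<open>\<beta> s\<close>), and (1 - s) *
  \<open>\<beta> s\<close> = c.\<close>

lemma nn_integral_fill:
  assumes "0 < s" "s < 1"
  shows "(\<integral>\<^sup>+ t. ennreal ((exp (- t * \<beta> s) - exp (- \<beta> s)) / (1 - t)) * indicator {s<..<1} t \<partial>lborel)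
    = ennreal (exp (- \<beta> s))"
proof -
  define b where "b = \<beta> s"
  have b: "0 < b" "(1 - s) * b = c" using assms \<beta>_pos by (auto simp: b_def \<beta>_def)
  define G where "G t = - (exp (- b) * expq_int ((1 - t) * b))" for t
  have "((\<lambda>t. (exp (- t * b) - exp (- b)) / (1 - t)) has_integral G 1 - G s) {s..1}"
  proof (rule fundamental_theorem_of_calculus_interior)
    show "continuous_on {s..1} G"
      unfolding G_def using b(1) assms
      by (intro continuous_intros continuous_on_compose2[OF continuous_on_expq_int]) auto
    fix t assume t: "t \<in> {s<..<1}"
    have "((\<lambda>t. expq_int ((1 - t) * b)) has_real_derivative expq ((1 - t) * b) * - b) (at t)"
      by (rule DERIV_chain2[OF expq_int_deriv]) (use t b in \<open>auto intro!: derivative_eq_intros\<close>)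
    then have "(G has_real_derivative - (exp (- b) * (expq ((1 - t) * b) * - b))) (at t)"
      unfolding G_def by (intro derivative_intros DERIV_cmult)
    moreover have "- (exp (- b) * (expq ((1 - t) * b) * - b)) = (exp (- t * b) - exp (- b)) / (1 - t)"
    proof -
      have "exp (- b) * exp ((1 - t) * b) = exp (- t * b)"
        by (simp add: exp_add[symmetric] algebra_simps)
      then show ?thesis using t b by (simp add: expq_def field_simps)
    qed
    ultimately show "(G has_vector_derivative (exp (- t * b) - exp (- b)) / (1 - t)) (at t)"
      by (simp add: has_real_derivative_iff_has_vector_derivative)
  qed (use assms in auto)
  moreover have "G 1 - G s = exp (- b)" by (simp add: G_def b expq_int_c)
  ultimately have h: "((\<lambda>t. (exp (- t * b) - exp (- b)) / (1 - t)) has_integral exp (- b)) {s<..<1}"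
    by (simp add: has_integral_Icc_iff_Ioo)
  show ?thesis unfolding b_def[symmetric]
    by (rule nn_integral_has_integral_lebesgue'[OF _ h]) (use b in \<open>auto intro!: divide_nonneg_pos mult_left_le_one_le\<close>)
qed

lemma nn_integral_Q:
  assumes "0 < s" "s < 1"
  shows "(\<integral>\<^sup>+ t. ennreal (exp (- t * \<beta> s) / t) * indicator {s<..<1} t \<partial>lborel) = ennreal (Q s)"
proof -
  define b where "b = \<beta> s"
  have b: "0 < b" using assms \<beta>_pos by (auto simp: b_def)
  define G where "G t = - exp_int (t * b)" for t
  have "((\<lambda>t. exp (- t * b) / t) has_integral G 1 - G s) {s..1}"
  proof (rule fundamental_theorem_of_calculus)
    fix t assume t: "t \<in> {s..1}"
    have "((\<lambda>t. exp_int (t * b)) has_real_derivative - (exp (- (t * b)) / (t * b)) * b) (at t)"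
      by (rule DERIV_chain2[OF exp_int_deriv]) (use t b assms in \<open>auto intro!: derivative_eq_intros\<close>)
    from DERIV_minus[OF this] have "(G has_real_derivative exp (- t * b) / t) (at t)"
      unfolding G_def using b by simp
    then show "(G has_vector_derivative exp (- t * b) / t) (at t within {s..1})"
      by (simp add: has_real_derivative_iff_has_vector_derivative has_vector_derivative_at_within)
  qed (use assms in auto)
  then have h: "((\<lambda>t. exp (- t * b) / t) has_integral Q s) {s<..<1}"
    by (simp add: has_integral_Icc_iff_Ioo G_def Q_def b_def)
  show ?thesis unfolding b_def[symmetric]
    by (rule nn_integral_has_integral_lebesgue'[OF _ h]) (use assms in auto)
qed

text \<open>Integration by parts of \<open>Q\<close>, using \<open>c / \<beta> s = 1 - s\<close>.\<close>

definition R :: "real \<Rightarrow> real" where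
  "R s = s * Q s - K * exp_int (\<beta> s) - (1 - s) * exp (- \<beta> s)"

text \<open>Apart from \<open>Q s\<close>, the derivative is a multiple of (s - exp c) + K + (1 - s)
  + b * (1 - s), which vanishes by b * (1 - s) = c and the value of \<open>K\<close>.\<close>

lemma R_deriv:
  assumes "0 < s" "s < 1" shows "(R has_real_derivative Q s) (at s)"
proof -
  define b where "b = \<beta> s"
  have b: "0 < b" "0 < s * b" using \<beta>_pos assms by (auto simp: b_def)
  have bs: "b * (1 - s) = c" using assms by (simp add: b_def \<beta>_def)
  have d\<beta>: "(\<beta> has_real_derivative b / (1 - s)) (at s)"
    unfolding b_def by (rule \<beta>_deriv) (use assms in auto)
  have 1: "((\<lambda>s. exp_int (\<beta> s)) has_real_derivative - (exp (- b) / b) * (b / (1 - s))) (at s)"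
    using DERIV_chain2[OF exp_int_deriv d\<beta>] b by (simp add: b_def)
  have ds: "((\<lambda>s. s * \<beta> s) has_real_derivative b + s * (b / (1 - s))) (at s)"
    using DERIV_mult[OF DERIV_ident d\<beta>] by (simp add: b_def algebra_simps)
  have 2: "((\<lambda>s. exp_int (s * \<beta> s)) has_real_derivative - (exp (- (s * b)) / (s * b)) * (b + s * (b / (1 - s)))) (at s)"
    using DERIV_chain2[OF exp_int_deriv ds] b by (simp add: b_def)
  have 3: "((\<lambda>s. exp (- \<beta> s)) has_real_derivative exp (- b) * - (b / (1 - s))) (at s)"
    using DERIV_chain2[OF DERIV_exp DERIV_minus[OF d\<beta>]] by (simp add: b_def)
  have 4: "((\<lambda>s. (1 - s) * exp (- \<beta> s)) has_real_derivative
      (0 - 1) * exp (- b) + (exp (- b) * - (b / (1 - s))) * (1 - s)) (at s)"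
    using DERIV_mult[OF DERIV_diff[OF DERIV_const DERIV_ident] 3] by (simp only: b_def)
  let ?Q' = "- (exp (- (s * b)) / (s * b)) * (b + s * (b / (1 - s))) - - (exp (- b) / b) * (b / (1 - s))"
  have dQ: "(Q has_real_derivative ?Q') (at s)"
    unfolding Q_def[abs_def] by (rule DERIV_diff[OF 2 1])
  have "(R has_real_derivative (1 * Q s + ?Q' * s) - K * (- (exp (- b) / b) * (b / (1 - s)))
      - ((0 - 1) * exp (- b) + (exp (- b) * - (b / (1 - s))) * (1 - s))) (at s)"
    unfolding R_def[abs_def]
    by (rule DERIV_diff[OF DERIV_diff[OF DERIV_mult[OF DERIV_ident dQ] DERIV_cmult[OF 1]] 4])
  moreover have "(1 * Q s + ?Q' * s) - K * (- (exp (- b) / b) * (b / (1 - s)))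
      - ((0 - 1) * exp (- b) + (exp (- b) * - (b / (1 - s))) * (1 - s)) = Q s"
  proof -
    have "s * b = b - c" using bs by (simp add: algebra_simps)
    then have e: "exp (- (s * b)) = exp (- b) * exp c" by (simp add: exp_diff exp_minus divide_inverse)
    have q: "?Q' * s = exp (- b) * (s - exp c) / (1 - s)"
    proof -
      have "b + s * (b / (1 - s)) = b / (1 - s)" using assms by (simp add: divide_simps) (simp add: algebra_simps)
      moreover have "exp (- b) * exp c / (s * b) * (b / (1 - s)) = exp (- b) * exp c / (s * (1 - s))"
        "exp (- b) / b * (b / (1 - s)) = exp (- b) / (1 - s)"
        using b by auto
      ultimately have "?Q' = - (exp (- b) * exp c / (s * (1 - s))) + exp (- b) / (1 - s)"
        unfolding e by simp
      then show ?thesis using assms by (simp add: divide_simps) (simp add: algebra_simps)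
    qed
    have "?Q' * s - K * (- (exp (- b) / b) * (b / (1 - s)))
      - ((0 - 1) * exp (- b) + (exp (- b) * - (b / (1 - s))) * (1 - s)) =
       exp (- b) * ((s - exp c) + K + (1 - s) + b * (1 - s)) / (1 - s)"
    proof -
      have k: "K * (- (exp (- b) / b) * (b / (1 - s))) = - K * exp (- b) / (1 - s)" using b by simp
      show ?thesis
        unfolding q k using assms by (simp add: divide_simps) (simp add: algebra_simps)
    qed
    also have "\<dots> = 0" unfolding bs by (simp add: K_def)
    finally show ?thesis by simp
  qed
  ultimately show ?thesis by (rule DERIV_cong)
qed

lemma Q_nonneg: "0 < s \<Longrightarrow> s < 1 \<Longrightarrow> 0 \<le> Q s"
  using exp_int_antimono[of "s * \<beta> s" "\<beta> s"] \<beta>_pos[of s] by (simp add: Q_def)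

text \<open>\<open>R\<close> rises from - \<open>gamma_value c\<close> to 0. At 0 the factor s
  defeats the logarithmic singularity of \<open>exp_int (s * \<beta> s)\<close>; at 1 the arguments
  of \<open>exp_int\<close> tend to infinity.\<close>

lemma nn_integral_Q_gamma:
  "(\<integral>\<^sup>+ s. ennreal (Q s) * indicator {0<..<1} s \<partial>lborel) = ennreal (gamma_value c)"
proof -
  \<comment> \<open>The end values are prescribed as limits, since the formula for \<open>R\<close>
    evaluates \<open>exp_int\<close> at 0 for s = 0 and divides by 0 in \<open>\<beta>\<close> for s
    = 1.\<close>
  define R' where "R' s = (if s = 0 then - gamma_value c else if s = 1 then 0 else R s)" for s
  have \<beta>0: "\<beta> 0 = c" by (simp add: \<beta>_def)
  have c\<beta>: "(\<beta> \<longlongrightarrow> c) (at_right 0)"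
    using isCont_tendsto_compose[OF DERIV_isCont[OF \<beta>_deriv[of 0]] tendsto_ident_at] by (simp add: \<beta>0)
  have E\<beta>: "((\<lambda>s. exp_int (\<beta> s)) \<longlongrightarrow> exp_int c) (at_right 0)"
    by (rule isCont_tendsto_compose[OF isCont_exp_int[OF c_pos] c\<beta>])
  have "filterlim (\<lambda>s. s * \<beta> s) (at_right 0) (at_right 0)"
    unfolding \<beta>_def using c_pos by real_asymp
  from filterlim_compose[OF exp_int_mult_tendsto_0 this]
  have "((\<lambda>s. (1 - s) / c * (s * \<beta> s * exp_int (s * \<beta> s))) \<longlongrightarrow> (1 - 0) / c * 0) (at_right 0)"
    using c_pos by (intro tendsto_intros) auto
  moreover have "\<forall>\<^sub>F s in at_right 0. (1 - s) / c * (s * \<beta> s * exp_int (s * \<beta> s)) = s * exp_int (s * \<beta> s)"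
    using c_pos by (auto simp: eventually_at_right_field \<beta>_def intro!: exI[of _ 1])
  ultimately have sE: "((\<lambda>s. s * exp_int (s * \<beta> s)) \<longlongrightarrow> 0) (at_right 0)"
    by (simp add: tendsto_cong)
  have "((\<lambda>s. (s * exp_int (s * \<beta> s) - s * exp_int (\<beta> s)) - K * exp_int (\<beta> s) - (1 - s) * exp (- \<beta> s)) \<longlongrightarrow>
      (0 - 0 * exp_int c) - K * exp_int c - (1 - 0) * exp (- c)) (at_right 0)"
    by (intro tendsto_intros sE E\<beta> c\<beta>)
  then have lim0: "(R \<longlongrightarrow> - gamma_value c) (at_right 0)"
    by (simp add: R_def[abs_def] Q_def right_diff_distrib gamma_value_altdef)
  have \<beta>1: "filterlim \<beta> at_top (at_left 1)" "filterlim (\<lambda>s. s * \<beta> s) at_top (at_left 1)"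
    unfolding \<beta>_def[abs_def] using c_pos by real_asymp+
  note E1 = filterlim_compose[OF exp_int_tendsto_0 \<beta>1(1)] filterlim_compose[OF exp_int_tendsto_0 \<beta>1(2)]
  have "((\<lambda>x::real. exp (- x)) \<longlongrightarrow> 0) at_top" by real_asymp
  note e1 = filterlim_compose[OF this \<beta>1(1)]
  have "(R \<longlongrightarrow> 1 * (0 - 0) - K * 0 - (1 - 1) * 0) (at_left 1)"
    unfolding R_def[abs_def] Q_def by (intro tendsto_intros E1 e1)
  then have lim1: "(R \<longlongrightarrow> 0) (at_left 1)" by simp
  have "(Q has_integral R' 1 - R' 0) {0..1}"
  proof (rule fundamental_theorem_of_calculus_interior)
    have ev: "R' s = R s" if "0 < s" "s < 1" for s using that by (simp add: R'_def)
    show "continuous_on {0..1} R'"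
    proof (rule continuous_on_IccI)
      show "(R' \<longlongrightarrow> R' 0) (at_right 0)"
        by (rule Lim_transform_eventually[OF lim0[THEN tendsto_eq_rhs]])
          (auto simp: R'_def eventually_at_right_field intro!: exI[of _ 1])
      show "(R' \<longlongrightarrow> R' 1) (at_left 1)"
        by (rule Lim_transform_eventually[OF lim1[THEN tendsto_eq_rhs]])
          (auto simp: R'_def eventually_at_left_field intro!: exI[of _ 0])
      fix x :: real assume x: "0 < x" "x < 1"
      have "(R' has_real_derivative Q x) (at x)"
        by (rule has_field_derivative_transform_within_open[OF R_deriv, of _ "{0<..<1}"]) (use x ev in auto)
      then show "R' \<midarrow>x\<rightarrow> R' x" using DERIV_isCont isCont_def by blast
    qed auto
    fix x :: real assume x: "x \<in> {0<..<1}"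
    have "(R' has_real_derivative Q x) (at x)"
      by (rule has_field_derivative_transform_within_open[OF R_deriv, of _ "{0<..<1}"]) (use x ev in auto)
    then show "(R' has_vector_derivative Q x) (at x)"
      by (simp add: has_real_derivative_iff_has_vector_derivative)
  qed auto
  then have "(Q has_integral gamma_value c) {0<..<1}"
    by (simp add: has_integral_Icc_iff_Ioo R'_def)
  then show ?thesis
    by (rule nn_integral_has_integral_lebesgue'[rotated]) (use Q_nonneg in auto)
qed

text \<open>The mean of \<open>payoff\<close> (defined below) in the Poisson limit, where the number
  N of values above the threshold of time s is Poisson with mean \<open>\<beta> s\<close>. The
  quotient is the mean of (1 - t)^(N - 1) on N > 0; the rest is the probability that N = 0 while
  some value exceeds the threshold of time t.\<close>

definition success_density :: "real \<Rightarrow> real \<Rightarrow> real" where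
  "success_density t s = (exp (- t * \<beta> s) - exp (- \<beta> s)) / (1 - t) + exp (- \<beta> s) - exp (- \<beta> t)"

text \<open>
  Splitting \<open>1 / (t * (1 - t)) = 1 / t + 1 / (1 - t)\<close>, the integral over \<open>s < t < 1\<close> of the part with
  \<open>1 / (1 - t)\<close> is \<open>exp (- \<beta> s)\<close> by the choice of \<open>c\<close>. This cancels the term \<open>- exp (- \<beta> t)\<close>.
\<close>

lemma nn_integral_success_density:
  "(\<integral>\<^sup>+ t. (\<integral>\<^sup>+ s. ennreal (success_density t s / t) * indicator {0<..<t} s \<partial>lborel) * indicator {0<..<1} t \<partial>lborel)
    = ennreal (gamma_value c)"
proof -
  \<comment> \<open>The triangle is built into the integrands, so that Fubini applies on the whole
    plane. The identity f1 + f2 = f3 + f4 replaces a subtraction of extended nonnegative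
    integrals.\<close>
  define f1 where "f1 s t = (if 0 < s \<and> s < t \<and> t < 1 then ennreal (success_density t s / t) else 0)" for s t
  define f2 where "f2 s t = (if 0 < s \<and> s < t \<and> t < 1 then ennreal (exp (- \<beta> t) / t) else 0)" for s t
  define f3 where "f3 s t = (if 0 < s \<and> s < t \<and> t < 1 then ennreal ((exp (- t * \<beta> s) - exp (- \<beta> s)) / (1 - t)) else 0)" for s t
  define f4 where "f4 s t = (if 0 < s \<and> s < t \<and> t < 1 then ennreal (exp (- t * \<beta> s) / t) else 0)" for s t
  have [measurable]: "case_prod f1 \<in> borel_measurable (borel \<Otimes>\<^sub>M borel)"
    "case_prod f2 \<in> borel_measurable (borel \<Otimes>\<^sub>M borel)"
    "case_prod f3 \<in> borel_measurable (borel \<Otimes>\<^sub>M borel)"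
    "case_prod f4 \<in> borel_measurable (borel \<Otimes>\<^sub>M borel)"
    unfolding f1_def f2_def f3_def f4_def success_density_def by measurable
  define \<kappa> where "\<kappa> = (\<integral>\<^sup>+ t. ennreal (exp (- \<beta> t)) * indicator {0<..<1} t \<partial>lborel)"
  \<comment> \<open>Finiteness allows \<kappa> to be cancelled at the end.\<close>
  have "\<kappa> \<le> (\<integral>\<^sup>+ t. indicator {0<..<1::real} t \<partial>lborel)"
    unfolding \<kappa>_def by (intro nn_integral_mono) (auto simp: less_imp_le[OF \<beta>_pos] split: split_indicator)
  also have "\<dots> < \<infinity>" by simp
  finally have \<kappa>: "\<kappa> \<noteq> \<infinity>" by simp
  have eq: "f1 s t + f2 s t = f3 s t + f4 s t" for s t
  proof (cases "0 < s \<and> s < t \<and> t < 1")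
    case True
    have le: "\<beta> s \<le> \<beta> t" using True c_pos by (auto simp: \<beta>_def intro!: divide_left_mono)
    have s1: "0 < \<beta> s" using True \<beta>_pos by auto
    have AB: "0 \<le> (exp (- t * \<beta> s) - exp (- \<beta> s)) / (1 - t)"
      using True s1 by (auto intro!: divide_nonneg_pos mult_left_le_one_le)
    have J: "0 \<le> success_density t s / t"
    proof -
      have "exp (- \<beta> t) \<le> exp (- \<beta> s)" using le by simp
      with AB have "0 \<le> success_density t s" unfolding success_density_def by linarith
      then show ?thesis using True by simp
    qed
    have "success_density t s / t + exp (- \<beta> t) / t =
      (exp (- t * \<beta> s) - exp (- \<beta> s)) / (1 - t) + exp (- t * \<beta> s) / t"
      using True by (simp add: success_density_def divide_simps) (simp add: algebra_simps)
    then show ?thesis using True AB J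
      by (simp add: f1_def f2_def f3_def f4_def flip: ennreal_plus)
  next
    case False
    then have "f1 s t = 0" "f2 s t = 0" "f3 s t = 0" "f4 s t = 0"
      unfolding f1_def f2_def f3_def f4_def by (rule if_not_P)+
    then show ?thesis by simp
  qed
  have swap: "(\<integral>\<^sup>+ t. \<integral>\<^sup>+ s. f s t \<partial>lborel \<partial>lborel) = (\<integral>\<^sup>+ s. \<integral>\<^sup>+ t. f s t \<partial>lborel \<partial>lborel)"
    if "case_prod f \<in> borel_measurable (borel \<Otimes>\<^sub>M borel)" for f :: "real \<Rightarrow> real \<Rightarrow> ennreal"
    using that by (intro lborel_pair.Fubini') simp
  have i2: "(\<integral>\<^sup>+ t. \<integral>\<^sup>+ s. f2 s t \<partial>lborel \<partial>lborel) = \<kappa>"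
    unfolding \<kappa>_def
  proof (rule nn_integral_cong)
    fix t :: real
    have "(\<integral>\<^sup>+ s. f2 s t \<partial>lborel) = (\<integral>\<^sup>+ s. (ennreal (exp (- \<beta> t) / t) * indicator {0<..<1} t) * indicator {0<..<t} s \<partial>lborel)"
      by (intro nn_integral_cong) (auto simp: f2_def split: split_indicator)
    also have "\<dots> = ennreal (exp (- \<beta> t)) * indicator {0<..<1} t"
      by (simp add: nn_integral_cmult flip: ennreal_mult' split: split_indicator)
    finally show "(\<integral>\<^sup>+ s. f2 s t \<partial>lborel) = ennreal (exp (- \<beta> t)) * indicator {0<..<1} t" .
  qed
  have i3: "(\<integral>\<^sup>+ s. \<integral>\<^sup>+ t. f3 s t \<partial>lborel \<partial>lborel) = \<kappa>"
    unfolding \<kappa>_def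
  proof (rule nn_integral_cong)
    fix s :: real
    have "(\<integral>\<^sup>+ t. f3 s t \<partial>lborel) = (\<integral>\<^sup>+ t. (ennreal ((exp (- t * \<beta> s) - exp (- \<beta> s)) / (1 - t)) * indicator {s<..<1} t) * indicator {0<..<1} s \<partial>lborel)"
      by (intro nn_integral_cong) (auto simp: f3_def split: split_indicator)
    also have "\<dots> = (\<integral>\<^sup>+ t. ennreal ((exp (- t * \<beta> s) - exp (- \<beta> s)) / (1 - t)) * indicator {s<..<1} t \<partial>lborel) * indicator {0<..<1} s"
      by (rule nn_integral_multc) measurable
    also have "\<dots> = ennreal (exp (- \<beta> s)) * indicator {0<..<1} s"
      using nn_integral_fill[of s] by (simp split: split_indicator)
    finally show "(\<integral>\<^sup>+ t. f3 s t \<partial>lborel) = ennreal (exp (- \<beta> s)) * indicator {0<..<1} s" .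
  qed
  have i4: "(\<integral>\<^sup>+ s. \<integral>\<^sup>+ t. f4 s t \<partial>lborel \<partial>lborel) = ennreal (gamma_value c)"
    unfolding nn_integral_Q_gamma[symmetric]
  proof (rule nn_integral_cong)
    fix s :: real
    have "(\<integral>\<^sup>+ t. f4 s t \<partial>lborel) = (\<integral>\<^sup>+ t. (ennreal (exp (- t * \<beta> s) / t) * indicator {s<..<1} t) * indicator {0<..<1} s \<partial>lborel)"
      by (intro nn_integral_cong) (auto simp: f4_def split: split_indicator)
    also have "\<dots> = (\<integral>\<^sup>+ t. ennreal (exp (- t * \<beta> s) / t) * indicator {s<..<1} t \<partial>lborel) * indicator {0<..<1} s"
      by (rule nn_integral_multc) measurable
    also have "\<dots> = ennreal (Q s) * indicator {0<..<1} s"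
      using nn_integral_Q[of s] by (simp split: split_indicator)
    finally show "(\<integral>\<^sup>+ t. f4 s t \<partial>lborel) = ennreal (Q s) * indicator {0<..<1} s" .
  qed
  have "(\<integral>\<^sup>+ t. \<integral>\<^sup>+ s. f1 s t \<partial>lborel \<partial>lborel) + \<kappa> =
      (\<integral>\<^sup>+ t. \<integral>\<^sup>+ s. f1 s t + f2 s t \<partial>lborel \<partial>lborel)"
    unfolding i2[symmetric] by (simp add: nn_integral_add)
  also have "\<dots> = (\<integral>\<^sup>+ t. \<integral>\<^sup>+ s. f3 s t \<partial>lborel \<partial>lborel) + (\<integral>\<^sup>+ t. \<integral>\<^sup>+ s. f4 s t \<partial>lborel \<partial>lborel)"
    unfolding eq by (simp add: nn_integral_add)
  also have "\<dots> = \<kappa> + ennreal (gamma_value c)"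
    using i3 i4 swap[of f3] swap[of f4] by simp
  finally have "(\<integral>\<^sup>+ t. \<integral>\<^sup>+ s. f1 s t \<partial>lborel \<partial>lborel) = ennreal (gamma_value c)"
    using \<kappa> by (simp add: add.commute ennreal_add_left_cancel)
  moreover have "(\<integral>\<^sup>+ t. \<integral>\<^sup>+ s. f1 s t \<partial>lborel \<partial>lborel) =
    (\<integral>\<^sup>+ t. (\<integral>\<^sup>+ s. ennreal (success_density t s / t) * indicator {0<..<t} s \<partial>lborel) * indicator {0<..<1} t \<partial>lborel)"
  proof (rule nn_integral_cong)
    fix t :: real
    have "(\<integral>\<^sup>+ s. f1 s t \<partial>lborel) = (\<integral>\<^sup>+ s. (ennreal (success_density t s / t) * indicator {0<..<t} s) * indicator {0<..<1} t \<partial>lborel)"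
      by (intro nn_integral_cong) (auto simp: f1_def split: split_indicator)
    also have "\<dots> = (\<integral>\<^sup>+ s. ennreal (success_density t s / t) * indicator {0<..<t} s \<partial>lborel) * indicator {0<..<1} t"
      unfolding success_density_def by (rule nn_integral_multc) measurable
    finally show "(\<integral>\<^sup>+ s. f1 s t \<partial>lborel) = \<dots>" .
  qed
  ultimately show ?thesis by simp
qed

end

section \<open>Uniform arrival times\<close>

text \<open>The interval is open because \<open>\<beta>\<close> is meaningful only before time
  1.\<close>

definition unit_time :: "real measure" where
  "unit_time = restrict_space lborel {0<..<1}"

lemma space_unit_time [simp]: "space unit_time = {0<..<1}"
  by (simp add: unit_time_def space_restrict_space)

lemma measurable_unit_time: "f \<in> borel_measurable borel \<Longrightarrow> f \<in> borel_measurable unit_time"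
  unfolding unit_time_def by (rule measurable_restrict_space1) simp

lemma nn_integral_unit_time:
  "(\<integral>\<^sup>+ u. f u \<partial>unit_time) = (\<integral>\<^sup>+ u. f u * indicator {0<..<1} u \<partial>lborel)"
  unfolding unit_time_def by (rule nn_integral_restrict_space) simp

interpretation unit_time: prob_space unit_time
  by (rule prob_spaceI) (simp add: unit_time_def emeasure_restrict_space space_restrict_space)

lemma product_sigma_finite_unit_time: "product_sigma_finite (\<lambda>_::nat. unit_time)"
  by unfold_locales

lemma prob_space_times: "prob_space (\<Pi>\<^sub>M i\<in>I. unit_time)"
  by (intro prob_space_PiM unit_time.prob_space_axioms)

lemma component_unit_time_measurable:
  assumes "i \<in> I" shows "(\<lambda>T. T i) \<in> borel_measurable (\<Pi>\<^sub>M i\<in>I. unit_time)"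
proof -
  have "(\<lambda>u::real. u) \<in> borel_measurable unit_time" by (rule measurable_unit_time) simp
  from measurable_compose[OF measurable_component_singleton[OF assms] this] show ?thesis .
qed

section \<open>Order statistics and the arrival times of the items\<close>

definition order_stat :: "nat \<Rightarrow> (nat \<Rightarrow> real) \<Rightarrow> nat \<Rightarrow> real" where
  "order_stat n \<omega> t = sort (map \<omega> [0..<n]) ! t"

lemma sorted_nth_le_iff:
  "sorted xs \<Longrightarrow> t < length xs \<Longrightarrow> xs ! t \<le> a \<longleftrightarrow> t < length (filter (\<lambda>x. x \<le> a) xs)"
proof (induction xs arbitrary: t)
  case (Cons x xs)
  show ?case
  proof (cases "x \<le> a")
    case True
    then show ?thesis using Cons by (cases t) auto
  next
    case False
    then have "filter (\<lambda>x. x \<le> a) (x # xs) = []"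
      using Cons.prems by (auto simp: filter_empty_conv)
    moreover have "x \<le> (x # xs) ! t"
      using sorted_nth_mono[OF Cons.prems(1), of 0 t] Cons.prems(2) by simp
    ultimately show ?thesis using False by (auto simp del: filter.simps)
  qed
qed simp

text \<open>Positions start at 0, so the t-th smallest time is at most a iff more than t times are.
  This expression by a count yields measurability.\<close>

lemma order_stat_le_iff:
  assumes "t < n"
  shows "order_stat n \<omega> t \<le> a \<longleftrightarrow> t < (\<Sum>i<n. if \<omega> i \<le> a then 1 else 0 :: nat)"
proof -
  have "length (filter (\<lambda>x. x \<le> a) (sort (map \<omega> [0..<n]))) = length (filter (\<lambda>x. x \<le> a) (map \<omega> [0..<n]))"
    by (simp add: filter_sort)
  also have "\<dots> = card {i. i < n \<and> \<omega> i \<le> a}"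
    by (simp add: length_filter_conv_card cong: conj_cong)
  also have "\<dots> = (\<Sum>i<n. if \<omega> i \<le> a then 1 else 0 :: nat)"
    by (subst sum.If_cases) (auto simp: Int_def lessThan_def)
  finally show ?thesis
    unfolding order_stat_def using sorted_nth_le_iff[of "sort (map \<omega> [0..<n])" t a] assms by simp
qed

lemma order_stat_measurable:
  assumes "t < n"
  shows "(\<lambda>\<omega>. order_stat n \<omega> t) \<in> borel_measurable (\<Pi>\<^sub>M i\<in>{..<n}. unit_time)"
proof (rule borel_measurableI_le)
  fix a
  note [measurable] = component_unit_time_measurable
  have "(\<lambda>\<omega>. \<Sum>i<n. if \<omega> i \<le> a then 1 else 0 :: real) \<in> borel_measurable (\<Pi>\<^sub>M i\<in>{..<n}. unit_time)"
    by (intro borel_measurable_sum measurable_If) auto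
  then have "{\<omega> \<in> space (\<Pi>\<^sub>M i\<in>{..<n}. unit_time). real t < (\<Sum>i<n. if \<omega> i \<le> a then 1 else 0 :: real)}
      \<in> sets (\<Pi>\<^sub>M i\<in>{..<n}. unit_time)"
    by measurable
  moreover have "real t < (\<Sum>i<n. if \<omega> i \<le> a then 1 else 0 :: real) \<longleftrightarrow> order_stat n \<omega> t \<le> a" for \<omega>
  proof -
    have "(\<Sum>i<n. if \<omega> i \<le> a then 1 else 0 :: real) = real (\<Sum>i<n. if \<omega> i \<le> a then 1 else 0 :: nat)"
      by (simp add: if_distrib cong: if_cong)
    then show ?thesis by (simp only: of_nat_less_iff order_stat_le_iff[OF assms])
  qed
  ultimately show "{\<omega> \<in> space (\<Pi>\<^sub>M i\<in>{..<n}. unit_time). order_stat n \<omega> t \<le> a} \<in> sets (\<Pi>\<^sub>M i\<in>{..<n}. unit_time)"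
    by (simp only:)
qed

lemma order_stat_mono: "s \<le> t \<Longrightarrow> t < n \<Longrightarrow> order_stat n \<omega> s \<le> order_stat n \<omega> t"
  unfolding order_stat_def by (rule sorted_nth_mono) auto

lemma order_stat_permutation:
  obtains \<sigma> where "\<sigma> permutes {..<n}" "\<And>t. t < n \<Longrightarrow> order_stat n \<omega> t = \<omega> (\<sigma> t)"
proof -
  obtain p where p: "p permutes {..<length (map \<omega> [0..<n])}" "permute_list p (map \<omega> [0..<n]) = sort (map \<omega> [0..<n])"
    using mset_eq_permutation[of "sort (map \<omega> [0..<n])" "map \<omega> [0..<n]"] by auto
  have "order_stat n \<omega> t = \<omega> (p t)" if "t < n" for t
  proof -
    have "p t < n" using permutes_in_image[of p "{..<n}" t] p(1) that by simp
    then show ?thesis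
      unfolding order_stat_def p(2)[symmetric] using p(1) that by (simp add: permute_list_nth)
  qed
  with p(1) show ?thesis using that by simp
qed

text \<open>The value shown at position t is that of item p t, so item i sits at position
  \<open>inv p i\<close> and receives the time of that rank.\<close>

definition arrival :: "nat \<Rightarrow> (nat \<Rightarrow> real) \<Rightarrow> (nat \<Rightarrow> nat) \<Rightarrow> nat \<Rightarrow> real" where
  "arrival n \<omega> p = (\<lambda>i\<in>{..<n}. order_stat n \<omega> (inv p i))"

text \<open>Sorting is itself a permutation \<sigma>, and \<sigma> o inv p runs through all
  permutations along with p. Summing over all orders thus undoes the sorting, which makes the
  arrival times independent and uniform.\<close>

lemma sum_permutations_arrival:
  fixes f :: "(nat \<Rightarrow> real) \<Rightarrow> ennreal"
  shows "(\<Sum>p | p permutes {..<n}. f (arrival n \<omega> p)) = (\<Sum>q | q permutes {..<n}. f (\<lambda>i\<in>{..<n}. \<omega> (q i)))"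
proof -
  obtain \<sigma> where \<sigma>: "\<sigma> permutes {..<n}" "\<And>t. t < n \<Longrightarrow> order_stat n \<omega> t = \<omega> (\<sigma> t)"
    using order_stat_permutation by blast
  have "arrival n \<omega> p = (\<lambda>i\<in>{..<n}. \<omega> ((\<sigma> \<circ> inv p) i))" if "p permutes {..<n}" for p
    using \<sigma>(2) permutes_in_image[OF permutes_inv[OF that]] by (auto simp: arrival_def fun_eq_iff)
  then have "(\<Sum>p | p permutes {..<n}. f (arrival n \<omega> p)) =
      (\<Sum>p | p permutes {..<n}. f (\<lambda>i\<in>{..<n}. \<omega> ((\<sigma> \<circ> inv p) i)))"
    by (intro sum.cong) auto
  also have "\<dots> = (\<Sum>p | p permutes {..<n}. f (\<lambda>i\<in>{..<n}. \<omega> ((\<sigma> \<circ> p) i)))"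
    by (rule sum_permutations_inverse[symmetric])
  also have "\<dots> = (\<Sum>p | p permutes {..<n}. f (\<lambda>i\<in>{..<n}. \<omega> (p i)))"
    by (rule setum_permutations_compose_left[OF \<sigma>(1), symmetric])
  finally show ?thesis .
qed

lemma nn_integral_arrival:
  assumes f: "f \<in> borel_measurable (\<Pi>\<^sub>M i\<in>{..<n}. unit_time)"
  shows "(\<integral>\<^sup>+ \<omega>. (\<Sum>p | p permutes {..<n}. f (arrival n \<omega> p)) \<partial>(\<Pi>\<^sub>M i\<in>{..<n}. unit_time)) =
    ennreal (real (fact n)) * (\<integral>\<^sup>+ T. f T \<partial>(\<Pi>\<^sub>M i\<in>{..<n}. unit_time))"
proof -
  let ?U = "\<Pi>\<^sub>M i\<in>{..<n}. unit_time"
  have meas: "(\<lambda>\<omega>. \<lambda>i\<in>{..<n}. \<omega> (q i)) \<in> measurable ?U ?U" if "q permutes {..<n}" for q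
    using permutes_in_image[OF that] by (intro measurable_restrict measurable_component_singleton) auto
  have eq: "(\<integral>\<^sup>+ \<omega>. f (\<lambda>i\<in>{..<n}. \<omega> (q i)) \<partial>?U) = (\<integral>\<^sup>+ T. f T \<partial>?U)" if q: "q permutes {..<n}" for q
  proof -
    have "q \<in> {..<n} \<rightarrow> {..<n}" using permutes_in_image[OF q] by auto
    then have "distr ?U ?U (\<lambda>\<omega>. \<lambda>i\<in>{..<n}. \<omega> (q i)) = ?U"
      using distr_PiM_reindex[of "{..<n}" "\<lambda>_. unit_time" q "{..<n}"] unit_time.prob_space_axioms
        permutes_inj_on[OF q] by simp
    then have "(\<integral>\<^sup>+ T. f T \<partial>?U) = (\<integral>\<^sup>+ T. f T \<partial>distr ?U ?U (\<lambda>\<omega>. \<lambda>i\<in>{..<n}. \<omega> (q i)))" by simp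
    also have "\<dots> = (\<integral>\<^sup>+ \<omega>. f (\<lambda>i\<in>{..<n}. \<omega> (q i)) \<partial>?U)"
      by (rule nn_integral_distr[OF meas[OF q]]) (use f in simp)
    finally show ?thesis by simp
  qed
  have "(\<integral>\<^sup>+ \<omega>. (\<Sum>p | p permutes {..<n}. f (arrival n \<omega> p)) \<partial>?U) =
      (\<Sum>q | q permutes {..<n}. \<integral>\<^sup>+ \<omega>. f (\<lambda>i\<in>{..<n}. \<omega> (q i)) \<partial>?U)"
    unfolding sum_permutations_arrival
    by (rule nn_integral_sum) (use measurable_compose[OF meas f] in auto)
  also have "\<dots> = (\<Sum>q | q permutes {..<n}. \<integral>\<^sup>+ T. f T \<partial>?U)"
    by (intro sum.cong refl eq) auto
  also have "\<dots> = ennreal (real (fact n)) * (\<integral>\<^sup>+ T. f T \<partial>?U)"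
    using card_permutations[of "{..<n}" n] by (simp add: ennreal_of_nat_eq_real_of_nat del: of_nat_fact)
  finally show ?thesis .
qed

text \<open>
  \<open>harmless b x y S t T\<close>: the best value among the items of \<open>S\<close> that arrive up to time \<open>t\<close>, if there
  is one, lies below the threshold of its own arrival time. For a decreasing threshold \<open>b\<close> no
  record up to time \<open>t\<close> is accepted then.
\<close>

definition harmless :: "(real \<Rightarrow> real) \<Rightarrow> (nat \<Rightarrow> real) \<Rightarrow> (nat \<Rightarrow> real) \<Rightarrow> nat set \<Rightarrow> real \<Rightarrow> (nat \<Rightarrow> real) \<Rightarrow> bool" where
  "harmless b x y S t T \<longleftrightarrow> (\<forall>k\<in>S. t < T k) \<or>
     (\<exists>j\<in>S. T j \<le> t \<and> (\<forall>k\<in>S. T k \<le> t \<longrightarrow> x k \<le> x j) \<and> y j < b (T j))"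

text \<open>For fixed s, the probability that all items of S with y at least b s arrive after time
  t.\<close>

definition thin_weight :: "(real \<Rightarrow> real) \<Rightarrow> (nat \<Rightarrow> real) \<Rightarrow> nat set \<Rightarrow> real \<Rightarrow> real \<Rightarrow> real" where
  "thin_weight b y S t s = (\<Prod>k\<in>S. if b s \<le> y k then 1 - t else 1)"

lemma thin_weight_nonneg: "0 \<le> t \<Longrightarrow> t \<le> 1 \<Longrightarrow> 0 \<le> thin_weight b y S t s"
  unfolding thin_weight_def by (intro prod_nonneg) simp

lemma harmless_measurable:
  assumes [measurable]: "b \<in> borel_measurable borel" and "finite S"
  shows "Measurable.pred (\<Pi>\<^sub>M i\<in>S. unit_time) (harmless b x y S t)"
proof -
  note [measurable] = component_unit_time_measurable
  show ?thesis
    unfolding harmless_def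
    by (intro pred_intros_logic pred_intros_finite assms) auto
qed

text \<open>
  Induction on \<open>S\<close>, adding the best item \<open>k\<close> last: either it arrives before \<open>t\<close>, and then its own
  time decides, or it arrives later and can be ignored.
\<close>

lemma harmless_prob:
  assumes b [measurable]: "b \<in> borel_measurable borel" and "finite S" and t: "0 < t" "t < 1"
    and mono: "\<And>j k. x j \<le> x k \<Longrightarrow> y j \<le> y k"
  shows "(\<integral>\<^sup>+ s. ennreal (thin_weight b y S t s) * indicator {0<..<t} s \<partial>lborel) \<le>
    ennreal t * (\<integral>\<^sup>+ T. indicator {T. harmless b x y S t T} T \<partial>(\<Pi>\<^sub>M i\<in>S. unit_time))"
  using \<open>finite S\<close>
proof (induction S rule: finite_ranking_induct[where f = x])
  case empty
  show ?case by (simp add: thin_weight_def harmless_def PiM_empty nn_integral_count_space_finite less_imp_le[OF t(1)])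
next
  case (insert k S)
  show ?case
  proof (cases "k \<in> S")
    case True
    then show ?thesis using insert by (simp add: insert_absorb)
  next
    case False
    interpret product_sigma_finite "\<lambda>_::nat. unit_time" by (rule product_sigma_finite_unit_time)
    define m where "m = (\<integral>\<^sup>+ u. indicator {u. y k < b u \<and> 0 < u \<and> u < t} u \<partial>lborel)"
    define P where "P S = (\<integral>\<^sup>+ T. indicator {T. harmless b x y S t T} T \<partial>(\<Pi>\<^sub>M i\<in>S. unit_time))" for S
    define g where "g S = (\<integral>\<^sup>+ s. ennreal (thin_weight b y S t s) * indicator {0<..<t} s \<partial>lborel)" for S
    have [measurable]: "thin_weight b y S t \<in> borel_measurable borel" for S
      unfolding thin_weight_def[abs_def]
      by measurable
    have meas: "(\<lambda>T. indicator {T. harmless b x y S t T} T :: ennreal) \<in> borel_measurable (\<Pi>\<^sub>M i\<in>S. unit_time)"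
      if "finite S" for S
    proof -
      have "(\<lambda>T. if harmless b x y S t T then 1 else 0 :: ennreal) \<in> borel_measurable (\<Pi>\<^sub>M i\<in>S. unit_time)"
        using harmless_measurable[OF b that] by measurable
      then show ?thesis by (simp add: indicator_def of_bool_def)
    qed
    have "g (insert k S) = (\<integral>\<^sup>+ s. ennreal t * indicator {u. y k < b u \<and> 0 < u \<and> u < t} s +
        ennreal (1 - t) * (ennreal (thin_weight b y S t s) * indicator {0<..<t} s) \<partial>lborel)"
      unfolding g_def
    proof (rule nn_integral_cong)
      fix s
      have w: "0 \<le> thin_weight b y S t s" using t by (intro thin_weight_nonneg) auto
      \<comment> \<open>As k is the best item, y k < b s puts every item below b s, and 1 = t + (1 -
        t) splits the weight. Otherwise k contributes a factor 1 - t.\<close>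
      have "thin_weight b y S t s = 1 \<and> thin_weight b y (insert k S) t s = 1" if "y k < b s"
      proof -
        have "y j < b s" if "j \<in> S" for j
          using mono[OF insert.hyps(2)[OF that]] \<open>y k < b s\<close> by simp
        then have "\<not> b s \<le> y j" if "j \<in> insert k S" for j
          using that \<open>y k < b s\<close> by (auto simp: not_le)
        then show ?thesis
          unfolding thin_weight_def by (intro conjI prod.neutral) auto
      qed
      moreover have "thin_weight b y (insert k S) t s = (1 - t) * thin_weight b y S t s" if "\<not> y k < b s"
        using that insert.hyps(1) False by (simp add: thin_weight_def)
      ultimately show "ennreal (thin_weight b y (insert k S) t s) * indicator {0<..<t} s =
          ennreal t * indicator {u. y k < b u \<and> 0 < u \<and> u < t} s +
          ennreal (1 - t) * (ennreal (thin_weight b y S t s) * indicator {0<..<t} s)"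
        using t w by (cases "y k < b s") (auto simp: ennreal_mult' simp flip: ennreal_plus split: split_indicator)
    qed
    also have "\<dots> = ennreal t * m + ennreal (1 - t) * g S"
      unfolding m_def g_def by (subst nn_integral_add) (auto simp: nn_integral_cmult)
    also have "\<dots> \<le> ennreal t * m + ennreal (1 - t) * (ennreal t * P S)"
      using insert.IH unfolding g_def P_def by (intro add_left_mono mult_left_mono) auto
    also have "\<dots> = ennreal t * (m + ennreal (1 - t) * P S)"
      by (simp add: distrib_left mult.left_commute)
    \<comment> \<open>Condition on the arrival time u of k. For u < t it is enough that k lies below
      its own threshold; for u > t it is enough that the remaining items are harmless.\<close>
    also have "m + ennreal (1 - t) * P S \<le> P (insert k S)"
    proof -
      interpret PS: prob_space "\<Pi>\<^sub>M i\<in>S. unit_time" by (rule prob_space_times)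
      have "m + ennreal (1 - t) * P S =
        (\<integral>\<^sup>+ T. m + ennreal (1 - t) * indicator {T. harmless b x y S t T} T \<partial>(\<Pi>\<^sub>M i\<in>S. unit_time))"
        unfolding P_def using meas[OF insert.hyps(1)]
        by (simp add: nn_integral_add nn_integral_cmult PS.emeasure_space_1)
      also have "\<dots> \<le> (\<integral>\<^sup>+ T. \<integral>\<^sup>+ u. indicator {T. harmless b x y (insert k S) t T} (T(k := u)) \<partial>unit_time \<partial>(\<Pi>\<^sub>M i\<in>S. unit_time))"
      proof (rule nn_integral_mono)
        fix T
        have e: "(\<integral>\<^sup>+ u. indicator {t<..<1} u \<partial>lborel) = ennreal (1 - t)" using t by simp
        have "m + ennreal (1 - t) * indicator {T. harmless b x y S t T} T =
          (\<integral>\<^sup>+ u. indicator {u. y k < b u \<and> 0 < u \<and> u < t} u + indicator {T. harmless b x y S t T} T * indicator {t<..<1} u \<partial>lborel)"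
          unfolding m_def e[symmetric] mult.commute[of "\<integral>\<^sup>+ u. indicator {t<..<1} u \<partial>lborel"]
          by (subst nn_integral_add) (auto simp: nn_integral_cmult)
        also have "\<dots> \<le> (\<integral>\<^sup>+ u. indicator {T. harmless b x y (insert k S) t T} (T(k := u)) * indicator {0<..<1} u \<partial>lborel)"
        proof (rule nn_integral_mono)
          fix u :: real
          have eq: "(T(k := u)) j = T j" if "j \<in> S" for j using that False by auto
          have 1: "harmless b x y (insert k S) t (T(k := u))" if "y k < b u" "u \<le> t"
            unfolding harmless_def using that insert.hyps(2) by (intro disjI2 bexI[of _ k]) auto
          have 2: "harmless b x y (insert k S) t (T(k := u))" if "harmless b x y S t T" "t < u"
            using that eq unfolding harmless_def by auto
          show "indicator {u. y k < b u \<and> 0 < u \<and> u < t} u + indicator {T. harmless b x y S t T} T * indicator {t<..<1} u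
            \<le> (indicator {T. harmless b x y (insert k S) t T} (T(k := u)) * indicator {0<..<1} u :: ennreal)"
            using 1 2 t by (auto split: split_indicator)
        qed
        finally show "m + ennreal (1 - t) * indicator {T. harmless b x y S t T} T \<le>
          (\<integral>\<^sup>+ u. indicator {T. harmless b x y (insert k S) t T} (T(k := u)) \<partial>unit_time)"
          by (simp add: nn_integral_unit_time)
      qed
      also have "\<dots> = P (insert k S)"
        unfolding P_def using insert.hyps(1) False
        by (intro product_nn_integral_insert[symmetric] meas) auto
      finally show ?thesis .
    qed
    finally show ?thesis unfolding g_def P_def by (simp add: mult_left_mono)
  qed
qed

section \<open>The outcome space\<close>

text \<open>The order takes finitely many values, so the event is a finite union over orders q. For
  fixed q the accessed coordinates are fixed, and being the maximum becomes finitely many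
  comparisons.\<close>

lemma success_set_measurable:
  assumes A: "online_algorithm n A" and D: "\<And>i. i < n \<Longrightarrow> real_distribution (D i)"
  shows "{(\<omega>, x, p) \<in> space (outcome_space n D A).
    \<exists>t<n. accepts_at A \<omega> (\<lambda>s. x (p s)) t \<and> x (p t) = Max (x ` {..<n})} \<in> sets (outcome_space n D A)"
proof -
  let ?X = "\<Pi>\<^sub>M i\<in>{..<n}. D i"
  let ?P = "uniform_count_measure {p. p permutes {..<n}}"
  let ?O = "outcome_space n D A"
  have O: "?O = seed A \<Otimes>\<^sub>M (?X \<Otimes>\<^sub>M ?P)" by (simp add: outcome_space_def)
  have x: "(\<lambda>z. fst (snd z) i) \<in> borel_measurable ?O" if "i < n" for i
  proof -
    have b: "sets (D i) = sets borel"
      using D[OF that] by (simp add: real_distribution_def real_distribution_axioms_def)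
    have "(\<lambda>z. fst (snd z) i) \<in> measurable ?O (D i)"
      unfolding O using that
      by (intro measurable_compose[OF measurable_compose[OF measurable_snd measurable_fst] measurable_component_singleton]) auto
    then show ?thesis unfolding measurable_cong_sets[OF refl b] .
  qed
  have acc: "Measurable.pred ?O (\<lambda>z. accept A t (fst z) (restrict (\<lambda>s. fst (snd z) (q s)) {..t}))"
    if q: "q permutes {..<n}" and t: "t < n" for q t
  proof -
    have 1: "(\<lambda>(\<omega>, h). accept A t \<omega> h) \<in> measurable (seed A \<Otimes>\<^sub>M (\<Pi>\<^sub>M i\<in>{..t}. borel)) (count_space UNIV)"
      using A t by (simp add: online_algorithm_def)
    have 2: "(\<lambda>z. (fst z, restrict (\<lambda>s. fst (snd z) (q s)) {..t})) \<in> measurable ?O (seed A \<Otimes>\<^sub>M (\<Pi>\<^sub>M i\<in>{..t}. borel))"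
    proof (rule measurable_Pair)
      show "fst \<in> measurable ?O (seed A)" unfolding O by (rule measurable_fst)
      show "(\<lambda>z. restrict (\<lambda>s. fst (snd z) (q s)) {..t}) \<in> measurable ?O (\<Pi>\<^sub>M i\<in>{..t}. borel)"
      proof (rule measurable_restrict)
        fix s assume "s \<in> {..t}"
        then have "q s < n" using permutes_in_image[OF q, of s] t by auto
        then show "(\<lambda>z. fst (snd z) (q s)) \<in> borel_measurable ?O" by (rule x)
      qed
    qed
    show ?thesis using measurable_compose[OF 2 1] by simp
  qed
  have eqm: "Measurable.pred ?O (\<lambda>z. snd (snd z) = q)" if "q permutes {..<n}" for q
  proof -
    have "(\<lambda>z. snd (snd z)) \<in> measurable ?O ?P"
      unfolding O by (rule measurable_compose[OF measurable_snd measurable_snd])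
    moreover have "{q} \<in> sets ?P" using that by (simp add: sets_uniform_count_measure)
    ultimately have "(\<lambda>z. snd (snd z)) -` {q} \<inter> space ?O \<in> sets ?O" by (rule measurable_sets)
    then show ?thesis
      by (simp add: pred_def vimage_def Int_def conj_commute)
  qed
  have le: "Measurable.pred ?O (\<lambda>z. fst (snd z) k \<le> fst (snd z) (q t))"
    if "q permutes {..<n}" "t < n" "k < n" for q t k
  proof -
    have "q t < n" using permutes_in_image[OF that(1), of t] that by simp
    from borel_measurable_le[OF x[OF \<open>k < n\<close>] x[OF this]] show ?thesis unfolding pred_def .
  qed
  have "Measurable.pred ?O (\<lambda>z. \<exists>q\<in>{p. p permutes {..<n}}. snd (snd z) = q \<and>
     (\<exists>t\<in>{..<n}. (accept A t (fst z) (restrict (\<lambda>s. fst (snd z) (q s)) {..t}) \<and>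
        (\<forall>s\<in>{..<t}. \<not> accept A s (fst z) (restrict (\<lambda>r. fst (snd z) (q r)) {..s}))) \<and>
        (\<forall>k\<in>{..<n}. fst (snd z) k \<le> fst (snd z) (q t))))"
    by (intro pred_intros_finite pred_intros_logic eqm le acc) (auto simp: finite_permutations)
  then have "{z \<in> space ?O. \<exists>q\<in>{p. p permutes {..<n}}. snd (snd z) = q \<and>
     (\<exists>t\<in>{..<n}. (accept A t (fst z) (restrict (\<lambda>s. fst (snd z) (q s)) {..t}) \<and>
        (\<forall>s\<in>{..<t}. \<not> accept A s (fst z) (restrict (\<lambda>r. fst (snd z) (q r)) {..s}))) \<and>
        (\<forall>k\<in>{..<n}. fst (snd z) k \<le> fst (snd z) (q t)))} \<in> sets ?O"
    unfolding pred_def .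
  also have "{z \<in> space ?O. \<exists>q\<in>{p. p permutes {..<n}}. snd (snd z) = q \<and>
     (\<exists>t\<in>{..<n}. (accept A t (fst z) (restrict (\<lambda>s. fst (snd z) (q s)) {..t}) \<and>
        (\<forall>s\<in>{..<t}. \<not> accept A s (fst z) (restrict (\<lambda>r. fst (snd z) (q r)) {..s}))) \<and>
        (\<forall>k\<in>{..<n}. fst (snd z) k \<le> fst (snd z) (q t)))} =
    {(\<omega>, x, p) \<in> space ?O. \<exists>t<n. accepts_at A \<omega> (\<lambda>s. x (p s)) t \<and> x (p t) = Max (x ` {..<n})}"
  proof -
    have max: "x (p t) = Max (x ` {..<n}) \<longleftrightarrow> (\<forall>k\<in>{..<n}. x k \<le> x (p t))"
      if "p permutes {..<n}" "t < n" for x :: "nat \<Rightarrow> real" and p t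
    proof -
      have "x (p t) \<in> x ` {..<n}" using permutes_in_image[OF that(1), of t] that(2) by simp
      then have "(Max (x ` {..<n}) = x (p t)) \<longleftrightarrow> (\<forall>a\<in>x ` {..<n}. a \<le> x (p t))"
        by (subst Max_eq_iff) auto
      then show ?thesis by auto
    qed
    have perm: "snd (snd z) permutes {..<n}" if "z \<in> space ?O" for z
      using that by (auto simp: O space_pair_measure space_uniform_count_measure)
    show ?thesis
      using perm max by (auto simp: accepts_at_def Bex_def Ball_def)
  qed
  finally show ?thesis .
qed

lemma prob_space_outcome_space:
  assumes "prob_space (seed A)" "\<And>i. i < n \<Longrightarrow> prob_space (D i)"
  shows "prob_space (outcome_space n D A)"
proof -
  have "prob_space (uniform_count_measure {p. p permutes {..<n}})"
    by (rule prob_space_uniform_count_measure[OF finite_permutations]) (use permutes_id in blast)+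
  then show ?thesis
    unfolding outcome_space_def using assms by (intro prob_space_pair prob_space_PiM) auto
qed

text \<open>The draws are integrated last because the analysis of the arrival times is carried out
  for fixed draws.\<close>

lemma emeasure_success_set:
  assumes A: "prob_space (seed A)" and D: "\<And>i. i < n \<Longrightarrow> prob_space (D i)"
    and S: "S \<in> sets (outcome_space n D A)"
  shows "emeasure (outcome_space n D A) S =
    (\<integral>\<^sup>+ x. (\<integral>\<^sup>+ \<omega>. (\<Sum>p | p permutes {..<n}. indicator S (\<omega>, x, p)) \<partial>seed A) / ennreal (real (fact n)) \<partial>(\<Pi>\<^sub>M i\<in>{..<n}. D i))"
proof -
  let ?X = "\<Pi>\<^sub>M i\<in>{..<n}. D i"
  let ?P = "uniform_count_measure {p. p permutes {..<n}}"
  have fin: "finite {p. p permutes {..<n}}" by (rule finite_permutations) simp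
  interpret seed: prob_space "seed A" by (rule A)
  interpret P: prob_space ?P
    by (rule prob_space_uniform_count_measure[OF fin]) (use permutes_id in blast)
  interpret X: prob_space ?X by (intro prob_space_PiM D) auto
  interpret XP: pair_prob_space ?X ?P ..
  interpret O: pair_sigma_finite "seed A" "?X \<Otimes>\<^sub>M ?P"
    unfolding pair_sigma_finite_def
    using prob_space_imp_sigma_finite[OF A] prob_space_imp_sigma_finite[OF XP.P.prob_space_axioms] by simp
  have O: "outcome_space n D A = seed A \<Otimes>\<^sub>M (?X \<Otimes>\<^sub>M ?P)" by (simp add: outcome_space_def)
  have S': "S \<in> sets (seed A \<Otimes>\<^sub>M (?X \<Otimes>\<^sub>M ?P))" using S by (simp add: O)
  have [measurable]: "(\<lambda>z. emeasure (seed A) ((\<lambda>\<omega>. (\<omega>, z)) -` S)) \<in> borel_measurable (?X \<Otimes>\<^sub>M ?P)"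
    by (rule O.measurable_emeasure_Pair2[OF S'])
  have "emeasure (outcome_space n D A) S =
      (\<integral>\<^sup>+ z. emeasure (seed A) ((\<lambda>\<omega>. (\<omega>, z)) -` S) \<partial>(?X \<Otimes>\<^sub>M ?P))"
    unfolding O by (rule O.emeasure_pair_measure_alt2[OF S'])
  also have "\<dots> = (\<integral>\<^sup>+ x. \<integral>\<^sup>+ p. emeasure (seed A) ((\<lambda>\<omega>. (\<omega>, x, p)) -` S) \<partial>?P \<partial>?X)"
    by (subst P.nn_integral_fst[symmetric]) auto
  also have "\<dots> = (\<integral>\<^sup>+ x. (\<integral>\<^sup>+ \<omega>. (\<Sum>p | p permutes {..<n}. indicator S (\<omega>, x, p)) \<partial>seed A) / ennreal (real (fact n)) \<partial>?X)"
  proof (rule nn_integral_cong)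
    fix x assume x: "x \<in> space ?X"
    have s: "(\<lambda>\<omega>. (\<omega>, x, p)) -` S \<in> sets (seed A)" for p
      by (rule sets_Pair2[OF S'])
    have I: "ennreal (1 / real (fact n)) = inverse (ennreal (real (fact n)))"
      using inverse_ennreal[of "real (fact n)"] by (simp add: inverse_eq_divide)
    have "(\<integral>\<^sup>+ p. emeasure (seed A) ((\<lambda>\<omega>. (\<omega>, x, p)) -` S) \<partial>?P) =
        (\<Sum>p | p permutes {..<n}. ennreal (1 / real (fact n)) * emeasure (seed A) ((\<lambda>\<omega>. (\<omega>, x, p)) -` S))"
      unfolding uniform_count_measure_def using fin card_permutations[of "{..<n}" n]
      by (subst nn_integral_point_measure_finite) (auto simp: mult.commute)
    also have "\<dots> = (\<Sum>p | p permutes {..<n}. emeasure (seed A) ((\<lambda>\<omega>. (\<omega>, x, p)) -` S)) / ennreal (real (fact n))"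
      unfolding I sum_distrib_left[symmetric] divide_ennreal_def by (rule mult.commute)
    also have "(\<Sum>p | p permutes {..<n}. emeasure (seed A) ((\<lambda>\<omega>. (\<omega>, x, p)) -` S)) =
        (\<integral>\<^sup>+ \<omega>. (\<Sum>p | p permutes {..<n}. indicator S (\<omega>, x, p)) \<partial>seed A)"
    proof -
      have ind: "indicator S (\<omega>, x, p) = (indicator ((\<lambda>\<omega>. (\<omega>, x, p)) -` S) \<omega> :: ennreal)" for \<omega> p
        by (auto split: split_indicator)
      have "(\<integral>\<^sup>+ \<omega>. (\<Sum>p | p permutes {..<n}. indicator ((\<lambda>\<omega>. (\<omega>, x, p)) -` S) \<omega>) \<partial>seed A) =
        (\<Sum>p | p permutes {..<n}. \<integral>\<^sup>+ \<omega>. indicator ((\<lambda>\<omega>. (\<omega>, x, p)) -` S) \<omega> \<partial>seed A)"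
        by (intro nn_integral_sum borel_measurable_indicator s)
      then show ?thesis unfolding ind nn_integral_indicator[OF s] by (rule sym)
    qed
    finally show "(\<integral>\<^sup>+ p. emeasure (seed A) ((\<lambda>\<omega>. (\<omega>, x, p)) -` S) \<partial>?P) =
      (\<integral>\<^sup>+ \<omega>. (\<Sum>p | p permutes {..<n}. indicator S (\<omega>, x, p)) \<partial>seed A) / ennreal (real (fact n))" .
  qed
  finally show ?thesis .
qed

text \<open>With the other coordinates fixed, the i-th one hits the value x j with probability 0, as
  a continuous distribution function has no atoms.\<close>

lemma AE_distinct_pair:
  fixes n :: nat
  assumes D: "\<And>i. continuous_distribution (D i)" and ij: "i < n" "j < n" "i \<noteq> j"
  shows "AE x in (\<Pi>\<^sub>M i\<in>{..<n}. D i). x i \<noteq> x j"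
proof -
  have rd: "real_distribution (D k)" for k
    using D by (simp add: continuous_distribution_def)
  have b: "sets (D k) = sets borel" for k
    using rd[of k] by (simp add: real_distribution_def real_distribution_axioms_def)
  interpret product_sigma_finite D
    unfolding product_sigma_finite_def
    using rd by (intro allI prob_space_imp_sigma_finite) (simp add: real_distribution_def)
  let ?I = "{..<n} - {i}"
  have ins: "insert i ?I = {..<n}" using ij by auto
  have mc: "(\<lambda>x. x k) \<in> borel_measurable (\<Pi>\<^sub>M i\<in>{..<n}. D i)" if "k < n" for k
  proof -
    have "(\<lambda>x. x k) \<in> measurable (\<Pi>\<^sub>M i\<in>{..<n}. D i) (D k)"
      by (rule measurable_component_singleton) (use that in simp)
    then show ?thesis unfolding measurable_cong_sets[OF refl b] .
  qed
  let ?N = "{x \<in> space (\<Pi>\<^sub>M i\<in>{..<n}. D i). x i = x j}"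
  have N: "?N \<in> sets (\<Pi>\<^sub>M i\<in>{..<n}. D i)"
    by (rule borel_measurable_eq[OF mc[OF ij(1)] mc[OF ij(2)]])
  have "emeasure (\<Pi>\<^sub>M i\<in>{..<n}. D i) ?N = integral\<^sup>N (\<Pi>\<^sub>M i\<in>{..<n}. D i) (indicator ?N)"
    by (rule nn_integral_indicator[OF N, symmetric])
  also have "\<dots> = (\<integral>\<^sup>+ x. \<integral>\<^sup>+ y. indicator ?N (x(i := y)) \<partial>D i \<partial>(\<Pi>\<^sub>M i\<in>?I. D i))"
  proof -
    have "indicator ?N \<in> borel_measurable (\<Pi>\<^sub>M i\<in>insert i ?I. D i)"
      unfolding ins by (rule borel_measurable_indicator[OF N])
    moreover have "finite ?I" "i \<notin> ?I" by auto
    ultimately show ?thesis using product_nn_integral_insert[of ?I i "indicator ?N"] unfolding ins by blast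
  qed
  also have "\<dots> \<le> (\<integral>\<^sup>+ x. \<integral>\<^sup>+ y. indicator {x j} y \<partial>D i \<partial>(\<Pi>\<^sub>M i\<in>?I. D i))"
  proof (intro nn_integral_mono)
    fix x y
    show "indicator ?N (x(i := y)) \<le> (indicator {x j} y :: ennreal)"
      using ij(3) by (auto split: split_indicator)
  qed
  also have "\<dots> = (\<integral>\<^sup>+ x. 0 \<partial>(\<Pi>\<^sub>M i\<in>?I. D i))"
  proof (rule nn_integral_cong)
    fix x
    interpret Di: real_distribution "D i" by (rule rd)
    have "isCont (cdf (D i)) (x j)"
      using D[of i] by (simp add: continuous_distribution_def continuous_on_eq_continuous_at)
    then have "measure (D i) {x j} = 0" by (simp add: Di.isCont_cdf)
    then have "emeasure (D i) {x j} = 0" by (simp add: Di.emeasure_eq_measure)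
    moreover have "(\<integral>\<^sup>+ y. indicator {x j} y \<partial>D i) = emeasure (D i) {x j}"
      by (rule nn_integral_indicator) (simp add: b)
    ultimately show "(\<integral>\<^sup>+ y. indicator {x j} y \<partial>D i) = 0" by (rule trans[rotated])
  qed
  finally have Z: "emeasure (\<Pi>\<^sub>M i\<in>{..<n}. D i) ?N = 0" by simp
  show ?thesis
  proof (rule AE_I[OF _ Z N])
    show "{x \<in> space (\<Pi>\<^sub>M i\<in>{..<n}. D i). \<not> x i \<noteq> x j} \<subseteq> ?N" by auto
  qed
qed

lemma AE_strict_max:
  fixes n :: nat
  assumes D: "\<And>i. continuous_distribution (D i)" and "1 \<le> n"
  shows "AE x in (\<Pi>\<^sub>M i\<in>{..<n}. D i). \<exists>i<n. \<forall>k<n. k \<noteq> i \<longrightarrow> x k < x i"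
proof -
  have "AE x in (\<Pi>\<^sub>M i\<in>{..<n}. D i). \<forall>z\<in>{(i, j). i < n \<and> j < n \<and> i \<noteq> j}. x (fst z) \<noteq> x (snd z)"
  proof (rule AE_finite_allI)
    show "finite {(i, j). i < n \<and> j < n \<and> i \<noteq> j}"
      by (rule finite_subset[of _ "{..<n} \<times> {..<n}"]) auto
    show "AE x in (\<Pi>\<^sub>M i\<in>{..<n}. D i). x (fst z) \<noteq> x (snd z)" if "z \<in> {(i, j). i < n \<and> j < n \<and> i \<noteq> j}" for z
      using that AE_distinct_pair[OF D] by auto
  qed
  then show ?thesis
  proof eventually_elim
    case (elim x)
    have "Max (x ` {..<n}) \<in> x ` {..<n}" using \<open>1 \<le> n\<close> by (intro Max_in) (auto simp: lessThan_empty_iff)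
    then obtain i where i: "i < n" "x i = Max (x ` {..<n})" by auto
    have "x k < x i" if "k < n" "k \<noteq> i" for k
    proof -
      have "x k \<le> x i" using that unfolding i(2) by (intro Max_ge) auto
      moreover have "x k \<noteq> x i" using elim that i(1) by auto
      ultimately show ?thesis by simp
    qed
    with i(1) show ?case by blast
  qed
qed

section \<open>The threshold algorithm\<close>

text \<open>Convexity of exp between 0 and ln p, that is, the weighted inequality of arithmetic and
  geometric means for 1 and p.\<close>

lemma powr_le_linear:
  fixes p t :: real
  assumes "0 < p" "0 \<le> t" "t \<le> 1" shows "p powr t \<le> 1 - t + t * p"
  using convex_onD[OF exp_convex assms(2,3), of 0 "ln p"] assms by (simp add: powr_def)

lemma harmless_random_time_measurable:
  assumes b [measurable]: "b \<in> borel_measurable borel" and "finite I" "S \<subseteq> I" "i \<in> I"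
  shows "Measurable.pred (\<Pi>\<^sub>M i\<in>I. unit_time) (\<lambda>T. harmless b x y S (T i) T)"
proof -
  have c: "(\<lambda>T. T k) \<in> borel_measurable (\<Pi>\<^sub>M i\<in>I. unit_time)" if "k \<in> insert i S" for k
    using that assms by (intro component_unit_time_measurable) auto
  have le: "Measurable.pred (\<Pi>\<^sub>M i\<in>I. unit_time) (\<lambda>T. T k \<le> T i)" if "k \<in> S" for k
    using borel_measurable_le[OF c[of k] c[of i]] that by (simp add: pred_def)
  have less: "Measurable.pred (\<Pi>\<^sub>M i\<in>I. unit_time) (\<lambda>T. T i < T k)" if "k \<in> S" for k
    using borel_measurable_less[OF c[of i] c[of k]] that by (simp add: pred_def)
  have bl: "Measurable.pred (\<Pi>\<^sub>M i\<in>I. unit_time) (\<lambda>T. y k < b (T k))" if "k \<in> S" for k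
    using borel_measurable_less[OF borel_measurable_const measurable_compose[OF c[of k] b], of "y k"] that
    by (simp add: pred_def)
  have "finite S" using assms by (auto intro: finite_subset)
  show ?thesis
    unfolding harmless_def
    by (intro pred_intros_finite[OF \<open>finite S\<close>] pred_intros_logic le less bl) auto
qed

context gamma_constant
begin

definition threshold :: "real \<Rightarrow> real" where "threshold t = exp (- \<beta> t)"

lemma threshold_measurable [measurable]: "threshold \<in> borel_measurable borel"
  unfolding threshold_def[abs_def] by measurable

lemma threshold_range: "t < 1 \<Longrightarrow> 0 < threshold t" "t < 1 \<Longrightarrow> threshold t < 1"
  using \<beta>_pos[of t] by (auto simp: threshold_def)

lemma threshold_antimono: "s \<le> t \<Longrightarrow> t < 1 \<Longrightarrow> threshold t \<le> threshold s"
  using c_pos by (auto simp: threshold_def \<beta>_def intro!: divide_left_mono)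

end

locale secretary = gamma_constant +
  fixes n :: nat and D :: "nat \<Rightarrow> real measure"
  assumes n: "1 \<le> n" and D: "continuous_distribution (D i)"
begin

lemma real_distribution_D: "real_distribution (D i)"
  using D by (simp add: continuous_distribution_def)

lemma prob_space_D: "prob_space (D i)"
  using real_distribution_D by (simp add: real_distribution_def)

lemma sets_D: "sets (D i) = sets borel"
  using real_distribution_D[of i] by (simp add: real_distribution_def real_distribution_axioms_def)

lemma product_sigma_finite_D: "product_sigma_finite D"
  unfolding product_sigma_finite_def by (intro allI prob_space_imp_sigma_finite prob_space_D)

definition F :: "real \<Rightarrow> real" where "F x = (\<Prod>i<n. cdf (D i) x)"

lemma F_mono: "mono F"
  unfolding F_def
  by (intro monoI prod_mono conjI finite_borel_measure.cdf_nondecreasing finite_borel_measure.cdf_nonneg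
      real_distribution.finite_borel_measure_M real_distribution_D)

lemma F_continuous: "continuous_on UNIV F"
  unfolding F_def using D by (intro continuous_on_prod) (simp add: continuous_distribution_def)

lemma F_measurable [measurable]: "F \<in> borel_measurable borel"
  by (rule borel_measurable_continuous_onI[OF F_continuous])

lemma F_at_bot: "(F \<longlongrightarrow> 0) at_bot"
proof -
  have "(F \<longlongrightarrow> (\<Prod>i<n. 0)) at_bot"
    unfolding F_def
    by (intro tendsto_prod finite_borel_measure.cdf_lim_at_bot real_distribution.finite_borel_measure_M real_distribution_D)
  then show ?thesis using n by (simp add: power_0_left)
qed

lemma F_at_top: "(F \<longlongrightarrow> 1) at_top"
proof -
  have "(F \<longlongrightarrow> (\<Prod>i<n. 1)) at_top"
    unfolding F_def by (intro tendsto_prod real_distribution.cdf_lim_at_top_prob real_distribution_D)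
  then show ?thesis by simp
qed

definition below :: "real \<Rightarrow> nat \<Rightarrow> real" where "below u k = measure (D k) {x. F x < u}"

text \<open>For the level point z of u, \<open>F x < u\<close> means x < z. No distribution has mass
  at z, so the factors are the distribution functions at z, and their product is
  \<open>F z = u\<close> whatever the individual distributions are.\<close>

lemma prod_below:
  assumes "0 < u" "u < 1" shows "(\<Prod>k<n. below u k) = u"
proof -
  obtain z where z: "F z = u" "\<And>x. u \<le> F x \<longleftrightarrow> z \<le> x"
    using continuous_level_point[OF F_mono F_continuous F_at_bot F_at_top assms] by blast
  have "below u k = cdf (D k) z" for k
  proof -
    interpret real_distribution "D k" by (rule real_distribution_D)
    have "isCont (cdf (D k)) z"
      using D[of k] by (simp add: continuous_distribution_def continuous_on_eq_continuous_at)
    then have "measure (D k) {z} = 0" by (simp add: isCont_cdf)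
    moreover have "measure (D k) ({..<z} \<union> {z}) = measure (D k) {..<z} + measure (D k) {z}"
      by (rule finite_measure_Union) auto
    moreover have "{..<z} \<union> {z} = {..z}" by auto
    moreover have "F x < u \<longleftrightarrow> x < z" for x using z(2)[of x] by linarith
    then have "{x. F x < u} = {..<z}" by auto
    ultimately show ?thesis by (simp add: below_def cdf_def)
  qed
  then show ?thesis using z(1) by (simp add: F_def)
qed

text \<open>
  With \<open>N\<close> the number of values whose \<open>F\<close> is at least \<open>threshold s\<close>, this is \<open>(1 - t) ^ (N - 1)\<close> for
  \<open>N > 0\<close>: the maximum itself does not count, but it is not known which value is the maximum.
\<close>

definition payoff :: "real \<Rightarrow> real \<Rightarrow> (nat \<Rightarrow> real) \<Rightarrow> real" where
  "payoff s t x = (if \<forall>k<n. F (x k) < threshold s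
     then (if \<exists>k<n. threshold t \<le> F (x k) then 1 else 0)
     else thin_weight threshold (\<lambda>k. F (x k)) {..<n} t s / (1 - t))"

lemma payoff_nonneg: "t < 1 \<Longrightarrow> 0 < t \<Longrightarrow> 0 \<le> payoff s t x"
  using thin_weight_nonneg by (auto simp: payoff_def)

lemma component_D_measurable:
  assumes "k < n" shows "(\<lambda>x. x k) \<in> borel_measurable (\<Pi>\<^sub>M i\<in>{..<n}. D i)"
proof -
  have "(\<lambda>x. x k) \<in> measurable (\<Pi>\<^sub>M i\<in>{..<n}. D i) (D k)"
    by (rule measurable_component_singleton) (use assms in simp)
  then show ?thesis unfolding measurable_cong_sets[OF refl sets_D] .
qed

text \<open>\<open>payoff\<close> is a linear combination of products over the items, so
  independence evaluates its mean. The indicator products have mean u by \<open>prod_below\<close>;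
  the thinned product is bounded factor by factor, giving
  \<open>threshold s powr t = exp (- t * \<beta> s)\<close>, the value in the Poisson limit.\<close>

lemma expectation_payoff:
  assumes st: "0 < s" "s < t" "t < 1"
  shows "ennreal (success_density t s) \<le> (\<integral>\<^sup>+ x. ennreal (payoff s t x) \<partial>(\<Pi>\<^sub>M i\<in>{..<n}. D i))"
proof -
  interpret product_sigma_finite D by (rule product_sigma_finite_D)
  let ?X = "\<Pi>\<^sub>M i\<in>{..<n}. D i"
  have th: "0 < threshold s" "threshold s < 1" "0 < threshold t" "threshold t < 1" "threshold t \<le> threshold s"
    using st threshold_range threshold_antimono by auto
  define a where "a u v = (if F v < u then 1 else 0 :: real)" for u v
  define w where "w v = (1 - t) + t * a (threshold s) v" for v
  have ia: "integrable (D k) (a u)" "integral\<^sup>L (D k) (a u) = below u k" for u k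
  proof -
    interpret real_distribution "D k" by (rule real_distribution_D)
    have m: "{x. F x < u} \<in> sets (D k)" unfolding sets_D by measurable
    have eq: "a u = indicator {x. F x < u}" by (auto simp: a_def fun_eq_iff)
    show "integrable (D k) (a u)"
      unfolding eq by (intro integrable_real_indicator m) (simp add: less_top[symmetric])
    show "integral\<^sup>L (D k) (a u) = below u k" unfolding eq using m by (simp add: below_def)
  qed
  have iw: "integrable (D k) w" "integral\<^sup>L (D k) w = 1 - t + t * below (threshold s) k" for k
  proof -
    interpret real_distribution "D k" by (rule real_distribution_D)
    show "integrable (D k) w" unfolding w_def using ia(1) by simp
    show "integral\<^sup>L (D k) w = 1 - t + t * below (threshold s) k"
    proof -
      have "measure (D k) UNIV = 1" using prob_space by simp
      then show ?thesis unfolding w_def using ia[of k "threshold s"] by simp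
    qed
  qed
  let ?A = "\<lambda>u x. \<Prod>k<n. a u (x k)"
  let ?W = "\<lambda>x. \<Prod>k<n. w (x k)"
  have pa: "?A u x = (if \<forall>k<n. F (x k) < u then 1 else 0)" for u x
    by (auto simp: a_def intro!: prod_zero)
  have pw: "?W x = thin_weight threshold (\<lambda>k. F (x k)) {..<n} t s" for x
    unfolding thin_weight_def by (intro prod.cong) (auto simp: w_def a_def)
  \<comment> \<open>If some value reaches \<open>threshold s\<close>, both indicator products
    vanish. If none does, the thinned product is 1 and cancels against the first indicator
    product.\<close>
  have eq: "payoff s t x = ?A (threshold s) x - ?A (threshold t) x + (?W x - ?A (threshold s) x) / (1 - t)" for x
  proof (cases "\<forall>k<n. F (x k) < threshold s")
    case True
    then have "?W x = 1" by (auto simp: w_def a_def intro!: prod.neutral)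
    then show ?thesis using True unfolding pa payoff_def by (auto simp: not_le)
  next
    case False
    then have "\<not> (\<forall>k<n. F (x k) < threshold t)" using th(5) by force
    then show ?thesis using False unfolding pa payoff_def pw by auto
  qed
  have int: "integrable ?X (?A u)" "integral\<^sup>L ?X (?A u) = (\<Prod>k<n. below u k)"
    "integrable ?X ?W" "integral\<^sup>L ?X ?W = (\<Prod>k<n. 1 - t + t * below (threshold s) k)" for u
    using product_integrable_prod[of "{..<n}" "\<lambda>_. a u"] product_integral_prod[of "{..<n}" "\<lambda>_. a u"]
      product_integrable_prod[of "{..<n}" "\<lambda>_. w"] product_integral_prod[of "{..<n}" "\<lambda>_. w"] ia iw by auto
  have "integrable ?X (payoff s t)"
    unfolding eq[abs_def]
    by (intro Bochner_Integration.integrable_add Bochner_Integration.integrable_diff integrable_divide_zero int)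
  then have nn: "(\<integral>\<^sup>+ x. ennreal (payoff s t x) \<partial>?X) = ennreal (integral\<^sup>L ?X (payoff s t))"
    using payoff_nonneg st by (intro nn_integral_eq_integral) auto
  have "integral\<^sup>L ?X (payoff s t) = threshold s - threshold t +
      ((\<Prod>k<n. 1 - t + t * below (threshold s) k) - threshold s) / (1 - t)"
    unfolding eq[abs_def] using int prod_below th by simp
  moreover have "threshold s powr t \<le> (\<Prod>k<n. 1 - t + t * below (threshold s) k)"
  proof -
    have nz: "below (threshold s) k \<noteq> 0" if "k < n" for k
      using prod_below[OF th(1,2)] that th(1) by (metis finite_lessThan lessThan_iff less_irrefl prod_zero)
    have pos: "0 < below (threshold s) k" if "k < n" for k
      using nz[OF that] by (simp add: below_def less_le)
    have "threshold s powr t = (\<Prod>k<n. below (threshold s) k) powr t"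
      using prod_below th by simp
    also have "\<dots> = (\<Prod>k<n. below (threshold s) k powr t)"
      by (rule prod_powr_distrib)
    also have "\<dots> \<le> (\<Prod>k<n. 1 - t + t * below (threshold s) k)"
      using pos st by (intro prod_mono) (auto intro!: powr_le_linear)
    finally show ?thesis .
  qed
  moreover have "threshold s powr t = exp (- t * \<beta> s)"
    by (simp add: threshold_def powr_def)
  ultimately have "success_density t s \<le> integral\<^sup>L ?X (payoff s t)"
    using st by (simp add: success_density_def threshold_def divide_right_mono)
  then show ?thesis unfolding nn by (rule ennreal_leI)
qed

text \<open>A sufficient condition for success in terms of draws and arrival times alone, free of
  the presentation order.\<close>

definition wins :: "(nat \<Rightarrow> real) \<Rightarrow> (nat \<Rightarrow> real) \<Rightarrow> bool" where
  "wins x T \<longleftrightarrow> (\<exists>i<n. (\<forall>k<n. k \<noteq> i \<longrightarrow> x k < x i) \<and> threshold (T i) \<le> F (x i) \<and>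
     harmless threshold x (\<lambda>k. F (x k)) ({..<n} - {i}) (T i) T)"

lemma threshold_time_measurable:
  assumes "i \<in> I"
  shows "Measurable.pred (\<Pi>\<^sub>M i\<in>I. unit_time) (\<lambda>T. threshold (T i) \<le> v)"
  using borel_measurable_le[OF measurable_compose[OF component_unit_time_measurable[OF assms] threshold_measurable] borel_measurable_const, of v]
  unfolding pred_def .

lemma wins_measurable: "Measurable.pred (\<Pi>\<^sub>M i\<in>{..<n}. unit_time) (wins x)"
proof -
  have "Measurable.pred (\<Pi>\<^sub>M i\<in>{..<n}. unit_time) (\<lambda>T. \<exists>i\<in>{..<n}. (\<forall>k<n. k \<noteq> i \<longrightarrow> x k < x i) \<and>
     (threshold (T i) \<le> F (x i) \<and> harmless threshold x (\<lambda>k. F (x k)) ({..<n} - {i}) (T i) T))"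
    by (intro pred_intros_finite pred_intros_logic threshold_time_measurable
        harmless_random_time_measurable[OF threshold_measurable]) auto
  moreover have "wins x = (\<lambda>T. \<exists>i\<in>{..<n}. (\<forall>k<n. k \<noteq> i \<longrightarrow> x k < x i) \<and>
     (threshold (T i) \<le> F (x i) \<and> harmless threshold x (\<lambda>k. F (x k)) ({..<n} - {i}) (T i) T))"
    unfolding wins_def[abs_def] by auto
  ultimately show ?thesis by (simp only:)
qed

text \<open>The arrival time t of the best item i is integrated last, and
  \<open>harmless_prob\<close> handles the others. If some value reaches \<open>threshold s\<close>,
  so does that of i; the division by 1 - t in \<open>payoff\<close> removes exactly its
  factor.\<close>

lemma wins_prob:
  assumes i: "i < n" "\<And>k. k < n \<Longrightarrow> k \<noteq> i \<Longrightarrow> x k < x i"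
  shows "(\<integral>\<^sup>+ t. (\<integral>\<^sup>+ s. ennreal (payoff s t x / t) * indicator {0<..<t} s \<partial>lborel) * indicator {0<..<1} t \<partial>lborel)
    \<le> (\<integral>\<^sup>+ T. indicator {T. wins x T} T \<partial>(\<Pi>\<^sub>M i\<in>{..<n}. unit_time))"
proof -
  interpret product_sigma_finite "\<lambda>_::nat. unit_time" by (rule product_sigma_finite_unit_time)
  let ?y = "\<lambda>k. F (x k)"
  let ?K = "{..<n} - {i}"
  have ins: "insert i ?K = {..<n}" using i by auto
  let ?E = "\<lambda>T. threshold (T i) \<le> F (x i) \<and> harmless threshold x ?y ?K (T i) T"
  have Em: "(\<lambda>T. indicator {T. ?E T} T :: ennreal) \<in> borel_measurable (\<Pi>\<^sub>M i\<in>insert i ?K. unit_time)"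
  proof -
    have "Measurable.pred (\<Pi>\<^sub>M i\<in>insert i ?K. unit_time) ?E"
      by (intro pred_intros_logic threshold_time_measurable harmless_random_time_measurable[OF threshold_measurable]) auto
    from this[unfolded pred_def]
    have "(\<lambda>T. if ?E T then 1 else 0 :: ennreal) \<in> borel_measurable (\<Pi>\<^sub>M i\<in>insert i ?K. unit_time)"
      by (intro measurable_If borel_measurable_const)
    then show ?thesis by (simp add: indicator_def of_bool_def)
  qed
  have upd: "harmless threshold x ?y ?K u (T(i := u)) = harmless threshold x ?y ?K u T" for u T
    by (auto simp: harmless_def)
  have F_le: "?y k \<le> ?y i" if "k < n" for k
    using monoD[OF F_mono, of "x k" "x i"] i(2)[OF that] by (cases "k = i") (auto simp: less_imp_le)
  \<comment> \<open>If some value reaches \<open>threshold s\<close>, the maximum clears the lower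
    \<open>threshold t\<close> as well. Otherwise the weight of the others is 1, and
    \<open>payoff\<close> itself tests the threshold at t.\<close>
  have pay: "payoff s t x \<le> thin_weight threshold ?y ?K t s \<and> threshold t \<le> ?y i \<or> payoff s t x = 0"
    if st: "0 < s" "s < t" "t < 1" for s t
  proof (cases "\<forall>k<n. ?y k < threshold s")
    case True
    then have "\<not> threshold s \<le> ?y k" if "k < n" for k using that by (simp add: not_le)
    then have "thin_weight threshold ?y ?K t s = 1"
      unfolding thin_weight_def by (intro prod.neutral) auto
    then show ?thesis using True F_le by (auto simp: payoff_def dest: order_trans)
  next
    case False
    then obtain k where "k < n" "threshold s \<le> ?y k" by (auto simp: not_less)
    then have ge: "threshold s \<le> ?y i" using F_le[of k] by simp
    have "thin_weight threshold ?y (insert i ?K) t s = (1 - t) * thin_weight threshold ?y ?K t s"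
      using ge unfolding thin_weight_def by (subst prod.insert) auto
    then have "payoff s t x = thin_weight threshold ?y ?K t s"
      using False st unfolding payoff_def ins by auto
    then show ?thesis using ge threshold_antimono[of s t] st by auto
  qed
  have "(\<integral>\<^sup>+ t. (\<integral>\<^sup>+ s. ennreal (payoff s t x / t) * indicator {0<..<t} s \<partial>lborel) * indicator {0<..<1} t \<partial>lborel)
    \<le> (\<integral>\<^sup>+ t. (\<integral>\<^sup>+ T. indicator {T. ?E T} (T(i := t)) \<partial>(\<Pi>\<^sub>M i\<in>?K. unit_time)) * indicator {0<..<1} t \<partial>lborel)"
  proof (rule nn_integral_mono)
    fix t :: real
    show "(\<integral>\<^sup>+ s. ennreal (payoff s t x / t) * indicator {0<..<t} s \<partial>lborel) * indicator {0<..<1} t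
      \<le> (\<integral>\<^sup>+ T. indicator {T. ?E T} (T(i := t)) \<partial>(\<Pi>\<^sub>M i\<in>?K. unit_time)) * indicator {0<..<1} t"
    proof (cases "0 < t \<and> t < 1")
      case True
      then have t: "0 < t" "t < 1" by auto
      have twn: "0 \<le> thin_weight threshold ?y ?K t s" for s
        using t by (intro thin_weight_nonneg) auto
      have [measurable]: "thin_weight threshold ?y ?K t \<in> borel_measurable borel"
        unfolding thin_weight_def[abs_def] by measurable
      let ?I = "if threshold t \<le> ?y i then 1 else 0 :: ennreal"
      have "(\<integral>\<^sup>+ s. ennreal (payoff s t x / t) * indicator {0<..<t} s \<partial>lborel)
        \<le> (\<integral>\<^sup>+ s. (?I * ennreal (1 / t)) * (ennreal (thin_weight threshold ?y ?K t s) * indicator {0<..<t} s) \<partial>lborel)"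
      proof (rule nn_integral_mono)
        fix s
        show "ennreal (payoff s t x / t) * indicator {0<..<t} s \<le>
          (?I * ennreal (1 / t)) * (ennreal (thin_weight threshold ?y ?K t s) * indicator {0<..<t} s)"
        proof (cases "0 < s \<and> s < t")
          case True
          show ?thesis
          proof (cases "payoff s t x = 0")
            case False
            then have *: "payoff s t x \<le> thin_weight threshold ?y ?K t s" "threshold t \<le> ?y i"
              using pay[of s t] True t by auto
            have "ennreal (payoff s t x / t) \<le> ennreal (1 / t * thin_weight threshold ?y ?K t s)"
              using * t by (intro ennreal_leI) (simp add: divide_right_mono)
            also have "\<dots> = ennreal (1 / t) * ennreal (thin_weight threshold ?y ?K t s)"
              using t twn by (intro ennreal_mult) auto
            finally show ?thesis using True * by simp
          qed simp
        qed simp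
      qed
      also have "\<dots> = (?I * ennreal (1 / t)) * (\<integral>\<^sup>+ s. ennreal (thin_weight threshold ?y ?K t s) * indicator {0<..<t} s \<partial>lborel)"
        by (rule nn_integral_cmult) measurable
      also have "\<dots> \<le> (?I * ennreal (1 / t)) * (ennreal t * (\<integral>\<^sup>+ T. indicator {T. harmless threshold x ?y ?K t T} T \<partial>(\<Pi>\<^sub>M i\<in>?K. unit_time)))"
        using t monoD[OF F_mono] by (intro mult_left_mono harmless_prob) auto
      also have "\<dots> = ?I * (\<integral>\<^sup>+ T. indicator {T. harmless threshold x ?y ?K t T} T \<partial>(\<Pi>\<^sub>M i\<in>?K. unit_time))"
      proof -
        have "ennreal (1 / t) * ennreal t = 1" using t by (simp flip: ennreal_mult')
        then show ?thesis by (simp add: mult.assoc[symmetric])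
      qed
      also have "\<dots> \<le> (\<integral>\<^sup>+ T. indicator {T. ?E T} (T(i := t)) \<partial>(\<Pi>\<^sub>M i\<in>?K. unit_time))"
      proof (cases "threshold t \<le> ?y i")
        case True
        have "(\<integral>\<^sup>+ T. indicator {T. harmless threshold x ?y ?K t T} T \<partial>(\<Pi>\<^sub>M i\<in>?K. unit_time))
          \<le> (\<integral>\<^sup>+ T. indicator {T. ?E T} (T(i := t)) \<partial>(\<Pi>\<^sub>M i\<in>?K. unit_time))"
          using True upd[of t] by (intro nn_integral_mono) (simp add: indicator_def)
        then show ?thesis using True by simp
      qed simp
      finally show ?thesis using t by simp
    qed auto
  qed
  also have "\<dots> = (\<integral>\<^sup>+ u. \<integral>\<^sup>+ T. indicator {T. ?E T} (T(i := u)) \<partial>(\<Pi>\<^sub>M i\<in>?K. unit_time) \<partial>unit_time)"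
    by (rule nn_integral_unit_time[symmetric])
  also have "\<dots> = (\<integral>\<^sup>+ T. indicator {T. ?E T} T \<partial>(\<Pi>\<^sub>M i\<in>insert i ?K. unit_time))"
    by (rule product_nn_integral_insert_rev[symmetric, OF _ _ Em]) auto
  also have "\<dots> \<le> (\<integral>\<^sup>+ T. indicator {T. wins x T} T \<partial>(\<Pi>\<^sub>M i\<in>insert i ?K. unit_time))"
  proof (rule nn_integral_mono)
    fix T
    have "?E T \<Longrightarrow> wins x T" using i by (auto simp: wins_def)
    then show "indicator {T. ?E T} T \<le> (indicator {T. wins x T} T :: ennreal)"
      by (auto split: split_indicator)
  qed
  finally show ?thesis unfolding ins .
qed

section \<open>The algorithm, and the passage from arrival times to presentation orders\<close>

definition alg :: algorithm where
  "alg = \<lparr>seed = \<Pi>\<^sub>M i\<in>{..<n}. unit_time,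
     accept = \<lambda>t \<omega> h. threshold (order_stat n \<omega> t) \<le> F (h t) \<and> (\<forall>s<t. h s < h t)\<rparr>"

lemma online_alg: "online_algorithm n alg"
  unfolding online_algorithm_def
proof (intro conjI allI impI)
  show "prob_space (seed alg)" by (simp add: alg_def prob_space_times)
  fix t assume t: "t < n"
  let ?M = "seed alg \<Otimes>\<^sub>M (\<Pi>\<^sub>M i\<in>{..t}. borel :: real measure)"
  have c: "(\<lambda>z. snd z s) \<in> borel_measurable ?M" if "s \<le> t" for s
    using that by (intro measurable_compose[OF measurable_snd measurable_component_singleton]) auto
  have "(\<lambda>z. order_stat n (fst z) t) \<in> borel_measurable ?M"
    using order_stat_measurable[OF t] by (intro measurable_compose[OF measurable_fst]) (simp add: alg_def)
  then have o: "(\<lambda>z. threshold (order_stat n (fst z) t)) \<in> borel_measurable ?M"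
    by (rule measurable_compose[OF _ threshold_measurable])
  have f: "(\<lambda>z. F (snd z t)) \<in> borel_measurable ?M"
    by (rule measurable_compose[OF c F_measurable]) simp
  have 1: "Measurable.pred ?M (\<lambda>z. threshold (order_stat n (fst z) t) \<le> F (snd z t))"
    using borel_measurable_le[OF o f] unfolding pred_def .
  have 2: "Measurable.pred ?M (\<lambda>z. snd z s < snd z t)" if "s \<in> {..<t}" for s
  proof -
    have "s \<le> t" using that by simp
    from borel_measurable_less[OF c[OF this] c[OF order_refl]] show ?thesis unfolding pred_def .
  qed
  have "Measurable.pred ?M (\<lambda>z. threshold (order_stat n (fst z) t) \<le> F (snd z t) \<and> (\<forall>s\<in>{..<t}. snd z s < snd z t))"
    using 2 by (intro pred_intros_logic(3) 1 pred_intros_finite(3)) auto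
  then show "(\<lambda>(\<omega>, h). accept alg t \<omega> h) \<in> measurable ?M (count_space UNIV)"
    by (simp add: alg_def case_prod_beta' Ball_def)
qed

lemma space_times: "\<omega> \<in> space (\<Pi>\<^sub>M i\<in>{..<n}. unit_time) \<Longrightarrow> i < n \<Longrightarrow> 0 < \<omega> i \<and> \<omega> i < 1"
  by (auto simp: space_PiM PiE_def Pi_def)

lemma order_stat_range:
  assumes "\<omega> \<in> space (\<Pi>\<^sub>M i\<in>{..<n}. unit_time)" "t < n"
  shows "order_stat n \<omega> t < 1"
proof -
  obtain \<sigma> where "\<sigma> permutes {..<n}" "order_stat n \<omega> t = \<omega> (\<sigma> t)"
    using order_stat_permutation[of n \<omega>] assms(2) by metis
  then show ?thesis using permutes_in_image[of \<sigma> "{..<n}" t] space_times[OF assms(1), of "\<sigma> t"] assms(2) by simp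
qed

text \<open>Suppose a record is accepted at s before the maximum arrives. The best item j arriving
  up to the time of the maximum is at least as large, so it cannot precede s. Thresholds decrease,
  so j clears the threshold of its own time as well, contradicting \<open>harmless\<close>.\<close>

lemma wins_success:
  assumes \<omega>: "\<omega> \<in> space (\<Pi>\<^sub>M i\<in>{..<n}. unit_time)" and p: "p permutes {..<n}"
    and w: "wins x (arrival n \<omega> p)"
  shows "\<exists>t<n. accepts_at alg \<omega> (\<lambda>s. x (p s)) t \<and> x (p t) = Max (x ` {..<n})"
proof -
  let ?\<tau> = "order_stat n \<omega>"
  obtain i where i: "i < n" "\<And>k. k < n \<Longrightarrow> k \<noteq> i \<Longrightarrow> x k < x i"
    and th: "threshold (arrival n \<omega> p i) \<le> F (x i)"
    and h: "harmless threshold x (\<lambda>k. F (x k)) ({..<n} - {i}) (arrival n \<omega> p i) (arrival n \<omega> p)"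
    using w by (auto simp: wins_def)
  define t where "t = inv p i"
  have pn: "p s < n \<longleftrightarrow> s < n" for s using permutes_in_image[OF p, of s] by simp
  have pt: "p t = i" unfolding t_def using permutes_inverses(1)[OF p] .
  then have t: "t < n" using i(1) pn[of t] by simp
  have arr: "arrival n \<omega> p (p s) = ?\<tau> s" if "s < n" for s
    using that pn permutes_inverses(2)[OF p] by (simp add: arrival_def)
  have arri: "arrival n \<omega> p i = ?\<tau> t" using arr[OF t] pt by simp
  have inj: "p s = p r \<longleftrightarrow> s = r" for s r using permutes_inj[OF p] by (auto simp: inj_def)
  have "x i = Max (x ` {..<n})"
  proof (rule Max_eqI[symmetric])
    show "y \<le> x i" if "y \<in> x ` {..<n}" for y
    proof -
      from that obtain k where "k < n" "y = x k" by auto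
      then show ?thesis using i(2)[of k] by (cases "k = i") auto
    qed
  qed (use i in auto)
  moreover have "accept alg t \<omega> (restrict (\<lambda>s. x (p s)) {..t})"
  proof -
    have "x (p s) < x (p t)" if "s < t" for s
    proof -
      have "p s \<noteq> i" using that inj[of s t] pt by auto
      then show ?thesis using i(2)[of "p s"] pn[of s] that t pt by simp
    qed
    then show ?thesis using th pt arri by (simp add: alg_def)
  qed
  moreover have "\<not> accept alg s \<omega> (restrict (\<lambda>s. x (p s)) {..s})" if s: "s < t" for s
  proof
    assume "accept alg s \<omega> (restrict (\<lambda>s. x (p s)) {..s})"
    then have acc: "threshold (?\<tau> s) \<le> F (x (p s))" "\<And>r. r < s \<Longrightarrow> x (p r) < x (p s)"
      by (auto simp: alg_def)
    have sn: "s < n" using s t by simp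
    let ?k = "p s"
    have k: "?k \<in> {..<n} - {i}" using sn pn[of s] inj[of s t] pt s by auto
    have Tk: "arrival n \<omega> p ?k \<le> arrival n \<omega> p i"
      unfolding arri arr[OF sn] using s t by (intro order_stat_mono) auto
    then have "\<not> (\<forall>k\<in>{..<n} - {i}. arrival n \<omega> p i < arrival n \<omega> p k)"
      using k by (meson not_less)
    then obtain j where j: "j \<in> {..<n} - {i}"
      "\<And>k. k \<in> {..<n} - {i} \<Longrightarrow> arrival n \<omega> p k \<le> arrival n \<omega> p i \<Longrightarrow> x k \<le> x j"
      "F (x j) < threshold (arrival n \<omega> p j)"
      using h unfolding harmless_def by blast
    have kj: "x ?k \<le> x j" by (rule j(2)[OF k Tk])
    define r where "r = inv p j"
    have pr: "p r = j" unfolding r_def using permutes_inverses(1)[OF p] .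
    have rn: "r < n" using pn[of r] pr j(1) by simp
    have "\<not> r < s" using acc(2)[of r] kj pr by auto
    then have "?\<tau> s \<le> ?\<tau> r" using rn by (intro order_stat_mono) auto
    then have "threshold (?\<tau> r) \<le> threshold (?\<tau> s)"
      using order_stat_range[OF \<omega> rn] by (intro threshold_antimono)
    also have "\<dots> \<le> F (x ?k)" by (rule acc(1))
    also have "\<dots> \<le> F (x j)" using monoD[OF F_mono kj] .
    finally show False using j(3) arr[OF rn] pr by simp
  qed
  ultimately show ?thesis using t pt by (intro exI[of _ t]) (auto simp: accepts_at_def)
qed

lemma payoff_measurable:
  "(\<lambda>(x, (t, s)). if 0 < s \<and> s < t \<and> t < 1 then ennreal (payoff s t x / t) else 0)
    \<in> borel_measurable ((\<Pi>\<^sub>M i\<in>{..<n}. D i) \<Otimes>\<^sub>M (lborel \<Otimes>\<^sub>M lborel))"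
proof -
  let ?M = "(\<Pi>\<^sub>M i\<in>{..<n}. D i) \<Otimes>\<^sub>M ((lborel :: real measure) \<Otimes>\<^sub>M (lborel :: real measure))"
  have t [measurable]: "(\<lambda>z. fst (snd z)) \<in> borel_measurable ?M"
    by (rule measurable_compose[OF measurable_snd]) simp
  have s [measurable]: "(\<lambda>z. snd (snd z)) \<in> borel_measurable ?M"
    by (rule measurable_compose[OF measurable_snd]) simp
  have f: "(\<lambda>z. F (fst z k)) \<in> borel_measurable ?M" if "k \<in> {..<n}" for k
    using measurable_compose[OF measurable_compose[OF measurable_fst component_D_measurable] F_measurable, of k] that by simp
  have ths: "(\<lambda>z. threshold (snd (snd z))) \<in> borel_measurable ?M" by (rule measurable_compose[OF s threshold_measurable])
  have tht: "(\<lambda>z. threshold (fst (snd z))) \<in> borel_measurable ?M" by (rule measurable_compose[OF t threshold_measurable])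
  have 1: "Measurable.pred ?M (\<lambda>z. F (fst z k) < threshold (snd (snd z)))" if "k \<in> {..<n}" for k
    using borel_measurable_less[OF f[OF that] ths] unfolding pred_def .
  have 2: "Measurable.pred ?M (\<lambda>z. threshold (fst (snd z)) \<le> F (fst z k))" if "k \<in> {..<n}" for k
    using borel_measurable_le[OF tht f[OF that]] unfolding pred_def .
  have 3: "Measurable.pred ?M (\<lambda>z. threshold (snd (snd z)) \<le> F (fst z k))" if "k \<in> {..<n}" for k
    using borel_measurable_le[OF ths f[OF that]] unfolding pred_def .
  have A [measurable]: "Measurable.pred ?M (\<lambda>z. \<forall>k\<in>{..<n}. F (fst z k) < threshold (snd (snd z)))"
    by (intro pred_intros_finite 1) auto
  have B [measurable]: "Measurable.pred ?M (\<lambda>z. \<exists>k\<in>{..<n}. threshold (fst (snd z)) \<le> F (fst z k))"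
    by (intro pred_intros_finite 2) auto
  have C [measurable]: "(\<lambda>z. \<Prod>k\<in>{..<n}. if threshold (snd (snd z)) \<le> F (fst z k) then 1 - fst (snd z) else 1) \<in> borel_measurable ?M"
    by (intro borel_measurable_prod measurable_If borel_measurable_const borel_measurable_diff t 3[unfolded pred_def])
  have "(\<lambda>z. if 0 < snd (snd z) \<and> snd (snd z) < fst (snd z) \<and> fst (snd z) < 1 then
      ennreal ((if \<forall>k\<in>{..<n}. F (fst z k) < threshold (snd (snd z))
     then (if \<exists>k\<in>{..<n}. threshold (fst (snd z)) \<le> F (fst z k) then 1 else 0)
     else (\<Prod>k\<in>{..<n}. if threshold (snd (snd z)) \<le> F (fst z k) then 1 - fst (snd z) else 1) / (1 - fst (snd z))) / fst (snd z)) else 0)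
    \<in> borel_measurable ?M"
    by measurable
  moreover have "payoff s t x = (if \<forall>k\<in>{..<n}. F (x k) < threshold s
     then (if \<exists>k\<in>{..<n}. threshold t \<le> F (x k) then 1 else 0)
     else (\<Prod>k\<in>{..<n}. if threshold s \<le> F (x k) then 1 - t else 1) / (1 - t))" for s t x
    by (simp only: payoff_def thin_weight_def Ball_def Bex_def lessThan_iff)
  ultimately show ?thesis
    unfolding case_prod_beta' by (simp only:)
qed

text \<open>\<gamma> is the integral of \<open>success_density t s / t\<close>, which the mean of
  \<open>payoff\<close> dominates. Tonelli moves that mean outside; for almost all draws
  \<open>wins_prob\<close> applies, and \<open>nn_integral_arrival\<close> turns independent arrival
  times into the average over seeds and orders.\<close>

lemma success_prob_alg: "gamma_value c \<le> success_prob n D alg"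
proof -
  let ?X = "\<Pi>\<^sub>M i\<in>{..<n}. D i"
  let ?U = "\<Pi>\<^sub>M i\<in>{..<n}. unit_time"
  let ?O = "outcome_space n D alg"
  let ?S = "{(\<omega>, x, p) \<in> space ?O. \<exists>t<n. accepts_at alg \<omega> (\<lambda>s. x (p s)) t \<and> x (p t) = Max (x ` {..<n})}"
  have seed: "seed alg = ?U" by (simp add: alg_def)
  have S: "?S \<in> sets ?O" by (rule success_set_measurable[OF online_alg real_distribution_D])
  have U: "prob_space ?U" by (rule prob_space_times)
  interpret X: prob_space ?X by (intro prob_space_PiM prob_space_D)
  interpret XL: pair_sigma_finite ?X "lborel \<Otimes>\<^sub>M lborel :: (real \<times> real) measure"
    unfolding pair_sigma_finite_def lborel_prod by (simp add: X.sigma_finite_measure_axioms sigma_finite_lborel)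
  define H where "H x = (\<integral>\<^sup>+ T. indicator {T. wins x T} T \<partial>?U)" for x
  define \<Psi> where "\<Psi> = (\<lambda>(x, (t, s)). if 0 < s \<and> s < t \<and> t < 1 then ennreal (payoff s t x / t) else 0)"
  have \<Psi>m: "\<Psi> \<in> borel_measurable (?X \<Otimes>\<^sub>M (lborel \<Otimes>\<^sub>M lborel))"
    unfolding \<Psi>_def by (rule payoff_measurable)
  have split: "(\<integral>\<^sup>+ z. f z \<partial>(lborel \<Otimes>\<^sub>M lborel)) = (\<integral>\<^sup>+ t. \<integral>\<^sup>+ s. f (t, s) \<partial>lborel \<partial>lborel)"
    if "f \<in> borel_measurable (lborel \<Otimes>\<^sub>M lborel)" for f :: "real \<times> real \<Rightarrow> ennreal"
    by (rule lborel.nn_integral_fst[symmetric, OF that])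
  have restr: "(\<integral>\<^sup>+ t. \<integral>\<^sup>+ s. (if 0 < s \<and> s < t \<and> t < 1 then g t s else 0) \<partial>lborel \<partial>lborel) =
      (\<integral>\<^sup>+ t. (\<integral>\<^sup>+ s. g t s * indicator {0<..<t} s \<partial>lborel) * indicator {0<..<1} t \<partial>lborel)"
    for g :: "real \<Rightarrow> real \<Rightarrow> ennreal"
  proof (rule nn_integral_cong)
    fix t :: real
    show "(\<integral>\<^sup>+ s. (if 0 < s \<and> s < t \<and> t < 1 then g t s else 0) \<partial>lborel) =
      (\<integral>\<^sup>+ s. g t s * indicator {0<..<t} s \<partial>lborel) * indicator {0<..<1} t"
    proof (cases "0 < t \<and> t < 1")
      case True
      then show ?thesis by (simp, intro nn_integral_cong) (auto split: split_indicator)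
    next
      case False
      then have "(if 0 < s \<and> s < t \<and> t < 1 then g t s else 0) = 0" for s by auto
      then show ?thesis using False by simp
    qed
  qed
  have "ennreal (gamma_value c) =
      (\<integral>\<^sup>+ t. \<integral>\<^sup>+ s. (if 0 < s \<and> s < t \<and> t < 1 then ennreal (success_density t s / t) else 0) \<partial>lborel \<partial>lborel)"
    unfolding restr by (rule nn_integral_success_density[symmetric])
  also have "\<dots> \<le> (\<integral>\<^sup>+ t. \<integral>\<^sup>+ s. \<integral>\<^sup>+ x. \<Psi> (x, (t, s)) \<partial>?X \<partial>lborel \<partial>lborel)"
  proof (intro nn_integral_mono)
    fix t s :: real
    show "(if 0 < s \<and> s < t \<and> t < 1 then ennreal (success_density t s / t) else 0) \<le> (\<integral>\<^sup>+ x. \<Psi> (x, (t, s)) \<partial>?X)"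
    proof (cases "0 < s \<and> s < t \<and> t < 1")
      case True
      have [measurable]: "(\<lambda>x. \<Psi> (x, (t, s))) \<in> borel_measurable ?X"
        by (rule measurable_compose[OF measurable_Pair2' \<Psi>m]) (simp add: space_pair_measure)
      have "ennreal (success_density t s / t) = ennreal (1 / t) * ennreal (success_density t s)"
        using True by (simp flip: ennreal_mult')
      also have "\<dots> \<le> ennreal (1 / t) * (\<integral>\<^sup>+ x. ennreal (payoff s t x) \<partial>?X)"
        using True by (intro mult_left_mono expectation_payoff) auto
      also have "(\<integral>\<^sup>+ x. ennreal (payoff s t x) \<partial>?X) = (\<integral>\<^sup>+ x. ennreal t * \<Psi> (x, (t, s)) \<partial>?X)"
        using True by (intro nn_integral_cong) (simp add: \<Psi>_def flip: ennreal_mult')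
      also have "\<dots> = ennreal t * (\<integral>\<^sup>+ x. \<Psi> (x, (t, s)) \<partial>?X)"
        by (rule nn_integral_cmult) measurable
      also have "ennreal (1 / t) * (ennreal t * (\<integral>\<^sup>+ x. \<Psi> (x, (t, s)) \<partial>?X)) = (\<integral>\<^sup>+ x. \<Psi> (x, (t, s)) \<partial>?X)"
      proof -
        have "ennreal (1 / t) * ennreal t = 1" using True by (simp flip: ennreal_mult')
        then show ?thesis by (simp add: mult.assoc[symmetric])
      qed
      finally show ?thesis using True by simp
    next
      case False
      then show ?thesis by (simp only: if_False) simp
    qed
  qed
  also have "\<dots> = (\<integral>\<^sup>+ z. \<integral>\<^sup>+ x. \<Psi> (x, z) \<partial>?X \<partial>(lborel \<Otimes>\<^sub>M lborel))"
    by (rule split[symmetric])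
      (rule X.borel_measurable_nn_integral_fst[OF measurable_pair_swap[OF \<Psi>m], unfolded prod.case])
  also have "\<dots> = (\<integral>\<^sup>+ x. \<integral>\<^sup>+ z. \<Psi> (x, z) \<partial>(lborel \<Otimes>\<^sub>M lborel) \<partial>?X)"
    by (rule XL.Fubini[OF \<Psi>m])
  also have "\<dots> \<le> (\<integral>\<^sup>+ x. H x \<partial>?X)"
  proof (rule nn_integral_mono_AE)
    have "AE x in ?X. \<exists>i<n. \<forall>k<n. k \<noteq> i \<longrightarrow> x k < x i"
      by (rule AE_strict_max[OF D n])
    then show "AE x in ?X. (\<integral>\<^sup>+ z. \<Psi> (x, z) \<partial>(lborel \<Otimes>\<^sub>M lborel)) \<le> H x"
      using AE_space
    proof eventually_elim
      case (elim x)
      then obtain i where i: "i < n" "\<And>k. k < n \<Longrightarrow> k \<noteq> i \<Longrightarrow> x k < x i" by blast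
      have "(\<lambda>z. \<Psi> (x, z)) \<in> borel_measurable (lborel \<Otimes>\<^sub>M lborel)"
        by (rule measurable_compose[OF measurable_Pair1' \<Psi>m]) (rule elim(2))
      then have "(\<integral>\<^sup>+ z. \<Psi> (x, z) \<partial>(lborel \<Otimes>\<^sub>M lborel)) =
          (\<integral>\<^sup>+ t. (\<integral>\<^sup>+ s. ennreal (payoff s t x / t) * indicator {0<..<t} s \<partial>lborel) * indicator {0<..<1} t \<partial>lborel)"
        by (simp only: split \<Psi>_def prod.case restr)
      also have "\<dots> \<le> H x" unfolding H_def by (rule wins_prob[of i]) (use i in auto)
      finally show ?case .
    qed
  qed
  also have "\<dots> \<le> (\<integral>\<^sup>+ x. (\<integral>\<^sup>+ \<omega>. (\<Sum>p | p permutes {..<n}. indicator ?S (\<omega>, x, p)) \<partial>seed alg) / ennreal (real (fact n)) \<partial>?X)"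
  proof (rule nn_integral_mono)
    fix x assume x: "x \<in> space ?X"
    have wm: "(\<lambda>T. indicator {T. wins x T} T :: ennreal) \<in> borel_measurable ?U"
    proof -
      have "(\<lambda>T. if wins x T then 1 else 0 :: ennreal) \<in> borel_measurable ?U"
        using wins_measurable[of x, unfolded pred_def] by (intro measurable_If borel_measurable_const)
      then show ?thesis by (simp add: indicator_def of_bool_def)
    qed
    have "ennreal (real (fact n)) * H x = (\<integral>\<^sup>+ \<omega>. (\<Sum>p | p permutes {..<n}. indicator {T. wins x T} (arrival n \<omega> p)) \<partial>?U)"
      unfolding H_def by (rule nn_integral_arrival[OF wm, symmetric])
    also have "\<dots> \<le> (\<integral>\<^sup>+ \<omega>. (\<Sum>p | p permutes {..<n}. indicator ?S (\<omega>, x, p)) \<partial>?U)"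
    proof (intro nn_integral_mono sum_mono)
      fix \<omega> p assume \<omega>: "\<omega> \<in> space ?U" and p: "p \<in> {p. p permutes {..<n}}"
      have "(\<omega>, x, p) \<in> space ?O"
        using \<omega> p x by (simp add: outcome_space_def seed space_pair_measure space_uniform_count_measure)
      then have "(\<omega>, x, p) \<in> ?S" if "wins x (arrival n \<omega> p)"
        using wins_success[OF \<omega> _ that] p by simp
      then show "indicator {T. wins x T} (arrival n \<omega> p) \<le> (indicator ?S (\<omega>, x, p) :: ennreal)"
        by (simp add: indicator_def)
    qed
    finally have "ennreal (real (fact n)) * H x / ennreal (real (fact n)) \<le>
        (\<integral>\<^sup>+ \<omega>. (\<Sum>p | p permutes {..<n}. indicator ?S (\<omega>, x, p)) \<partial>?U) / ennreal (real (fact n))"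
      by (rule divide_right_mono_ennreal)
    then show "H x \<le> (\<integral>\<^sup>+ \<omega>. (\<Sum>p | p permutes {..<n}. indicator ?S (\<omega>, x, p)) \<partial>seed alg) / ennreal (real (fact n))"
      unfolding seed by (simp add: mult_divide_eq_ennreal mult.commute)
  qed
  also have "\<dots> = emeasure ?O ?S"
    by (rule emeasure_success_set[symmetric, OF _ prob_space_D S]) (use U seed in simp)
  finally have le: "ennreal (gamma_value c) \<le> emeasure ?O ?S" .
  interpret O: prob_space ?O
    by (rule prob_space_outcome_space) (use U seed prob_space_D in auto)
  have "ennreal (gamma_value c) \<le> ennreal (measure ?O ?S)"
    using le unfolding O.emeasure_eq_measure .
  then show ?thesis
    unfolding success_prob_def by (simp only: ennreal_le_iff[OF measure_nonneg])
qed

end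

section \<open>Combination of both bounds\<close>

lemma success_prob_cong:
  "(\<And>i. i < n \<Longrightarrow> D i = D' i) \<Longrightarrow> success_prob n D A = success_prob n D' A"
proof -
  assume "\<And>i. i < n \<Longrightarrow> D i = D' i"
  then have "(\<Pi>\<^sub>M i\<in>{..<n}. D i) = (\<Pi>\<^sub>M i\<in>{..<n}. D' i)" by (intro PiM_cong) auto
  then have "outcome_space n D A = outcome_space n D' A" by (simp only: outcome_space_def)
  then show ?thesis by (simp only: success_prob_def)
qed

lemma success_prob_le_1: 
  assumes "online_algorithm n A" "\<And>i. i < n \<Longrightarrow> real_distribution (D i)"
  shows "success_prob n D A \<le> 1"
proof -
  have "prob_space (outcome_space n D A)"
    by (rule prob_space_outcome_space) (use assms in \<open>auto simp: online_algorithm_def real_distribution_def\<close>)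
  then show ?thesis unfolding success_prob_def by (rule prob_space.prob_le_1)
qed

theorem theorem1:
  "\<exists>c \<gamma>.
     gamma_parameter c \<and> (\<forall>c'. gamma_parameter c' \<longrightarrow> c' = c) \<and> \<gamma> = gamma_value c \<and>
     (\<forall>E. continuous_distribution E \<longrightarrow>
        (\<lambda>m. optimal_success m (\<lambda>_. E)) \<longlonglongrightarrow> \<gamma> \<and>
        (INF m\<in>{1..}. optimal_success m (\<lambda>_. E)) = \<gamma>) \<and>
     (\<forall>(n::nat) D. n \<ge> 1 \<longrightarrow> (\<forall>i<n. continuous_distribution (D i)) \<longrightarrow>
        (\<exists>A. online_algorithm n A \<and> success_prob n D A \<ge> \<gamma>))"
proof -
  obtain c where c: "gamma_parameter c" using gamma_parameter_exists by blast
  interpret gamma_constant c by unfold_locales (rule c)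
  have lower: "\<exists>A. online_algorithm n A \<and> gamma_value c \<le> success_prob n D A"
    if n: "1 \<le> n" and D: "\<And>i. i < n \<Longrightarrow> continuous_distribution (D i)" for n D
  proof -
    \<comment> \<open>The locale asks for a continuous distribution at every index; indices from n
      on are filled with \<open>D 0\<close>, which leaves the success probability unchanged.\<close>
    define D' where "D' i = (if i < n then D i else D 0)" for i
    interpret secretary c n D'
      by unfold_locales (use n D in \<open>auto simp: D'_def\<close>)
    have "success_prob n D alg = success_prob n D' alg"
      by (rule success_prob_cong) (simp add: D'_def)
    then show ?thesis using online_alg success_prob_alg by auto
  qed
  have iid: "(\<lambda>m. optimal_success m (\<lambda>_. E)) \<longlonglongrightarrow> gamma_value c \<and>
      (INF m\<in>{1..}. optimal_success m (\<lambda>_. E)) = gamma_value c"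
    if E: "continuous_distribution E" for E
  proof -
    let ?v = "\<lambda>m. optimal_success m (\<lambda>_. E)"
    have rd: "real_distribution E" using E by (simp add: continuous_distribution_def)
    have ge: "gamma_value c \<le> ?v m" if m: "1 \<le> m" for m
    proof -
      obtain A where A: "online_algorithm m A" "gamma_value c \<le> success_prob m (\<lambda>_. E) A"
        using lower[OF m, of "\<lambda>_. E"] E by auto
      have "success_prob m (\<lambda>_. E) A \<le> ?v m"
        unfolding optimal_success_def
        using A(1) rd by (intro cSUP_upper bdd_aboveI2[of _ _ 1]) (auto intro: success_prob_le_1)
      with A(2) show ?thesis by simp
    qed
    have lim: "?v \<longlonglongrightarrow> gamma_value c"
    proof (rule order_tendstoI)
      fix a assume "a < gamma_value c"
      then show "\<forall>\<^sub>F m in sequentially. a < ?v m"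
        using ge by (intro eventually_sequentiallyI[of 1]) force
    next
      fix a assume a: "gamma_value c < a"
      define e where "e = (a - gamma_value c) / 2"
      have "0 < e" using a by (simp add: e_def)
      from eventually_success_prob_iid_le[OF E this] eventually_ge_at_top[of 1]
      show "\<forall>\<^sub>F m in sequentially. ?v m < a"
      proof eventually_elim
        case (elim m)
        \<comment> \<open>The lower bound supplies an algorithm, so the supremum is over a nonempty
          set.\<close>
        have "?v m \<le> gamma_value c + e"
          unfolding optimal_success_def
          using lower[OF elim(2), of "\<lambda>_. E"] E elim(1) by (intro cSUP_least) auto
        also have "\<dots> < a" using a by (simp add: e_def field_simps)
        finally show ?case .
      qed
    qed
    have "(INF m\<in>{1..}. ?v m) = gamma_value c"
    proof (rule antisym)
      show "gamma_value c \<le> (INF m\<in>{1..}. ?v m)"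
        by (rule cINF_greatest) (use ge in auto)
      have "bdd_below (?v ` {1..})" by (rule bdd_belowI2[of _ "gamma_value c"]) (use ge in auto)
      then have "\<forall>\<^sub>F m in sequentially. (INF m\<in>{1..}. ?v m) \<le> ?v m"
        by (intro eventually_sequentiallyI[of 1] cINF_lower) auto
      then show "(INF m\<in>{1..}. ?v m) \<le> gamma_value c"
        by (rule tendsto_lowerbound[OF lim]) simp
    qed
    with lim show ?thesis by simp
  qed
  show ?thesis
  proof (rule exI[of _ c], rule exI[of _ "gamma_value c"], intro conjI)
    show "gamma_parameter c" by (rule c)
    show "\<forall>c'. gamma_parameter c' \<longrightarrow> c' = c"
      using gamma_parameter_unique[OF c] by blast
    show "\<forall>E. continuous_distribution E \<longrightarrow>
        (\<lambda>m. optimal_success m (\<lambda>_. E)) \<longlonglongrightarrow> gamma_value c \<and>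
        (INF m\<in>{1..}. optimal_success m (\<lambda>_. E)) = gamma_value c"
      using iid by blast
    show "\<forall>(n::nat) D. n \<ge> 1 \<longrightarrow> (\<forall>i<n. continuous_distribution (D i)) \<longrightarrow>
        (\<exists>A. online_algorithm n A \<and> success_prob n D A \<ge> gamma_value c)"
    proof (intro allI impI)
      fix n :: nat and D
      assume "1 \<le> n" "\<forall>i<n. continuous_distribution (D i)"
      then show "\<exists>A. online_algorithm n A \<and> success_prob n D A \<ge> gamma_value c"
        by (intro lower) simp_all
    qed
  qed (rule refl)
qed

end
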